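(* Let $\Omega\subset\mathbb{C}^n$ be a bounded pseudoconvex domain with $C^k$ boundary, $3\leq k\leq\infty$. (1) Suppose that for some $0<\eta<1$ there exists a $C^2$ defining function $\rho_\eta$ for $\Omega$ such that $\lambda=-(-\rho_\eta)^\eta$ is plurisubharmonic on $U_\eta\cap\Omega$ for some neighborhood $U_\eta$ of $b\Omega$. Then for every $0<s<\eta$ there exist a neighborhood $U_s\subset U_\eta$ of $b\Omega$ and a function $\varphi_s\in C^\infty(U_s)$ such that for every nonzero $\tau\in T^{1,0}(b\Omega)$, on $b\Omega$ we have $$\frac{s}{1-s}\left|\partial\varphi_s(\tau)-2\alpha_\Omega(\tau)\right|^2<i\partial\bar\partial\varphi_s(\tau,\bar\tau)+2\beta_\Omega(\tau,\bar\tau).$$ (2) Suppose that for some $0<s<1$ there exist a neighborhood $U_s$ of $b\Omega$ and a function $\varphi_s\in C^k(U_s)$ such that for every $\tau\in T^{1,0}(b\Omega)$, on $b\Omega$ we have $$\frac{s}{1-s}\left|\partial\varphi_s(\tau)-2\alpha_\Omega(\tau)\right|^2\leq i\partial\bar\partial\varphi_s(\tau,\bar\tau)+2\beta_\Omega(\tau,\bar\tau).$$ Then for every $0<\eta<s$ there exists a $C^k$ defining function $\rho_\eta$ for $\Omega$ such that $\lambda=-(-\rho_\eta)^\eta$ is strictly plurisubharmonic on $U_\eta\cap\Omega$ for some neighborhood $U_\eta$ of $b\Omega$.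
   Context: Distance function. $\delta_\Omega(z)=\operatorname{dist}(z,b\Omega)$; the signed distance function is $\tilde\delta_\Omega=\delta_\Omega$ outside $\Omega$ and $\tilde\delta_\Omega=-\delta_\Omega$ on $\Omega$; it is $C^k$ on a neighborhood $U$ of $b\Omega$. Forms and vectors. For a real $(1,1)$-form $\Theta$ and $X,Y\in T^{1,0}$, $\Theta(X,\bar Y)=\Theta(-iX\wedge\bar Y)$; thus for $X=\sum_jX_j\frac{\partial}{\partial z_j}$ and $Y=\sum_kY_k\frac{\partial}{\partial z_k}$, $i\partial\bar\partial f(X,\bar Y)=\sum_{j,k}\frac{\partial^2f}{\partial z_j\partial\bar z_k}X_j\bar Y_k$. $T^{1,0}(b\Omega)$ consists of the $(1,0)$-vectors $\tau$ at points of $b\Omega$ with $\partial\tilde\delta_\Omega(\tau)=0$. The forms $\alpha_\Omega$ and $\beta_\Omega$. On $U$ define the real one-form $$\alpha_\Omega=4\sum_{j=1}^n\operatorname{Re}\left(\frac{\partial\tilde\delta_\Omega}{\partial\bar z_j}\bar\partial\left(\frac{\partial\tilde\delta_\Omega}{\partial z_j}\right)\right),$$ and, with $\pi_{1,0}\alpha_\Omega$ and $\pi_{0,1}\alpha_\Omega$ its $(1,0)$ and $(0,1)$ components, the real $(1,1)$-form $$\beta_\Omega=\sum_{j=1}^n i\left(\partial\frac{\partial\tilde\delta_\Omega}{\partial z_j}\wedge\bar\partial\frac{\partial\tilde\delta_\Omega}{\partial\bar z_j}+\partial\frac{\partial\tilde\delta_\Omega}{\partial\bar z_j}\wedge\bar\partial\frac{\partial\tilde\delta_\Omega}{\partial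 z_j}\right)-2i\,\pi_{1,0}\alpha_\Omega\wedge\pi_{0,1}\alpha_\Omega.$$ A $C^m$ defining function for $\Omega$ is a $C^m$ function $\rho$ on a neighborhood of $b\Omega$ which is negative in $\Omega$, positive outside $\overline\Omega$, zero on $b\Omega$, with $d\rho\neq0$ on $b\Omega$. *)

theory Defs
  imports "HOL-Analysis.Analysis" "HOL-Library.Extended_Nat"
begin

section \<open>Functions of class \<open>C\<^sup>k\<close> on open sets\<close>

fun Cn_on :: "nat \<Rightarrow> 'a::real_normed_vector set \<Rightarrow> ('a \<Rightarrow> 'b::real_normed_vector) \<Rightarrow> bool" where
  "Cn_on 0 S f \<longleftrightarrow> continuous_on S f"
| "Cn_on (Suc m) S f \<longleftrightarrow> (\<forall>x\<in>S. f differentiable (at x)) \<and>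
     (\<forall>v. Cn_on m S (\<lambda>x. frechet_derivative f (at x) v))"

text \<open>Only meant for open \<open>S\<close> and finite-dimensional domains, where continuity of the
  directional derivatives is continuity of the derivative; \<open>k = \<infinity>\<close> is smoothness.\<close>

definition Ck_on :: "enat \<Rightarrow> 'a::real_normed_vector set \<Rightarrow> ('a \<Rightarrow> 'b::real_normed_vector) \<Rightarrow> bool" where
  "Ck_on k S f \<longleftrightarrow> (\<forall>m::nat. enat m \<le> k \<longrightarrow> Cn_on m S f)"

section \<open>Vectors and forms on \<open>\<complex>\<^sup>n\<close>\<close>

text \<open>The pair \<open>(X, Y)\<close> is the complexified tangent vector
  \<open>\<Sum>\<^sub>j X\<^sub>j \<partial>/\<partial>z\<^sub>j + \<Sum>\<^sub>j Y\<^sub>j \<partial>/\<partial>z\<bar>\<^sub>j\<close>.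
  A complex one-form at a point is a complex-linear function of such a vector, a two-form
  an alternating bilinear function of two of them.\<close>

type_synonym 'n ctvec = "(complex^'n) \<times> (complex^'n)"
type_synonym 'n oneform = "'n ctvec \<Rightarrow> complex"
type_synonym 'n twoform = "'n ctvec \<Rightarrow> 'n ctvec \<Rightarrow> complex"

definition cnj_vec :: "complex^'n \<Rightarrow> complex^'n" where
  "cnj_vec X = (\<chi> j. cnj (X $ j))"

definition vec10 :: "complex^'n \<Rightarrow> 'n ctvec" where
  "vec10 X = (X, 0)"

definition cnj_ctvec :: "'n ctvec \<Rightarrow> 'n::finite ctvec" where
  "cnj_ctvec V = (cnj_vec (snd V), cnj_vec (fst V))"

definition Re_form :: "'n oneform \<Rightarrow> 'n::finite oneform" where
  "Re_form \<omega> = (\<lambda>V. (\<omega> V + cnj (\<omega> (cnj_ctvec V))) / 2)"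

definition pi10 :: "'n oneform \<Rightarrow> 'n::finite oneform" where
  "pi10 \<omega> = (\<lambda>V. \<omega> (fst V, 0))"

definition pi01 :: "'n oneform \<Rightarrow> 'n::finite oneform" where
  "pi01 \<omega> = (\<lambda>V. \<omega> (0, snd V))"

definition wedge :: "'n oneform \<Rightarrow> 'n oneform \<Rightarrow> 'n::finite twoform" where
  "wedge \<omega> \<theta> = (\<lambda>V W. \<omega> V * \<theta> W - \<omega> W * \<theta> V)"

text \<open>\<open>\<Theta>(X, Y\<bar>) = \<Theta>(- i X \<and> Y\<bar>)\<close>, where \<open>Y\<close> is the \<open>(1,0)\<close>-vector being conjugated.\<close>

definition form11_at :: "'n twoform \<Rightarrow> complex^'n \<Rightarrow> complex^'n \<Rightarrow> complex" where
  "form11_at \<Theta> X Y = - \<i> * \<Theta> (vec10 X) (cnj_ctvec (vec10 Y))"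

definition d_dz :: "'n::finite \<Rightarrow> (complex^'n \<Rightarrow> complex) \<Rightarrow> complex^'n \<Rightarrow> complex" where
  "d_dz j f p = (frechet_derivative f (at p) (axis j 1) - \<i> * frechet_derivative f (at p) (axis j \<i>)) / 2"

definition d_dzbar :: "'n::finite \<Rightarrow> (complex^'n \<Rightarrow> complex) \<Rightarrow> complex^'n \<Rightarrow> complex" where
  "d_dzbar j f p = (frechet_derivative f (at p) (axis j 1) + \<i> * frechet_derivative f (at p) (axis j \<i>)) / 2"

definition del :: "(complex^'n \<Rightarrow> complex) \<Rightarrow> complex^'n \<Rightarrow> 'n::finite oneform" where
  "del f p = (\<lambda>V. \<Sum>j\<in>UNIV. d_dz j f p * fst V $ j)"

definition delbar :: "(complex^'n \<Rightarrow> complex) \<Rightarrow> complex^'n \<Rightarrow> 'n::finite oneform" where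
  "delbar f p = (\<lambda>V. \<Sum>j\<in>UNIV. d_dzbar j f p * snd V $ j)"

text \<open>\<open>i \<partial>\<partial>\<bar> f = i \<Sum>\<^sub>k \<partial>(\<partial>f/\<partial>z\<bar>\<^sub>k) \<and> dz\<bar>\<^sub>k\<close>.\<close>

definition i_del_delbar :: "(complex^'n \<Rightarrow> complex) \<Rightarrow> complex^'n \<Rightarrow> 'n::finite twoform" where
  "i_del_delbar f p = (\<lambda>V W. \<i> * (\<Sum>k\<in>UNIV. wedge (del (d_dzbar k f) p) (\<lambda>V. snd V $ k) V W))"

lemma form11_i_del_delbar:
  "form11_at (i_del_delbar f p) X Y =
     (\<Sum>j\<in>UNIV. \<Sum>k\<in>UNIV. d_dz j (d_dzbar k f) p * X $ j * cnj (Y $ k))"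
proof -
  have "form11_at (i_del_delbar f p) X Y =
     (\<Sum>k\<in>UNIV. \<Sum>j\<in>UNIV. d_dz j (d_dzbar k f) p * X $ j * cnj (Y $ k))"
    by (simp add: form11_at_def i_del_delbar_def wedge_def del_def vec10_def cnj_ctvec_def
        cnj_vec_def sum_distrib_right flip: mult.assoc)
  then show ?thesis
    by (subst sum.swap)
qed

section \<open>Plurisubharmonic functions\<close>

text \<open>For real-valued (hence nowhere \<open>-\<infinity>\<close>) functions on an open set: upper semicontinuity
  and the sub-mean value inequality on every closed disc in a complex line. As the value at the centre
  is finite, the inequality forces integrability over the circle, which has to be stated because
  \<open>integral\<close> is \<open>0\<close> on non-integrable functions.\<close>

definition usc_on :: "'a::topological_space set \<Rightarrow> ('a \<Rightarrow> real) \<Rightarrow> bool" where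
  "usc_on S u \<longleftrightarrow> (\<forall>a\<in>S. \<forall>c>u a. \<forall>\<^sub>F x in at a within S. u x < c)"

definition psh_on :: "(complex^'n) set \<Rightarrow> (complex^'n \<Rightarrow> real) \<Rightarrow> bool" where
  "psh_on S u \<longleftrightarrow> usc_on S u \<and>
     (\<forall>a w. (\<forall>\<zeta>. cmod \<zeta> \<le> 1 \<longrightarrow> a + \<zeta> *s w \<in> S) \<longrightarrow>
        (\<lambda>t. u (a + cis t *s w)) absolutely_integrable_on {0..2*pi} \<and>
        u a \<le> integral {0..2*pi} (\<lambda>t. u (a + cis t *s w)) / (2*pi))"

text \<open>The usual \<open>C\<^sup>2\<close> notion: the complex Hessian is positive definite.\<close>

definition strictly_psh_on :: "(complex^'n) set \<Rightarrow> (complex^'n \<Rightarrow> real) \<Rightarrow> bool" where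
  "strictly_psh_on S u \<longleftrightarrow> Ck_on 2 S u \<and>
     (\<forall>p\<in>S. \<forall>X. X \<noteq> 0 \<longrightarrow> Re (form11_at (i_del_delbar (\<lambda>z. complex_of_real (u z)) p) X X) > 0)"

section \<open>Domains and distance functions\<close>

definition sdist :: "'a::metric_space set \<Rightarrow> 'a \<Rightarrow> real" where
  "sdist \<Omega> z = (if z \<in> \<Omega> then - infdist z (frontier \<Omega>) else infdist z (frontier \<Omega>))"

definition nbhd_of_boundary :: "'a::topological_space set \<Rightarrow> 'a set \<Rightarrow> bool" where
  "nbhd_of_boundary U \<Omega> \<longleftrightarrow> open U \<and> frontier \<Omega> \<subseteq> U"

text \<open>The neighbourhood \<open>W\<close> on which the defining function \<open>\<rho>\<close> lives is explicit; values of
  \<open>\<rho>\<close> off \<open>W\<close> are irrelevant.\<close>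

definition defining_function ::
  "enat \<Rightarrow> 'a::real_normed_vector set \<Rightarrow> 'a set \<Rightarrow> ('a \<Rightarrow> real) \<Rightarrow> bool" where
  "defining_function m \<Omega> W \<rho> \<longleftrightarrow>
     nbhd_of_boundary W \<Omega> \<and> Ck_on m W \<rho> \<and>
     (\<forall>z\<in>W \<inter> \<Omega>. \<rho> z < 0) \<and> (\<forall>z\<in>W - closure \<Omega>. \<rho> z > 0) \<and>
     (\<forall>z\<in>frontier \<Omega>. \<rho> z = 0 \<and> frechet_derivative \<rho> (at z) \<noteq> (\<lambda>v. 0))"

definition has_Ck_boundary :: "enat \<Rightarrow> 'a::real_normed_vector set \<Rightarrow> bool" where
  "has_Ck_boundary k \<Omega> \<longleftrightarrow> (\<exists>W \<rho>. defining_function k \<Omega> W \<rho>)"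

definition domain_set :: "'a::topological_space set \<Rightarrow> bool" where
  "domain_set \<Omega> \<longleftrightarrow> open \<Omega> \<and> connected \<Omega> \<and> \<Omega> \<noteq> {}"

text \<open>Hartogs pseudoconvexity, \<open>- log \<delta>\<close> plurisubharmonic; only meant for nonempty open
  \<open>\<Omega>\<close> other than the whole space, so that the boundary is nonempty.\<close>

definition pseudoconvex :: "(complex^'n) set \<Rightarrow> bool" where
  "pseudoconvex \<Omega> \<longleftrightarrow> psh_on \<Omega> (\<lambda>z. - ln (infdist z (frontier \<Omega>)))"

section \<open>The forms \<open>\<alpha>\<close> and \<open>\<beta>\<close>\<close>

abbreviation csdist :: "(complex^'n) set \<Rightarrow> complex^'n \<Rightarrow> complex" where
  "csdist \<Omega> \<equiv> (\<lambda>z. complex_of_real (sdist \<Omega> z))"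

definition T10_boundary :: "(complex^'n) set \<Rightarrow> ((complex^'n) \<times> (complex^'n)) set" where
  "T10_boundary \<Omega> = {(p, \<tau>). p \<in> frontier \<Omega> \<and> del (csdist \<Omega>) p (vec10 \<tau>) = 0}"

definition alpha_form :: "(complex^'n) set \<Rightarrow> complex^'n \<Rightarrow> 'n::finite oneform" where
  "alpha_form \<Omega> p = (\<lambda>V. 4 * (\<Sum>j\<in>UNIV.
     Re_form (\<lambda>W. d_dzbar j (csdist \<Omega>) p * delbar (d_dz j (csdist \<Omega>)) p W) V))"

definition beta_form :: "(complex^'n) set \<Rightarrow> complex^'n \<Rightarrow> 'n::finite twoform" where
  "beta_form \<Omega> p = (\<lambda>V W.
     (\<Sum>j\<in>UNIV. \<i> *
        (wedge (del (d_dz j (csdist \<Omega>)) p) (delbar (d_dzbar j (csdist \<Omega>)) p) V W +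
         wedge (del (d_dzbar j (csdist \<Omega>)) p) (delbar (d_dz j (csdist \<Omega>)) p) V W))
     - 2 * \<i> * wedge (pi10 (alpha_form \<Omega> p)) (pi01 (alpha_form \<Omega> p)) V W)"

text \<open>The two sides of the inequality at a boundary point; both \<open>(1,1)\<close>-forms on the right are
  real, so that taking the real part loses nothing.\<close>

definition ineq_lhs ::
  "(complex^'n) set \<Rightarrow> real \<Rightarrow> (complex^'n \<Rightarrow> real) \<Rightarrow> complex^'n \<Rightarrow> complex^'n \<Rightarrow> real" where
  "ineq_lhs \<Omega> s \<phi> p \<tau> = s / (1 - s) *
     (cmod (del (\<lambda>z. complex_of_real (\<phi> z)) p (vec10 \<tau>) - 2 * alpha_form \<Omega> p (vec10 \<tau>)))\<^sup>2"

definition ineq_rhs ::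
  "(complex^'n) set \<Rightarrow> (complex^'n \<Rightarrow> real) \<Rightarrow> complex^'n \<Rightarrow> complex^'n \<Rightarrow> real" where
  "ineq_rhs \<Omega> \<phi> p \<tau> =
     Re (form11_at (i_del_delbar (\<lambda>z. complex_of_real (\<phi> z)) p) \<tau> \<tau> + 2 * form11_at (beta_form \<Omega> p) \<tau> \<tau>)"

end

theory Submission
  imports Defs
begin

text \<open>
  Write \<open>r\<close> for the signed distance, \<open>\<nu>\<close> for its gradient and \<open>H\<close> for the derivative of \<open>\<nu>\<close>. Since \<open>\<nu>\<close> is
  constant along normals, \<open>H\<close> becomes \<open>H + \<delta> H\<^sup>2 + o(\<delta>)\<close> on tangential vectors at distance \<open>\<delta>\<close> inside the
  boundary; this is where \<open>\<beta>\<close> comes from, while \<open>\<alpha>\<close> is the mixed tangential-normal part of the Levi form of \<open>r\<close>.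

  For (2), put \<open>\<rho> = r exp (- \<phi> - \<kappa> |z|\<^sup>2)\<close> and test the Levi form of \<open>- (- \<rho>)\<^sup>\<eta>\<close> on \<open>\<tau> + \<delta> (a \<nu> + b i \<nu>)\<close>.
  The Levi form of the boundary divided by \<open>\<delta>\<close> is nonnegative; without it, the limit \<open>\<delta> \<rightarrow> 0\<close> is a quadratic
  polynomial in \<open>(a, b)\<close> whose minimum is the difference of the two sides of the boundary inequality.

  For (1), the natural choice \<open>- log (\<rho> / r)\<close> is only of class \<open>C\<^sup>1\<close> up to the boundary. It is replaced by
  \<open>- log (- \<rho> (z - \<epsilon> \<nu>(z)))\<close>, which is \<open>C\<^sup>2\<close> near the boundary. To second order in tangential directions this
  is the translate of \<open>- log (\<rho> / r)\<close> plus \<open>r / \<epsilon>\<close> plus a constant, and \<open>r / \<epsilon>\<close> supplies the Levi form of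
  the boundary. The passage from \<open>\<eta>\<close> to \<open>s\<close> pays for adding \<open>\<kappa> |z|\<^sup>2\<close>, and the resulting strict
  inequality survives a smooth approximation in \<open>C\<^sup>2\<close>.
\<close>

section \<open>Functions of class \<open>C\<^sup>k\<close>\<close>

text \<open>The weight \<eta> / (1 - \<eta>) comes from completing a square. A normal component (a,
  b), measured in units of the distance to the boundary, enters the limit through (1 - \<eta>)(a^2 +
  b^2) and through linear terms built from \<alpha> and the derivative of \<phi>; eliminating (a, b)
  divides the square of the linear coefficient by 1 - \<eta>. Uniformity in the point and the vector
  does not rest on explicit estimates: a failing sequence is normalised, a limit is extracted by
  compactness, and the limit contradicts the inequality at the boundary. Continuity of the second
  derivatives of the functions involved is then sufficient. The order of choices matters in (1):
  \<epsilon> is chosen so that the error is at most \<kappa>, hence \<kappa> must not depend on the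
  function which \<epsilon> produces. All computations are real: with J multiplication by i, a
  hermitian form at v is a sum of two values of a real quadratic form, at v and at J v. The
  regularity of the signed distance has to be derived too, since the hypothesis only provides some
  defining function of class C^k.\<close>

lemma Cn_on_transform:
  assumes "Cn_on m S f" "open S" "\<And>x. x \<in> S \<Longrightarrow> f x = g x"
  shows "Cn_on m S g"
  using assms
proof (induction m arbitrary: f g)
  case 0
  then show ?case by (simp cong: continuous_on_cong)
next
  case (Suc m)
  have der: "(g has_derivative frechet_derivative f (at x)) (at x)" if "x \<in> S" for x
    using Suc.prems that has_derivative_transform_within_open[of f _ x UNIV S g]
    by (auto simp: frechet_derivative_works)
  then have eq: "frechet_derivative g (at x) = frechet_derivative f (at x)" if "x \<in> S" for x
    using frechet_derivative_at that by metis
  show ?case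
    using der Suc.IH[of "\<lambda>x. frechet_derivative f (at x) v" "\<lambda>x. frechet_derivative g (at x) v" for v]
      Suc.prems eq by (auto simp: differentiable_def)
qed

lemma Cn_on_SucI:
  assumes "open S" "\<And>x. x \<in> S \<Longrightarrow> (f has_derivative f' x) (at x)" "\<And>v. Cn_on m S (\<lambda>x. f' x v)"
  shows "Cn_on (Suc m) S f"
proof -
  have "frechet_derivative f (at x) = f' x" if "x \<in> S" for x
    using frechet_derivative_at assms(2) that by metis
  then show ?thesis
    using assms Cn_on_transform[OF assms(3) assms(1)] by (auto simp: differentiable_def)
qed

lemma Cn_on_Suc_has_derivative:
  "Cn_on (Suc m) S f \<Longrightarrow> x \<in> S \<Longrightarrow> (f has_derivative frechet_derivative f (at x)) (at x)"
  by (simp add: frechet_derivative_works[symmetric])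

lemma Cn_on_subset: "Cn_on m S f \<Longrightarrow> T \<subseteq> S \<Longrightarrow> Cn_on m T f"
  by (induction m arbitrary: f) (auto intro: continuous_on_subset)

lemma Cn_on_SucD: "Cn_on (Suc m) S f \<Longrightarrow> Cn_on m S f"
proof (induction m arbitrary: f)
  case 0
  then show ?case
    by (auto intro!: continuous_at_imp_continuous_on differentiable_imp_continuous_within)
qed auto

lemma Cn_on_mono: "Cn_on m S f \<Longrightarrow> l \<le> m \<Longrightarrow> Cn_on l S f"
proof (induction m)
  case (Suc m)
  show ?case
  proof (cases "l = Suc m")
    case False
    then show ?thesis
      using Suc.IH Cn_on_SucD[OF Suc.prems(1)] Suc.prems(2) by linarith
  qed (use Suc.prems in blast)
qed simp

lemma Cn_on_continuous: "Cn_on m S f \<Longrightarrow> continuous_on S f"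
  by (drule Cn_on_mono[of m S f 0]) simp_all

lemma Cn_on_localI:
  assumes "\<And>x. x \<in> S \<Longrightarrow> \<exists>T. open T \<and> x \<in> T \<and> Cn_on m T f"
  shows "Cn_on m S f"
  using assms
proof (induction m arbitrary: f)
  case 0
  show ?case
    unfolding Cn_on.simps
  proof (intro continuous_at_imp_continuous_on ballI)
    fix x assume "x \<in> S"
    from 0[OF this] obtain T where "open T" "x \<in> T" "continuous_on T f" by auto
    then show "isCont f x" by (simp add: continuous_on_eq_continuous_at)
  qed
next
  case (Suc m)
  have "f differentiable at x" if "x \<in> S" for x
    using Suc.prems[OF that] by auto
  moreover have "Cn_on m S (\<lambda>x. frechet_derivative f (at x) v)" for v
  proof (rule Suc.IH)
    fix x assume "x \<in> S"
    from Suc.prems[OF this] obtain T where "open T" "x \<in> T" "Cn_on (Suc m) T f" by blast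
    then show "\<exists>T. open T \<and> x \<in> T \<and> Cn_on m T (\<lambda>x. frechet_derivative f (at x) v)"
      by (intro exI[of _ T]) simp
  qed
  ultimately show ?case by simp
qed

lemma Cn_on_const [simp]: "Cn_on m S (\<lambda>x. c)"
  by (induction m arbitrary: c) auto

lemma Cn_on_add:
  assumes "open S" "Cn_on m S f" "Cn_on m S g"
  shows "Cn_on m S (\<lambda>x. f x + g x)"
  using assms(2,3)
proof (induction m arbitrary: f g)
  case 0
  then show ?case by (auto intro: continuous_intros)
next
  case (Suc m)
  show ?case
    by (rule Cn_on_SucI[OF assms(1) has_derivative_add[OF
          Cn_on_Suc_has_derivative[OF Suc.prems(1)] Cn_on_Suc_has_derivative[OF Suc.prems(2)]]])
      (use Suc in auto)
qed

lemma Cn_on_bounded_linear: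
  assumes "bounded_linear L" "open S" "Cn_on m S f"
  shows "Cn_on m S (\<lambda>x. L (f x))"
  using assms(3)
proof (induction m arbitrary: f)
  case 0
  then show ?case by (auto intro: bounded_linear.continuous_on[OF assms(1)])
next
  case (Suc m)
  show ?case
    by (rule Cn_on_SucI[OF assms(2) bounded_linear.has_derivative[OF assms(1) 
          Cn_on_Suc_has_derivative[OF Suc.prems(1)]]])
      (use Suc in auto)
qed

lemma Cn_on_bounded_bilinear:
  assumes "bounded_bilinear P" "open S" "Cn_on m S f" "Cn_on m S g"
  shows "Cn_on m S (\<lambda>x. P (f x) (g x))"
  using assms(3,4)
proof (induction m arbitrary: f g)
  case 0
  then show ?case by (auto intro: bounded_bilinear.continuous_on[OF assms(1)])
next
  case (Suc m)
  show ?case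
    by (rule Cn_on_SucI[OF assms(2) bounded_bilinear.FDERIV[OF assms(1) 
          Cn_on_Suc_has_derivative[OF Suc.prems(1)] Cn_on_Suc_has_derivative[OF Suc.prems(2)]]])
      (use Suc.prems Cn_on_SucD[OF Suc.prems(1)] Cn_on_SucD[OF Suc.prems(2)] in 
        \<open>auto intro!: Cn_on_add assms(2) Suc.IH\<close>)
qed

lemmas Cn_on_mult = Cn_on_bounded_bilinear[OF bounded_bilinear_mult]
lemmas Cn_on_scaleR = Cn_on_bounded_bilinear[OF bounded_bilinear_scaleR]
lemmas Cn_on_inner = Cn_on_bounded_bilinear[OF bounded_bilinear_inner]

lemma Cn_on_minus: "open S \<Longrightarrow> Cn_on m S f \<Longrightarrow> Cn_on m S (\<lambda>x. - f x)"
  by (rule Cn_on_bounded_linear[OF bounded_linear_minus[OF bounded_linear_ident]])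

lemma Cn_on_diff:
  "open S \<Longrightarrow> Cn_on m S f \<Longrightarrow> Cn_on m S g \<Longrightarrow> Cn_on m S (\<lambda>x. f x - g x)"
  using Cn_on_add[of S m f "\<lambda>x. - g x"] Cn_on_minus[of S m g] by simp

lemma Cn_on_sum:
  "open S \<Longrightarrow> (\<And>i. i \<in> I \<Longrightarrow> Cn_on m S (f i)) \<Longrightarrow> Cn_on m S (\<lambda>x. \<Sum>i\<in>I. f i x)"
  by (induction I rule: infinite_finite_induct) (auto intro: Cn_on_add)

lemma Cn_on_id: "open S \<Longrightarrow> Cn_on m S (\<lambda>x. x)"
proof (cases m)
  case (Suc l)
  assume "open S"
  then show ?thesis
    unfolding Suc by (rule Cn_on_SucI) (auto intro: has_derivative_ident)
qed auto

lemma Cn_on_linear: "bounded_linear L \<Longrightarrow> open S \<Longrightarrow> Cn_on m S L"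
  using Cn_on_bounded_linear[of L S m "\<lambda>x. x"] Cn_on_id by blast

section \<open>Composition and elementary functions\<close>

lemma linear_eq_sum_Basis:
  fixes f :: "'a::euclidean_space \<Rightarrow> 'b::real_vector"
  assumes "linear f"
  shows "f w = (\<Sum>b\<in>Basis. (w \<bullet> b) *\<^sub>R f b)"
proof -
  have "f (\<Sum>b\<in>Basis. (w \<bullet> b) *\<^sub>R b) = (\<Sum>b\<in>Basis. (w \<bullet> b) *\<^sub>R f b)"
    by (simp add: linear_sum[OF assms] linear_scale[OF assms] o_def)
  then show ?thesis by (simp add: euclidean_representation)
qed

text \<open>\<open>Cn_on\<close> speaks of derivatives in fixed directions, whereas the chain rule
  evaluates the derivative of \<open>g\<close> in the moving direction supplied by the derivative of
  \<open>f\<close>. Expanding that direction in the basis leads back to fixed directions, where the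
  induction hypothesis and the product rule apply.\<close>

lemma Cn_on_compose:
  fixes f :: "'a::real_normed_vector \<Rightarrow> 'b::euclidean_space"
  assumes "open S" "open T" "\<And>x. x \<in> S \<Longrightarrow> f x \<in> T" "Cn_on m S f" "Cn_on m T g"
  shows "Cn_on m S (\<lambda>x. g (f x))"
  using assms(4,5)
proof (induction m arbitrary: g)
  case 0
  then show ?case using assms(3) by (auto intro: continuous_on_compose2)
next
  case (Suc m)
  have d: "((\<lambda>x. g (f x)) has_derivative
      (\<lambda>v. \<Sum>b\<in>Basis. (frechet_derivative f (at x) v \<bullet> b) *\<^sub>R frechet_derivative g (at (f x)) b)) (at x)"
    if "x \<in> S" for x
  proof -
    have g: "(g has_derivative frechet_derivative g (at (f x))) (at (f x))"
      using Cn_on_Suc_has_derivative[OF Suc.prems(2)] assms(3) that by blast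
    have "((\<lambda>x. g (f x)) has_derivative
        (\<lambda>v. frechet_derivative g (at (f x)) (frechet_derivative f (at x) v))) (at x)"
      using has_derivative_compose[OF Cn_on_Suc_has_derivative[OF Suc.prems(1) that] g] .
    moreover have "(\<lambda>v. frechet_derivative g (at (f x)) (frechet_derivative f (at x) v)) =
        (\<lambda>v. \<Sum>b\<in>Basis. (frechet_derivative f (at x) v \<bullet> b) *\<^sub>R frechet_derivative g (at (f x)) b)"
      by (intro ext linear_eq_sum_Basis[OF has_derivative_linear[OF g]])
    ultimately show ?thesis by (simp only:)
  qed
  have "Cn_on m S (\<lambda>x. frechet_derivative g (at (f x)) b)" for b
    using Suc.IH[of "\<lambda>z. frechet_derivative g (at z) b"] Cn_on_SucD[OF Suc.prems(1)] Suc.prems(2) by simp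
  then show ?case
    using Suc.prems(1)
    by (intro Cn_on_SucI[OF assms(1) d] Cn_on_sum Cn_on_scaleR assms(1) 
        Cn_on_bounded_linear[OF bounded_linear_inner_left]) auto
qed

lemma Cn_on_real_SucI:
  fixes f :: "real \<Rightarrow> real"
  assumes "open S" "\<And>x. x \<in> S \<Longrightarrow> (f has_real_derivative f' x) (at x)" "Cn_on m S f'"
  shows "Cn_on (Suc m) S f"
proof (rule Cn_on_SucI[OF assms(1)])
  show "(f has_derivative (\<lambda>v. f' x * v)) (at x)" if "x \<in> S" for x
    using assms(2)[OF that] by (simp add: has_field_derivative_def)
  show "Cn_on m S (\<lambda>x. f' x * v)" for v
    using assms by (intro Cn_on_mult) auto
qed

lemma Cn_on_exp: "Cn_on m UNIV (exp :: real \<Rightarrow> real)"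
proof (induction m)
  case (Suc m)
  show ?case
    by (rule Cn_on_real_SucI[OF open_UNIV DERIV_exp Suc])
qed (simp add: continuous_on_exp)

lemma Cn_on_inverse: "Cn_on m (- {0}) (inverse :: real \<Rightarrow> real)"
proof (induction m)
  case (Suc m)
  show ?case
  proof (rule Cn_on_real_SucI)
    show "(inverse has_real_derivative - (inverse x * inverse x)) (at x)" if "x \<in> -{0}" for x :: real
      using DERIV_inverse[of x] that by (simp add: power2_eq_square)
  qed (use Suc in \<open>auto intro!: Cn_on_minus Cn_on_mult\<close>)
qed (simp add: continuous_on_inverse)

lemma Cn_on_ln: "Cn_on m {0<..} (ln :: real \<Rightarrow> real)"
proof (cases m)
  case 0
  then show ?thesis by (simp add: continuous_on_ln)
next
  case (Suc l)
  show ?thesis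
    unfolding Suc
  proof (rule Cn_on_real_SucI)
    show "(ln has_real_derivative inverse x) (at x)" if "x \<in> {0<..}" for x :: real
      using DERIV_ln[of x] that by simp
  qed (auto intro: Cn_on_subset[OF Cn_on_inverse])
qed

lemma Cn_on_sqrt: "Cn_on m {0<..} sqrt"
proof -
  have "Cn_on m {0<..} (\<lambda>x::real. exp (ln x / 2))"
    by (rule Cn_on_compose[OF _ open_UNIV _ _ Cn_on_exp])
      (auto intro!: Cn_on_bounded_linear[OF bounded_linear_divide] Cn_on_ln)
  moreover have "exp (ln x / 2) = sqrt x" if "x \<in> {0<..}" for x :: real
    using that by (simp flip: ln_sqrt)
  ultimately show ?thesis
    using Cn_on_transform[of m "{0<..}" "\<lambda>x::real. exp (ln x / 2)" sqrt] by simp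
qed

lemma Cn_on_powr: "Cn_on m {0<..} (\<lambda>x::real. x powr a)"
proof -
  have "Cn_on m {0<..} (\<lambda>x::real. exp (a * ln x))"
    by (rule Cn_on_compose[OF _ open_UNIV _ _ Cn_on_exp])
      (auto intro!: Cn_on_bounded_linear[OF bounded_linear_mult_right] Cn_on_ln)
  then show ?thesis
    by (rule Cn_on_transform) (auto simp: powr_def)
qed

lemma Cn_on_Pair:
  assumes "open S" "Cn_on m S f" "Cn_on m S g"
  shows "Cn_on m S (\<lambda>x. (f x, g x))"
proof -
  have "Cn_on m S (\<lambda>x. (f x, 0) + (0, g x))"
    using assms by (intro Cn_on_add Cn_on_bounded_linear[of "\<lambda>x. (x,0)"]
      Cn_on_bounded_linear[of "\<lambda>x. (0,x)"] bounded_linear_Pair bounded_linear_ident bounded_linear_zero)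
  then show ?thesis by simp
qed

section \<open>Linear systems depending on a parameter\<close>

lemma linear_solve_estimate:
  fixes A :: "'a::real_normed_vector \<Rightarrow> 'b::euclidean_space \<Rightarrow> 'b"
  assumes S: "open S" and lin: "\<And>y. y \<in> S \<Longrightarrow> linear (A y)" and inj: "\<And>y. y \<in> S \<Longrightarrow> inj (A y)"
    and A: "\<And>w. continuous_on S (\<lambda>y. A y w)" and u: "\<And>y. y \<in> S \<Longrightarrow> A y (u y) = v y" and y: "y \<in> S"
  shows "\<exists>c>0. \<exists>E. (E \<longlongrightarrow> 0) (at y) \<and> (\<forall>w. c * norm w \<le> norm (A y w)) \<and>
      (\<forall>\<^sub>F y' in at y. (\<forall>w. norm (A y w - A y' w) \<le> E y' * norm w) \<and> 0 \<le> E y' \<and> 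
        norm (u y' - u y) \<le> (2 / c) * norm (v y' - A y' (u y)) \<and>
        A y (u y' - u y) = (A y (u y' - u y) - A y' (u y' - u y)) + (v y' - A y' (u y)))"
proof -
  obtain c where c: "c > 0" "\<And>w. c * norm w \<le> norm (A y w)"
    using linear_inj_bounded_below_pos[OF lin[OF y] inj[OF y]] by blast
  define E where "E y' = (\<Sum>b\<in>Basis. norm (A y b - A y' b))" for y'
  have E0: "(E \<longlongrightarrow> 0) (at y)"
  proof -
    have "((\<lambda>y'. \<Sum>b\<in>Basis. norm (A y b - A y' b)) \<longlongrightarrow> (\<Sum>b\<in>Basis. norm (A y b - A y b))) (at y)"
      using A y S by (intro tendsto_intros) (auto simp: continuous_on_eq_continuous_at isCont_def)
    then show ?thesis by (simp add: E_def[abs_def])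
  qed
  have Ew: "norm (A y w - A y' w) \<le> E y' * norm w" if "y' \<in> S" for y' w
  proof -
    have "linear (\<lambda>w. A y w - A y' w)"
      using lin y that by (intro linear_compose_sub) auto
    then have "A y w - A y' w = (\<Sum>b\<in>Basis. (w \<bullet> b) *\<^sub>R (A y b - A y' b))"
      by (rule linear_eq_sum_Basis)
    also have "norm \<dots> \<le> (\<Sum>b\<in>Basis. norm w * norm (A y b - A y' b))"
      by (intro sum_norm_le) (auto intro!: mult_right_mono Basis_le_norm)
    finally show ?thesis
      by (simp add: E_def sum_distrib_left[symmetric] mult.commute)
  qed
  have evS: "\<forall>\<^sub>F y' in at y. y' \<in> S"
    using S y by (simp add: eventually_at_in_open')
  \<comment> \<open>Half of the lower bound \<open>c\<close> at \<open>y\<close> absorbs the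
    perturbation, so that \<open>A y'\<close> is bounded below by c / 2 near \<open>y\<close>. This
    is the origin of the factor 2 / c.\<close>
  have evE: "\<forall>\<^sub>F y' in at y. E y' < c / 2"
    using order_tendstoD(2)[OF E0, of "c/2"] c by simp
  have Epos: "0 \<le> E y'" for y'
    by (auto simp: E_def intro: sum_nonneg)
  have ev: "\<forall>\<^sub>F y' in at y. y' \<in> S \<and> (\<forall>w. norm (A y w - A y' w) \<le> E y' * norm w) \<and> 0 \<le> E y' \<and> E y' \<le> c / 2"
    using evS evE by eventually_elim (use Ew Epos in auto)
    have "\<forall>\<^sub>F y' in at y. (\<forall>w. norm (A y w - A y' w) \<le> E y' * norm w) \<and> 0 \<le> E y' \<and> 
        norm (u y' - u y) \<le> (2 / c) * norm (v y' - A y' (u y)) \<and>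
        A y (u y' - u y) = (A y (u y' - u y) - A y' (u y' - u y)) + (v y' - A y' (u y))"
      using ev
    proof eventually_elim
      case (elim y')
      have *: "A y' (u y' - u y) = v y' - A y' (u y)"
        using elim u lin by (simp add: linear_diff)
      have "c * norm (u y' - u y) \<le> norm (A y (u y' - u y))" using c by blast
      also have "\<dots> \<le> norm (A y (u y' - u y) - A y' (u y' - u y)) + norm (A y' (u y' - u y))"
        by (metis diff_add_cancel norm_triangle_ineq)
      also have "\<dots> \<le> c / 2 * norm (u y' - u y) + norm (v y' - A y' (u y))"
        unfolding * using elim by (smt (verit) * mult_right_mono norm_ge_zero)
      finally show ?case
        using * c(1) elim by (simp add: field_simps)
    qed
    then show ?thesis using c E0 by blast
qed

text \<open>Implicit differentiation of A u = v: the derivative of \<open>u\<close> solves a system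
  with the same operator \<open>A\<close> and right side v' - A' u, so the induction can run over
  the right side and the solution while \<open>A\<close> stays fixed. No formula for the inverse is
  differentiated.\<close>

lemma Cn_on_linear_solve:
  fixes A :: "'a::euclidean_space \<Rightarrow> 'b::euclidean_space \<Rightarrow> 'b"
  assumes S: "open S" and lin: "\<And>y. y \<in> S \<Longrightarrow> linear (A y)" and inj: "\<And>y. y \<in> S \<Longrightarrow> inj (A y)"
    and A: "\<And>w. Cn_on m S (\<lambda>y. A y w)" and v: "Cn_on m S v" and u: "\<And>y. y \<in> S \<Longrightarrow> A y (u y) = v y"
  shows "Cn_on m S u"
  using A v u
proof (induction m arbitrary: u v)
  case 0
    show ?case
      unfolding Cn_on.simps
    proof (intro continuous_at_imp_continuous_on ballI)
      fix y assume y: "y \<in> S"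
      have "continuous_on S (\<lambda>y. A y w)" for w
        using 0(1) by simp
      from linear_solve_estimate[where A=A and S=S and u=u and v=v and y=y, OF S lin inj this 0(3) y]
      obtain c E where "\<forall>\<^sub>F y' in at y. (\<forall>w. norm (A y w - A y' w) \<le> E y' * norm w) \<and> 0 \<le> E y' \<and> 
        norm (u y' - u y) \<le> (2 / c) * norm (v y' - A y' (u y)) \<and>
        A y (u y' - u y) = (A y (u y' - u y) - A y' (u y' - u y)) + (v y' - A y' (u y))" by blast
      then have c: "\<forall>\<^sub>F y' in at y. norm (u y' - u y) \<le> (2 / c) * norm (v y' - A y' (u y))"
        by eventually_elim blast
      have "((\<lambda>y'. (2 / c) * norm (v y' - A y' (u y))) \<longlongrightarrow> (2/c) * norm (v y - A y (u y))) (at y)"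
        using 0(1,2) y S by (intro tendsto_intros) (auto simp: continuous_on_eq_continuous_at isCont_def)
      then have "((\<lambda>y'. (2 / c) * norm (v y' - A y' (u y))) \<longlongrightarrow> 0) (at y)"
        using 0 y by simp
      then have "((\<lambda>y'. u y' - u y) \<longlongrightarrow> 0) (at y)"
        using Lim_null_comparison[OF c] by blast
      then show "isCont u y"
        by (simp add: isCont_def LIM_zero_iff)
    qed
  next
    case (Suc m)
    \<comment> \<open>Right side of the differentiated system; the vector \<open>u y\<close> is
      frozen while \<open>A\<close> is differentiated.\<close>
    define B where "B y h = frechet_derivative v (at y) h - frechet_derivative (\<lambda>z. A z (u y)) (at y) h" for y h
    define u' where "u' y h = inv (A y) (B y h)" for y h
    have Au': "A y (u' y h) = B y h" if "y \<in> S" for y h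
      unfolding u'_def using lin inj that
      by (simp add: linear_injective_imp_surjective surj_f_inv_f)
    \<comment> \<open>The data with one order less already give \<open>u\<close> of class
      \<open>m\<close>; the right side \<open>B\<close> contains \<open>u\<close> and needs
      this.\<close>
    have Cu: "Cn_on m S u"
      using Suc.IH[of v u] Suc.prems Cn_on_SucD by metis
    have der: "(u has_derivative u' y) (at y)" if y: "y \<in> S" for y
    proof -
      have Bder: "((\<lambda>y'. v y' - A y' (u y)) has_derivative B y) (at y)"
        unfolding B_def using Suc.prems y
        by (intro has_derivative_diff Cn_on_Suc_has_derivative) auto
      have linB: "bounded_linear (B y)"
        using Bder by (rule has_derivative_bounded_linear)
      have linu': "linear (u' y)"
      proof (rule linearI)
        have eq: "w = w'" if "A y w = A y w'" for w w'
          using inj[OF y] that by (rule injD)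
        show "u' y (h + k) = u' y h + u' y k" for h k
          by (rule eq) (simp add: Au'[OF y] linear_add[OF lin[OF y]] linear_add[OF bounded_linear.linear[OF linB]])
        show "u' y (r *\<^sub>R h) = r *\<^sub>R u' y h" for r h
          by (rule eq) (simp add: Au'[OF y] linear_scale[OF lin[OF y]] linear_scale[OF bounded_linear.linear[OF linB]])
      qed
      obtain K where K: "\<And>h. norm (B y h) \<le> norm h * K"
        using bounded_linear.bounded[OF linB] by blast
      have contA: "continuous_on S (\<lambda>y. A y w)" for w
        using Suc.prems(1) Cn_on_continuous by blast
      from linear_solve_estimate[where A=A and S=S and u=u and v=v and y=y, OF S lin inj contA Suc.prems(3) y]
      obtain c E where c: "c > 0" "(E \<longlongrightarrow> 0) (at y)" "\<And>w. c * norm w \<le> norm (A y w)" and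
        ev: "\<forall>\<^sub>F y' in at y. (\<forall>w. norm (A y w - A y' w) \<le> E y' * norm w) \<and> 0 \<le> E y' \<and> 
        norm (u y' - u y) \<le> (2 / c) * norm (v y' - A y' (u y)) \<and>
        A y (u y' - u y) = (A y (u y' - u y) - A y' (u y' - u y)) + (v y' - A y' (u y))" by blast
      define R where "R y' = norm (v y' - A y' (u y) - B y (y' - y)) / norm (y' - y)" for y'
      have R: "(R \<longlongrightarrow> 0) (at y)"
        using Bder Suc.prems(3)[OF y] unfolding R_def[abs_def]
        by (simp add: has_derivative_iff_norm)
      have "((\<lambda>y'. norm (u y' - u y - u' y (y' - y)) / norm (y' - y)) \<longlongrightarrow> 0) (at y)"
      proof (rule Lim_null_comparison)
        \<comment> \<open>Two contributions to the error: the variation \<open>E\<close> of the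
          operator times a bound for the difference quotient of \<open>u\<close>, and the first
          order remainder \<open>R\<close> of the right side.\<close>
        show "((\<lambda>y'. (E y' * ((2 / c) * (R y' + K)) + R y') / c) \<longlongrightarrow> 0) (at y)"
          using c(1) by (auto intro!: tendsto_eq_intros c(2) R)
        show "\<forall>\<^sub>F y' in at y. norm (norm (u y' - u y - u' y (y' - y)) / norm (y' - y)) \<le>
            (E y' * ((2 / c) * (R y' + K)) + R y') / c"
          using ev eventually_neq_at_within[of y y UNIV]
        proof eventually_elim
          case (elim y')
          let ?h = "y' - y" and ?V = "v y' - A y' (u y)"
          have h: "norm ?h > 0" using elim by simp
          have "c * norm (u y' - u y - u' y ?h) \<le> norm (A y (u y' - u y - u' y ?h))"
            using c by blast
          also have "A y (u y' - u y - u' y ?h) = A y (u y' - u y) - B y ?h"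
            using lin[OF y] Au'[OF y] by (simp add: linear_diff)
          also have "\<dots> = (A y (u y' - u y) - A y' (u y' - u y)) + (?V - B y ?h)"
            using elim by (simp add: algebra_simps)
          also have "norm \<dots> \<le> E y' * norm (u y' - u y) + norm (?V - B y ?h)"
            using elim by (meson add_mono_thms_linordered_semiring(3) norm_triangle_le)
          also have "E y' * norm (u y' - u y) \<le> E y' * ((2 / c) * norm ?V)"
            using elim by (intro mult_left_mono) auto
          also have "\<dots> \<le> E y' * ((2 / c) * (norm (?V - B y ?h) + norm ?h * K))"
            using elim c(1) K[of ?h] norm_triangle_ineq[of "?V - B y ?h" "B y ?h"]
            by (intro mult_left_mono) auto
          finally have "c * norm (u y' - u y - u' y ?h) \<le> 
            E y' * ((2 / c) * (norm (?V - B y ?h) + norm ?h * K)) + norm (?V - B y ?h)" by simp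
          also have "norm (?V - B y ?h) = R y' * norm ?h"
            using h by (simp add: R_def)
          finally show ?case
            using h c(1) by (simp add: field_simps)
        qed
      qed
      then show ?thesis
        using linu' by (auto simp: has_derivative_iff_norm linear_conv_bounded_linear)
    qed
    have "Cn_on m S (\<lambda>y. u' y h)" for h
    proof (rule Suc.IH)
      have dA: "frechet_derivative (\<lambda>z. A z w) (at y) h = 
          (\<Sum>b\<in>Basis. (w \<bullet> b) *\<^sub>R frechet_derivative (\<lambda>z. A z b) (at y) h)" if y: "y \<in> S" for y w
      proof -
        have "((\<lambda>z. \<Sum>b\<in>Basis. (w \<bullet> b) *\<^sub>R A z b) has_derivative 
            (\<lambda>h. \<Sum>b\<in>Basis. (w \<bullet> b) *\<^sub>R frechet_derivative (\<lambda>z. A z b) (at y) h)) (at y)"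
          using Suc.prems(1) y
          by (intro has_derivative_sum has_derivative_scaleR_right Cn_on_Suc_has_derivative) auto
        then have "((\<lambda>z. A z w) has_derivative 
            (\<lambda>h. \<Sum>b\<in>Basis. (w \<bullet> b) *\<^sub>R frechet_derivative (\<lambda>z. A z b) (at y) h)) (at y)"
          by (rule has_derivative_transform_within_open[OF _ S y])
            (simp add: linear_eq_sum_Basis[OF lin, of _ w])
        from frechet_derivative_at[OF this] show ?thesis by (rule fun_cong[OF sym])
      qed
      have "Cn_on m S (\<lambda>y. frechet_derivative v (at y) h - 
          (\<Sum>b\<in>Basis. (u y \<bullet> b) *\<^sub>R frechet_derivative (\<lambda>z. A z b) (at y) h))"
        using Suc.prems Cu S
        by (intro Cn_on_diff Cn_on_sum Cn_on_scaleR Cn_on_inner) auto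
      then show "Cn_on m S (\<lambda>y. B y h)"
        by (rule Cn_on_transform[OF _ S]) (simp add: B_def dA)
      show "A y (u' y h) = B y h" if "y \<in> S" for y using Au' that .
      show "Cn_on m S (\<lambda>y. A y w)" for w using Suc.prems(1) Cn_on_SucD by blast
    qed
    with der show ?case
      by (intro Cn_on_SucI[OF S, of u u'])
qed

section \<open>Second derivatives\<close>

abbreviation FD where "FD f x \<equiv> frechet_derivative f (at x)"

text \<open>\<open>v\<close> is the direction of the inner derivative and \<open>w\<close> that of
  the outer one; exchanging them is the content of \<open>D2_symmetric\<close>.\<close>

definition D2 :: "('a::real_normed_vector \<Rightarrow> 'b::real_normed_vector) \<Rightarrow> 'a \<Rightarrow> 'a \<Rightarrow> 'a \<Rightarrow> 'b" where
  "D2 f x v w = FD (\<lambda>y. FD f y v) x w"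

lemma Cn_on_has_FD: "Cn_on m S f \<Longrightarrow> 1 \<le> m \<Longrightarrow> x \<in> S \<Longrightarrow> (f has_derivative FD f x) (at x)"
  using Cn_on_Suc_has_derivative[of "m - 1" S f x] by simp

lemma Cn_on_FD: "Cn_on (Suc m) S f \<Longrightarrow> Cn_on m S (\<lambda>x. FD f x v)"
  by simp

lemma C2_has_D2: "Cn_on 2 S f \<Longrightarrow> x \<in> S \<Longrightarrow> ((\<lambda>y. FD f y v) has_derivative D2 f x v) (at x)"
  unfolding D2_def[abs_def]
  using Cn_on_Suc_has_derivative[of 0 S "\<lambda>y. FD f y v" x] by (simp add: numeral_2_eq_2)

lemma FD_cong:
  assumes "open S" "x \<in> S" "\<And>y. y \<in> S \<Longrightarrow> f y = g y"
  shows "FD f x = FD g x"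
proof -
  have "(f has_derivative d) (at x) \<longleftrightarrow> (g has_derivative d) (at x)" for d
    using has_derivative_transform_within_open[of f d x UNIV S g]
      has_derivative_transform_within_open[of g d x UNIV S f] assms by auto
  then show ?thesis by (simp add: frechet_derivative_def)
qed

lemma D2_cong:
  assumes "open S" "x \<in> S" "\<And>y. y \<in> S \<Longrightarrow> f y = g y"
  shows "D2 f x = D2 g x"
proof -
  have "FD (\<lambda>y. FD f y v) x = FD (\<lambda>y. FD g y v) x" for v
    by (rule FD_cong[OF assms(1,2)]) (simp add: FD_cong[of S _ f g] assms)
  then show ?thesis by (simp add: D2_def[abs_def] fun_eq_iff)
qed

lemma FD_eqI: "(f has_derivative f') (at x) \<Longrightarrow> FD f x = f'"
  by (rule frechet_derivative_at[symmetric])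

lemma D2_eqI:
  assumes "open S" "x \<in> S" "\<And>y. y \<in> S \<Longrightarrow> (f has_derivative f' y) (at y)"
    and "((\<lambda>y. f' y v) has_derivative g) (at x)"
  shows "D2 f x v w = g w"
proof -
  have "FD f y v = f' y v" if "y \<in> S" for y
    using FD_eqI[OF assms(3)[OF that]] by simp
  then have "FD (\<lambda>y. FD f y v) x = FD (\<lambda>y. f' y v) x"
    by (rule FD_cong[OF assms(1,2)])
  then show ?thesis
    using FD_eqI[OF assms(4)] by (simp add: D2_def)
qed

lemma FD_linear: "Cn_on m S f \<Longrightarrow> 1 \<le> m \<Longrightarrow> x \<in> S \<Longrightarrow> linear (FD f x)"
  by (blast intro: has_derivative_linear Cn_on_has_FD)

lemma D2_linear_right: "Cn_on 2 S f \<Longrightarrow> x \<in> S \<Longrightarrow> linear (D2 f x v)"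
  using C2_has_D2 has_derivative_linear by blast

lemma D2_linear_left:
  assumes S: "open S" and f: "Cn_on 2 S f" and x: "x \<in> S"
  shows "linear (\<lambda>v. D2 f x v w)"
proof (rule linearI)
  have der: "(f has_derivative FD f y) (at y)" if "y \<in> S" for y
    using Cn_on_has_FD[OF f _ that] by simp
  note lin = FD_linear[OF f]
  have "((\<lambda>y. FD f y (a + b)) has_derivative (\<lambda>w. D2 f x a w + D2 f x b w)) (at x)" for a b
    by (rule has_derivative_transform_within_open[OF has_derivative_add[OF C2_has_D2[OF f x] C2_has_D2[OF f x]] S x])
      (simp add: linear_add[OF lin])
  from D2_eqI[OF S x der this] show "D2 f x (a + b) w = D2 f x a w + D2 f x b w" for a b
    by simp
  have "((\<lambda>y. FD f y (c *\<^sub>R a)) has_derivative (\<lambda>w. c *\<^sub>R D2 f x a w)) (at x)" for a c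
    by (rule has_derivative_transform_within_open[OF has_derivative_scaleR_right[OF C2_has_D2[OF f x]] S x])
      (simp add: linear_scale[OF lin])
  from D2_eqI[OF S x der this] show "D2 f x (c *\<^sub>R a) w = c *\<^sub>R D2 f x a w" for a c
    by simp
qed

lemma FD_tendsto:
  fixes f :: "'a::euclidean_space \<Rightarrow> 'b::real_normed_vector"
  assumes S: "open S" and f: "Cn_on m S f" "1 \<le> m" and x: "x \<in> S" "(X \<longlongrightarrow> x) F" "(V \<longlongrightarrow> v) F"
  shows "((\<lambda>n. FD f (X n) (V n)) \<longlongrightarrow> FD f x v) F"
proof -
  have c: "continuous_on S (\<lambda>y. FD f y b)" for b
    using Cn_on_mono[OF f] by (simp add: numeral_2_eq_2)
  have "((\<lambda>n. FD f (X n) b) \<longlongrightarrow> FD f x b) F" for b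
    using c[of b] S x continuous_on_tendsto_compose[of S "\<lambda>y. FD f y b" X x F] topological_tendstoD[OF x(2) S x(1)]
    by simp
  then have "((\<lambda>n. \<Sum>b\<in>Basis. (V n \<bullet> b) *\<^sub>R FD f (X n) b) \<longlongrightarrow> (\<Sum>b\<in>Basis. (v \<bullet> b) *\<^sub>R FD f x b)) F"
    by (intro tendsto_intros x)
  moreover have "\<forall>\<^sub>F n in F. (\<Sum>b\<in>Basis. (V n \<bullet> b) *\<^sub>R FD f (X n) b) = FD f (X n) (V n)"
    using topological_tendstoD[OF x(2) S x(1)]
    by eventually_elim (rule linear_eq_sum_Basis[OF FD_linear[OF f], symmetric])
  ultimately have "((\<lambda>n. FD f (X n) (V n)) \<longlongrightarrow> (\<Sum>b\<in>Basis. (v \<bullet> b) *\<^sub>R FD f x b)) F"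
    using tendsto_cong by force
  then show ?thesis
    by (simp only: linear_eq_sum_Basis[OF FD_linear[OF f x(1)], of v])
qed

lemma D2_expand:
  fixes f :: "'a::euclidean_space \<Rightarrow> 'b::real_normed_vector"
  assumes S: "open S" and f: "Cn_on 2 S f" and x: "x \<in> S"
  shows "D2 f x v w = (\<Sum>b\<in>Basis. \<Sum>c\<in>Basis. ((v \<bullet> b) * (w \<bullet> c)) *\<^sub>R D2 f x b c)"
proof -
  have "D2 f x v w = (\<Sum>b\<in>Basis. (v \<bullet> b) *\<^sub>R D2 f x b w)"
    by (rule linear_eq_sum_Basis[OF D2_linear_left[OF assms]])
  also have "\<dots> = (\<Sum>b\<in>Basis. (v \<bullet> b) *\<^sub>R (\<Sum>c\<in>Basis. (w \<bullet> c) *\<^sub>R D2 f x b c))"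
    by (intro sum.cong refl arg_cong[where f = "scaleR _"] linear_eq_sum_Basis[OF D2_linear_right[OF f x]])
  finally show ?thesis by (simp add: scaleR_sum_right)
qed

lemma D2_tendsto:
  fixes f :: "'a::euclidean_space \<Rightarrow> 'b::real_normed_vector"
  assumes S: "open S" and f: "Cn_on 2 S f" and x: "x \<in> S" "(X \<longlongrightarrow> x) F" "(V \<longlongrightarrow> v) F" "(W \<longlongrightarrow> w) F"
  shows "((\<lambda>n. D2 f (X n) (V n) (W n)) \<longlongrightarrow> D2 f x v w) F"
proof -
  have c: "continuous_on S (\<lambda>y. D2 f y b c)" for b c
    using f by (simp add: numeral_2_eq_2 D2_def)
  have "((\<lambda>n. D2 f (X n) b c) \<longlongrightarrow> D2 f x b c) F" for b c
    using c[of b c] S x continuous_on_tendsto_compose[of S "\<lambda>y. D2 f y b c" X x F] topological_tendstoD[OF x(2) S x(1)]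
    by simp
  then have "((\<lambda>n. \<Sum>b\<in>Basis. \<Sum>c\<in>Basis. ((V n \<bullet> b) * (W n \<bullet> c)) *\<^sub>R D2 f (X n) b c) \<longlongrightarrow> 
      (\<Sum>b\<in>Basis. \<Sum>c\<in>Basis. ((v \<bullet> b) * (w \<bullet> c)) *\<^sub>R D2 f x b c)) F"
    by (intro tendsto_intros x)
  moreover have "\<forall>\<^sub>F n in F. (\<Sum>b\<in>Basis. \<Sum>c\<in>Basis. ((V n \<bullet> b) * (W n \<bullet> c)) *\<^sub>R D2 f (X n) b c) = D2 f (X n) (V n) (W n)"
    using topological_tendstoD[OF x(2) S x(1)]
    by eventually_elim (rule D2_expand[OF S f, symmetric])
  ultimately have "((\<lambda>n. D2 f (X n) (V n) (W n)) \<longlongrightarrow> (\<Sum>b\<in>Basis. \<Sum>c\<in>Basis. ((v \<bullet> b) * (w \<bullet> c)) *\<^sub>R D2 f x b c)) F"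
    using tendsto_cong by force
  then show ?thesis
    by (simp only: D2_expand[OF S f x(1), of v w])
qed

section \<open>Second differences and the symmetry of the second derivative\<close>

lemma line_has_real_derivative:
  fixes f :: "'a::real_normed_vector \<Rightarrow> real"
  assumes "(f has_derivative f') (at (a + s *\<^sub>R v))"
  shows "((\<lambda>s. f (a + s *\<^sub>R v)) has_real_derivative f' v) (at s)"
proof -
  have "((\<lambda>s. a + s *\<^sub>R v) has_derivative (\<lambda>h. h *\<^sub>R v)) (at s)"
    by (auto intro!: derivative_eq_intros)
  from has_derivative_compose[OF this assms] have "((\<lambda>s. f (a + s *\<^sub>R v)) has_derivative (\<lambda>h. f' (h *\<^sub>R v))) (at s)" .
  moreover have "(\<lambda>h. f' (h *\<^sub>R v)) = (*) (f' v)"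
    by (simp add: fun_eq_iff linear_scale[OF has_derivative_linear[OF assms]])
  ultimately show ?thesis
    by (simp add: has_field_derivative_def)
qed

text \<open>Two applications of the mean value theorem: first to the difference of \<open>f\<close>
  along two parallel edges, then to the derivative along \<open>v\<close> as a function of the
  position in direction \<open>w\<close>.\<close>

lemma second_difference:
  fixes f :: "'a::euclidean_space \<Rightarrow> real"
  assumes S: "open S" and f: "Cn_on 2 S f" and h: "0 < h"
    and sub: "\<And>s t. 0 \<le> s \<Longrightarrow> s \<le> h \<Longrightarrow> 0 \<le> t \<Longrightarrow> t \<le> h \<Longrightarrow> x + s *\<^sub>R v + t *\<^sub>R w \<in> S"
  shows "\<exists>s t. 0 \<le> s \<and> s \<le> h \<and> 0 \<le> t \<and> t \<le> h \<and>
    f (x + h *\<^sub>R v + h *\<^sub>R w) - f (x + h *\<^sub>R v) - f (x + h *\<^sub>R w) + f x = h * h * D2 f (x + s *\<^sub>R v + t *\<^sub>R w) v w"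
proof -
  define g where "g s = f ((x + h *\<^sub>R w) + s *\<^sub>R v) - f (x + s *\<^sub>R v)" for s
  have dg: "(g has_real_derivative FD f ((x + h *\<^sub>R w) + s *\<^sub>R v) v - FD f (x + s *\<^sub>R v) v) (at s)"
    if "0 \<le> s" "s \<le> h" for s
    unfolding g_def[abs_def]
    using sub[OF that, of h] sub[OF that, of 0] h f
    by (intro DERIV_diff line_has_real_derivative Cn_on_has_FD[OF f]) (auto simp: algebra_simps)
  obtain s where s: "0 < s" "s < h" "g h - g 0 = (h - 0) * (FD f ((x + h *\<^sub>R w) + s *\<^sub>R v) v - FD f (x + s *\<^sub>R v) v)"
    using MVT2[OF h, of g "\<lambda>s. FD f ((x + h *\<^sub>R w) + s *\<^sub>R v) v - FD f (x + s *\<^sub>R v) v"] dg by blast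
  have dk: "((\<lambda>t. FD f ((x + s *\<^sub>R v) + t *\<^sub>R w) v) has_real_derivative D2 f ((x + s *\<^sub>R v) + t *\<^sub>R w) v w) (at t)"
    if "0 \<le> t" "t \<le> h" for t
    using sub[of s t] s that by (intro line_has_real_derivative C2_has_D2[OF f]) auto
  obtain t where t: "0 < t" "t < h" 
    "FD f ((x + s *\<^sub>R v) + h *\<^sub>R w) v - FD f ((x + s *\<^sub>R v) + 0 *\<^sub>R w) v = (h - 0) * D2 f ((x + s *\<^sub>R v) + t *\<^sub>R w) v w"
    using MVT2[OF h, of "\<lambda>t. FD f ((x + s *\<^sub>R v) + t *\<^sub>R w) v" "\<lambda>t. D2 f ((x + s *\<^sub>R v) + t *\<^sub>R w) v w"] dk by blast
  have "f (x + h *\<^sub>R v + h *\<^sub>R w) - f (x + h *\<^sub>R v) - f (x + h *\<^sub>R w) + f x = g h - g 0"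
    by (simp add: g_def algebra_simps)
  also have "\<dots> = h * h * D2 f (x + s *\<^sub>R v + t *\<^sub>R w) v w"
    using s(3) t(3) by (simp add: algebra_simps)
  finally show ?thesis using s t by (intro exI[of _ s] exI[of _ t]) auto
qed

text \<open>The second difference over the parallelogram with sides h v and h w does not see the
  order of the sides, and divided by h^2 it tends to either mixed derivative.\<close>

lemma D2_symmetric:
  fixes f :: "'a::euclidean_space \<Rightarrow> real"
  assumes S: "open S" and f: "Cn_on 2 S f" and x: "x \<in> S"
  shows "D2 f x v w = D2 f x w v"
proof -
  obtain e where e: "e > 0" "ball x e \<subseteq> S" using S x openE by blast
  \<comment> \<open>The summand 1 prevents division by zero. The sum of the norms is the same for
    (v, w) and (w, v), so one sequence serves both orders.\<close>
  define h where "h n = e / (1 + norm v + norm w) * inverse (real (Suc (Suc n)))" for n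
  have h: "h n > 0" for n using e by (auto simp: h_def intro!: divide_pos_pos add_pos_nonneg)
  have h0: "h \<longlonglongrightarrow> 0"
    unfolding h_def[abs_def] by (rule tendsto_mult_right_zero, rule LIMSEQ_Suc[OF LIMSEQ_inverse_real_of_nat])
  have sub: "x + s *\<^sub>R a + t *\<^sub>R b \<in> S" if st: "0 \<le> s" "s \<le> h n" "0 \<le> t" "t \<le> h n" and ab: "norm a + norm b = norm v + norm w" for s t n a b
  proof -
    have "norm (s *\<^sub>R a + t *\<^sub>R b) \<le> s * norm a + t * norm b"
      using st norm_triangle_ineq[of "s *\<^sub>R a" "t *\<^sub>R b"] by simp
    also have "\<dots> \<le> h n * (norm v + norm w)"
      using st by (auto simp: distrib_left ab[symmetric] intro!: add_mono mult_right_mono)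
    also have "\<dots> < h n * (1 + norm v + norm w)"
      using h[of n] by (simp add: algebra_simps)
    also have "\<dots> = e * inverse (real (Suc (Suc n)))"
      using add_pos_nonneg[of 1 "norm v + norm w"] by (simp add: h_def)
    also have "\<dots> \<le> e" using e by (simp add: field_simps)
    finally have "norm (s *\<^sub>R a + t *\<^sub>R b) < e" .
    then have "x + (s *\<^sub>R a + t *\<^sub>R b) \<in> ball x e" 
      unfolding mem_ball dist_norm by (metis add_diff_cancel_left' norm_minus_commute)
    then show ?thesis using e by (auto simp: add.assoc)
  qed
  let ?P = "\<lambda>a b n s t. 0 \<le> s \<and> s \<le> h n \<and> 0 \<le> t \<and> t \<le> h n \<and>
    f (x + h n *\<^sub>R a + h n *\<^sub>R b) - f (x + h n *\<^sub>R a) - f (x + h n *\<^sub>R b) + f x = h n * h n * D2 f (x + s *\<^sub>R a + t *\<^sub>R b) a b"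
  have lim: "\<exists>X. (X \<longlonglongrightarrow> D2 f x a b) \<and> (\<forall>n. f (x + h n *\<^sub>R a + h n *\<^sub>R b) - f (x + h n *\<^sub>R a) - f (x + h n *\<^sub>R b) + f x = h n * h n * X n)"
    if ab: "norm a + norm b = norm v + norm w" for a b
  proof -
    have "\<forall>n. \<exists>s t. ?P a b n s t"
      by (intro allI second_difference[OF S f h sub[OF _ _ _ _ ab]]) auto
    then obtain s t where st: "\<And>n. ?P a b n (s n) (t n)" by metis
    have s0: "s \<longlonglongrightarrow> 0" by (rule tendsto_sandwich[OF _ _ tendsto_const h0]) (use st in auto)
    have t0: "t \<longlonglongrightarrow> 0" by (rule tendsto_sandwich[OF _ _ tendsto_const h0]) (use st in auto)
    have "(\<lambda>n. x + s n *\<^sub>R a + t n *\<^sub>R b) \<longlonglongrightarrow> x + 0 *\<^sub>R a + 0 *\<^sub>R b"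
      by (intro tendsto_intros s0 t0)
    then have "(\<lambda>n. D2 f (x + s n *\<^sub>R a + t n *\<^sub>R b) a b) \<longlonglongrightarrow> D2 f x a b"
      by (intro D2_tendsto[OF S f x]) auto
    then show ?thesis using st by blast
  qed
  obtain X where X: "X \<longlonglongrightarrow> D2 f x v w" "\<And>n. f (x + h n *\<^sub>R v + h n *\<^sub>R w) - f (x + h n *\<^sub>R v) - f (x + h n *\<^sub>R w) + f x = h n * h n * X n"
    using lim[of v w] by auto
  obtain Y where Y: "Y \<longlonglongrightarrow> D2 f x w v" "\<And>n. f (x + h n *\<^sub>R w + h n *\<^sub>R v) - f (x + h n *\<^sub>R w) - f (x + h n *\<^sub>R v) + f x = h n * h n * Y n"
    using lim[of w v] by (auto simp: add.commute)
  have "h n * h n * X n = h n * h n * Y n" for n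
    using X(2)[of n] Y(2)[of n] by (simp add: algebra_simps)
  then have "X = Y" using h by (simp add: fun_eq_iff less_imp_neq[symmetric])
  then show ?thesis using X(1) Y(1) LIMSEQ_unique by blast
qed

text \<open>Continuity of the second derivatives as a bound uniform in the direction, the form
  required for a Taylor estimate on a whole circle.\<close>

lemma D2_close:
  fixes f :: "'a::euclidean_space \<Rightarrow> real"
  assumes S: "open S" and f: "Cn_on 2 S f" and x: "x \<in> S" and e: "e > 0"
  obtains d where "d > 0" "ball x d \<subseteq> S" "\<And>y v. y \<in> ball x d \<Longrightarrow> \<bar>D2 f y v v - D2 f x v v\<bar> \<le> e * (norm v)\<^sup>2"
proof -
  define E where "E y = (\<Sum>b\<in>Basis. \<Sum>c\<in>Basis. \<bar>D2 f y b c - D2 f x b c\<bar>)" for y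
  have "(E \<longlongrightarrow> (\<Sum>b\<in>Basis. \<Sum>c\<in>(Basis::'a set). \<bar>D2 f x b c - D2 f x b c\<bar>)) (nhds x)"
    unfolding E_def[abs_def] by (intro tendsto_intros D2_tendsto[OF S f x]) (auto intro: filterlim_ident)
  then have "(E \<longlongrightarrow> 0) (nhds x)" by simp
  from order_tendstoD(2)[OF this e] have "\<forall>\<^sub>F y in nhds x. E y < e" .
  moreover have "\<forall>\<^sub>F y in nhds x. y \<in> S" using S x by (rule eventually_nhds_in_open)
  ultimately have "\<forall>\<^sub>F y in nhds x. E y < e \<and> y \<in> S" by eventually_elim auto
  then obtain d where d: "d > 0" "\<And>y. dist y x < d \<Longrightarrow> E y < e \<and> y \<in> S"
    unfolding eventually_nhds_metric by blast
  show ?thesis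
  proof
    show "ball x d \<subseteq> S" using d by (auto simp: dist_commute)
    fix y v assume "y \<in> ball x d"
    then have y: "E y < e" "y \<in> S" using d by (auto simp: dist_commute)
    have "\<bar>D2 f y v v - D2 f x v v\<bar> = \<bar>\<Sum>b\<in>Basis. \<Sum>c\<in>Basis. ((v \<bullet> b) * (v \<bullet> c)) * (D2 f y b c - D2 f x b c)\<bar>"
      unfolding D2_expand[OF S f x, of v v] D2_expand[OF S f y(2), of v v]
      by (simp add: sum_subtractf right_diff_distrib)
    also have "\<dots> \<le> (\<Sum>b\<in>Basis. \<Sum>c\<in>Basis. \<bar>((v \<bullet> b) * (v \<bullet> c)) * (D2 f y b c - D2 f x b c)\<bar>)"
      by (rule order_trans[OF sum_abs]) (intro sum_mono sum_abs)
    also have "\<dots> \<le> (\<Sum>b\<in>Basis. \<Sum>c\<in>(Basis::'a set). (norm v * norm v) * \<bar>D2 f y b c - D2 f x b c\<bar>)"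
      unfolding abs_mult
      by (intro sum_mono mult_right_mono mult_mono Basis_le_norm abs_ge_zero norm_ge_zero)
    also have "\<dots> = E y * (norm v)\<^sup>2"
      by (simp add: E_def sum_distrib_left[symmetric] power2_eq_square)
    also have "\<dots> \<le> e * (norm v)\<^sup>2" using y by (intro mult_right_mono) auto
    finally show "\<bar>D2 f y v v - D2 f x v v\<bar> \<le> e * (norm v)\<^sup>2" .
  qed (use d in auto)
qed

section \<open>Sum, product and chain rules up to second order\<close>

lemma FD_add: "Cn_on m S f \<Longrightarrow> Cn_on m S g \<Longrightarrow> 1 \<le> m \<Longrightarrow> x \<in> S \<Longrightarrow> FD (\<lambda>x. f x + g x) x v = FD f x v + FD g x v"
  using FD_eqI[OF has_derivative_add[OF Cn_on_has_FD[of m S f x] Cn_on_has_FD[of m S g x]]] by simp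

lemma D2_add:
  assumes "open S" "Cn_on 2 S f" "Cn_on 2 S g" "x \<in> S"
  shows "D2 (\<lambda>x. f x + g x) x v w = D2 f x v w + D2 g x v w"
proof -
  have 1: "(f has_derivative FD f y) (at y)" "(g has_derivative FD g y) (at y)" if "y \<in> S" for y
    using Cn_on_has_FD[OF assms(2) _ that] Cn_on_has_FD[OF assms(3) _ that] by simp_all
  have "((\<lambda>y. FD f y v + FD g y v) has_derivative (\<lambda>w. D2 f x v w + D2 g x v w)) (at x)"
    by (intro has_derivative_add C2_has_D2[OF assms(2,4)] C2_has_D2[OF assms(3,4)])
  from D2_eqI[OF assms(1,4) has_derivative_add[OF 1] this] show ?thesis by simp
qed

lemma has_derivative_real_compose:
  fixes h :: "real \<Rightarrow> real"
  assumes "(h has_real_derivative d) (at (f x))" "(f has_derivative f') (at x)"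
  shows "((\<lambda>x. h (f x)) has_derivative (\<lambda>v. d * f' v)) (at x)"
  using has_derivative_compose[OF assms(2)] assms(1) by (simp add: has_field_derivative_def)

lemma FD_real_compose:
  fixes h :: "real \<Rightarrow> real"
  assumes "Cn_on m S f" "1 \<le> m" "x \<in> S" "(h has_real_derivative d) (at (f x))"
  shows "FD (\<lambda>x. h (f x)) x v = d * FD f x v"
  using FD_eqI[OF has_derivative_real_compose[OF assms(4) Cn_on_has_FD[OF assms(1-3)]]] by simp

lemma D2_real_compose:
  fixes h :: "real \<Rightarrow> real"
  assumes S: "open S" and f: "Cn_on 2 S f" and x: "x \<in> S" 
    and h: "\<And>y. y \<in> S \<Longrightarrow> (h has_real_derivative h' (f y)) (at (f y))"
    and h': "(h' has_real_derivative d) (at (f x))"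
  shows "D2 (\<lambda>x. h (f x)) x v w = d * FD f x v * FD f x w + h' (f x) * D2 f x v w"
proof -
  have f1: "(f has_derivative FD f y) (at y)" if "y \<in> S" for y
    using Cn_on_has_FD[OF f _ that] by simp
  have "((\<lambda>y. h' (f y) * FD f y v) has_derivative
      (\<lambda>w. h' (f x) * D2 f x v w + d * FD f x w * FD f x v)) (at x)"
    by (rule has_derivative_mult[OF has_derivative_real_compose[OF h' f1[OF x]] C2_has_D2[OF f x]])
  from D2_eqI[OF S x has_derivative_real_compose[OF h f1] this] show ?thesis by simp
qed

lemma FD_compose:
  fixes \<Phi> :: "'a::real_normed_vector \<Rightarrow> 'b::real_normed_vector"
  assumes "(\<Phi> has_derivative FD \<Phi> x) (at x)" "(f has_derivative FD f (\<Phi> x)) (at (\<Phi> x))"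
  shows "FD (\<lambda>x. f (\<Phi> x)) x v = FD f (\<Phi> x) (FD \<Phi> x v)"
  using FD_eqI[OF has_derivative_compose[OF assms]] by simp

text \<open>As in \<open>Cn_on_compose\<close>, the direction supplied by the inner function moves.
  The product rule on its basis expansion separates the quadratic term from the one with the second
  derivative of \<open>\<Phi>\<close>.\<close>

lemma D2_compose:
  fixes \<Phi> :: "'a::real_normed_vector \<Rightarrow> 'b::euclidean_space"
  assumes S: "open S" and T: "open T" and P: "Cn_on 2 S \<Phi>" and f: "Cn_on 2 T f" and x: "x \<in> S"
    and sub: "\<And>y. y \<in> S \<Longrightarrow> \<Phi> y \<in> T"
  shows "D2 (\<lambda>x. f (\<Phi> x)) x v w = D2 f (\<Phi> x) (FD \<Phi> x v) (FD \<Phi> x w) + FD f (\<Phi> x) (D2 \<Phi> x v w)"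
proof -
  have f1: "(f has_derivative FD f y) (at y)" if "y \<in> T" for y
    using Cn_on_has_FD[OF f _ that] by simp
  have P1: "(\<Phi> has_derivative FD \<Phi> y) (at y)" if "y \<in> S" for y
    using Cn_on_has_FD[OF P _ that] by simp
  have c: "((\<lambda>x. f (\<Phi> x)) has_derivative (\<lambda>v. FD f (\<Phi> y) (FD \<Phi> y v))) (at y)" if "y \<in> S" for y
    using has_derivative_compose[OF P1 f1] sub that by blast
  have "((\<lambda>y. \<Sum>b\<in>Basis. (FD \<Phi> y v \<bullet> b) *\<^sub>R FD f (\<Phi> y) b) has_derivative
     (\<lambda>w. \<Sum>b\<in>Basis. (FD \<Phi> x v \<bullet> b) *\<^sub>R D2 f (\<Phi> x) b (FD \<Phi> x w) + (D2 \<Phi> x v w \<bullet> b) *\<^sub>R FD f (\<Phi> x) b)) (at x)"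
    by (intro has_derivative_sum has_derivative_scaleR has_derivative_inner_left C2_has_D2[OF P x]
        has_derivative_compose[OF P1[OF x] C2_has_D2[OF f sub[OF x]]])
  then have "((\<lambda>y. FD f (\<Phi> y) (FD \<Phi> y v)) has_derivative
     (\<lambda>w. \<Sum>b\<in>Basis. (FD \<Phi> x v \<bullet> b) *\<^sub>R D2 f (\<Phi> x) b (FD \<Phi> x w) + (D2 \<Phi> x v w \<bullet> b) *\<^sub>R FD f (\<Phi> x) b)) (at x)"
    by (rule has_derivative_transform_within_open[OF _ S x])
      (rule linear_eq_sum_Basis[OF FD_linear[OF f _ sub], symmetric], auto)
  from D2_eqI[OF S x c this] have "D2 (\<lambda>x. f (\<Phi> x)) x v w = 
     (\<Sum>b\<in>Basis. (FD \<Phi> x v \<bullet> b) *\<^sub>R D2 f (\<Phi> x) b (FD \<Phi> x w) + (D2 \<Phi> x v w \<bullet> b) *\<^sub>R FD f (\<Phi> x) b)" .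
  also have "\<dots> = (\<Sum>b\<in>Basis. (FD \<Phi> x v \<bullet> b) *\<^sub>R D2 f (\<Phi> x) b (FD \<Phi> x w)) + (\<Sum>b\<in>Basis. (D2 \<Phi> x v w \<bullet> b) *\<^sub>R FD f (\<Phi> x) b)"
    by (rule sum.distrib)
  also have "(\<Sum>b\<in>Basis. (FD \<Phi> x v \<bullet> b) *\<^sub>R D2 f (\<Phi> x) b (FD \<Phi> x w)) = D2 f (\<Phi> x) (FD \<Phi> x v) (FD \<Phi> x w)"
    by (rule linear_eq_sum_Basis[OF D2_linear_left[OF T f sub[OF x]], symmetric])
  also have "(\<Sum>b\<in>Basis. (D2 \<Phi> x v w \<bullet> b) *\<^sub>R FD f (\<Phi> x) b) = FD f (\<Phi> x) (D2 \<Phi> x v w)"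
    by (rule linear_eq_sum_Basis[OF FD_linear[OF f _ sub[OF x]], symmetric]) simp
  finally show ?thesis .
qed

lemma FD_mult:
  fixes f g :: "'a::real_normed_vector \<Rightarrow> real"
  assumes "Cn_on m S f" "Cn_on m S g" "1 \<le> m" "x \<in> S"
  shows "FD (\<lambda>x. f x * g x) x v = f x * FD g x v + FD f x v * g x"
  using FD_eqI[OF has_derivative_mult[OF Cn_on_has_FD[OF assms(1,3,4)] Cn_on_has_FD[OF assms(2,3,4)]]] by simp

lemma D2_mult:
  fixes f g :: "'a::real_normed_vector \<Rightarrow> real"
  assumes "open S" "Cn_on 2 S f" "Cn_on 2 S g" "x \<in> S"
  shows "D2 (\<lambda>x. f x * g x) x v w = f x * D2 g x v w + FD f x v * FD g x w + FD f x w * FD g x v + D2 f x v w * g x"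
proof -
  have 1: "(f has_derivative FD f y) (at y)" "(g has_derivative FD g y) (at y)" if "y \<in> S" for y
    using Cn_on_has_FD[OF assms(2) _ that] Cn_on_has_FD[OF assms(3) _ that] by simp_all
  have "((\<lambda>y. f y * FD g y v + FD f y v * g y) has_derivative
    (\<lambda>w. (f x * D2 g x v w + FD f x w * FD g x v) + (FD f x v * FD g x w + D2 f x v w * g x))) (at x)"
    by (intro has_derivative_add has_derivative_mult 1 C2_has_D2[OF assms(2,4)] C2_has_D2[OF assms(3,4)] assms(4))
  from D2_eqI[OF assms(1,4) has_derivative_mult[OF 1] this] show ?thesis by simp
qed

lemma Cn_on_norm_square: "open S \<Longrightarrow> Cn_on m S (\<lambda>x::'a::real_inner. c * (x \<bullet> x))"
  by (intro Cn_on_mult Cn_on_inner Cn_on_id Cn_on_const)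

lemma has_derivative_norm_square:
  "((\<lambda>x::'a::real_inner. c * (x \<bullet> x)) has_derivative (\<lambda>v. 2 * c * (x \<bullet> v))) (at x)"
  by (auto intro!: derivative_eq_intros simp: inner_commute)

lemma FD_norm_square: "FD (\<lambda>x::'a::real_inner. c * (x \<bullet> x)) x v = 2 * c * (x \<bullet> v)"
  using FD_eqI[OF has_derivative_norm_square] by metis

lemma D2_norm_square: "D2 (\<lambda>x::'a::real_inner. c * (x \<bullet> x)) x v w = 2 * c * (v \<bullet> w)"
proof -
  have "((\<lambda>y::'a. 2 * c * (y \<bullet> v)) has_derivative (\<lambda>w. 2 * c * (v \<bullet> w))) (at x)"
    by (auto intro!: derivative_eq_intros simp: inner_commute)
  from D2_eqI[OF open_UNIV UNIV_I has_derivative_norm_square this] show ?thesis .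
qed

section \<open>Smooth approximation in \<open>C\<^sup>2\<close>\<close>

text \<open>Differentiation under the integral wants the derivative to be continuous as an operator.
  In finite dimension this follows from continuity in each direction.\<close>

lemma leibniz_directional:
  fixes K :: "'a::euclidean_space \<Rightarrow> 'a \<Rightarrow> real"
  assumes der: "\<And>x y. y \<in> cbox a b \<Longrightarrow> ((\<lambda>x. K x y) has_derivative K' x y) (at x)"
    and cont: "\<And>v. continuous_on (UNIV \<times> cbox a b) (\<lambda>(x, y). K' x y v)"
    and K: "\<And>x. continuous_on (cbox a b) (K x)"
  shows "((\<lambda>x. integral (cbox a b) (K x)) has_derivative (\<lambda>v. integral (cbox a b) (\<lambda>y. K' x y v))) (at x)"
proof -
  define L where "L x y = Blinfun (K' x y)" for x y
  have L: "blinfun_apply (L x y) = K' x y" if "y \<in> cbox a b" for x y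
    unfolding L_def by (rule bounded_linear_Blinfun_apply[OF has_derivative_bounded_linear[OF der[OF that]]])
  have cL: "continuous_on (UNIV \<times> cbox a b) (\<lambda>(x, y). L x y)"
  proof (rule continuous_on_blinfun_componentwise)
    fix i
    show "continuous_on (UNIV \<times> cbox a b) (\<lambda>z. blinfun_apply (case z of (x, y) \<Rightarrow> L x y) i)"
      by (rule continuous_on_eq[OF cont[of i]]) (auto simp: L)
  qed
  have "((\<lambda>x. integral (cbox a b) (K x)) has_derivative blinfun_apply (integral (cbox a b) (L x))) (at x within UNIV)"
    by (rule leibniz_rule[OF _ _ cL]) (auto simp: L intro: der integrable_continuous K)
  moreover have app: "blinfun_apply (integral (cbox a b) (L x)) v = integral (cbox a b) (\<lambda>y. K' x y v)" for v
  proof -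
    have "continuous_on (cbox a b) (L x)"
    proof -
      have "continuous_on (cbox a b) (\<lambda>y. (x, y))"
        by (intro continuous_on_Pair continuous_on_const continuous_on_id)
      from continuous_on_compose2[OF cL this] show ?thesis by auto
    qed
    then have "blinfun_apply (integral (cbox a b) (L x)) v = integral (cbox a b) (\<lambda>y. blinfun_apply (L x y) v)"
      by (intro blinfun_apply_integral integrable_continuous)
    also have "\<dots> = integral (cbox a b) (\<lambda>y. K' x y v)"
      by (rule integral_cong) (simp add: L)
    finally show ?thesis .
  qed
  then have "blinfun_apply (integral (cbox a b) (L x)) = (\<lambda>v. integral (cbox a b) (\<lambda>y. K' x y v))"
    by (rule ext)
  ultimately show ?thesis by simp
qed

text \<open>The convolution of \<open>f\<close>, thought of as supported in the box, with
  \<open>g\<close>. Integrating over the box that carries \<open>f\<close> makes decay of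
  \<open>g\<close> irrelevant.\<close>

definition conv where "conv a b f g x = integral (cbox a b) (\<lambda>y. f y * g (x - y))"
  for a b :: "'a::euclidean_space" and f g :: "'a \<Rightarrow> real"

text \<open>All derivatives fall on the smooth factor \<open>g\<close>, while \<open>f\<close>
  contributes continuity only.\<close>

lemma Cn_on_conv:
  assumes f: "continuous_on UNIV f" and g: "\<And>l. Cn_on l UNIV g"
  shows "Cn_on m UNIV (conv a b f g)"
  using g
proof (induction m arbitrary: g)
  case 0
  have g: "continuous_on UNIV g" using 0[of 0] by simp
  show ?case
    unfolding Cn_on.simps conv_def[abs_def]
    by (intro integral_continuous_on_param)
      (auto simp: case_prod_beta' intro!: continuous_intros continuous_on_compose2[OF f] continuous_on_compose2[OF g])
next
  case (Suc m)
  have g: "continuous_on UNIV g" and g': "continuous_on UNIV (\<lambda>x. FD g x v)" for v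
    using Suc.prems[of 0] Suc.prems[of 1] by simp_all
  have gd: "(g has_derivative FD g x) (at x)" for x using Cn_on_has_FD[OF Suc.prems[of 1]] by simp
  have d: "(conv a b f g has_derivative (\<lambda>v. conv a b f (\<lambda>z. FD g z v) x)) (at x)" for x
    unfolding conv_def[abs_def]
  proof (rule leibniz_directional)
    fix x y :: 'a
    have "((\<lambda>x. x - y) has_derivative (\<lambda>v. v)) (at x)" by (auto intro!: derivative_eq_intros)
    from has_derivative_compose[OF this gd] have "((\<lambda>x. g (x - y)) has_derivative FD g (x - y)) (at x)" .
    then show "((\<lambda>x. f y * g (x - y)) has_derivative (\<lambda>v. f y * FD g (x - y) v)) (at x)"
      by (rule has_derivative_mult_right)
  next
    show "continuous_on (UNIV \<times> cbox a b) (\<lambda>(x, y). f y * FD g (x - y) v)" for v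
      by (auto simp: case_prod_beta' intro!: continuous_intros continuous_on_compose2[OF f] continuous_on_compose2[OF g'])
    show "continuous_on (cbox a b) (\<lambda>y. f y * g (x - y))" for x
      by (auto intro!: continuous_intros continuous_on_compose2[OF f] continuous_on_compose2[OF g])
  qed
  have "Cn_on m UNIV (conv a b f (\<lambda>z. FD g z v))" for v
    by (rule Suc.IH) (use Suc.prems[of "Suc _"] in simp)
  then have "Cn_on m UNIV (\<lambda>x. conv a b f (\<lambda>z. FD g z v) x)" for v by simp
  with d show ?case by (intro Cn_on_SucI[OF open_UNIV, of "conv a b f g" "\<lambda>x v. conv a b f (\<lambda>z. FD g z v) x"])
qed

text \<open>The substitution of x - y for y hands the integration variable to \<open>g\<close>.
  Since \<open>f\<close> vanishes off its box, any box that contains all the differences may serve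
  as domain.\<close>

lemma conv_commute:
  assumes f: "continuous_on UNIV f" and g: "continuous_on UNIV g" and z: "\<And>y. y \<notin> cbox a b \<Longrightarrow> f y = 0"
    and sub: "\<And>y. y \<in> cbox a b \<Longrightarrow> x - y \<in> cbox c d"
  shows "conv a b f g x = integral (cbox c d) (\<lambda>y. f (x - y) * g y)"
proof -
  have "continuous_on (cbox a b) (\<lambda>y. f y * g (x - y))"
    by (auto intro!: continuous_intros continuous_on_compose2[OF f] continuous_on_compose2[OF g])
  then have "((\<lambda>y. f y * g (x - y)) has_integral conv a b f g x) (cbox a b)"
    unfolding conv_def by (intro integrable_integral integrable_continuous)
  then have "((\<lambda>y. f (- y) * g (x - (- y))) has_integral conv a b f g x) (cbox (- b) (- a))"
    using has_integral_reflect[of "\<lambda>y. f y * g (x - y)"] by simp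
  then have "((\<lambda>y. f (- (y + (- x))) * g (x - (- (y + (- x))))) has_integral conv a b f g x) (cbox (- b + x) (- a + x))"
    using has_integral_shift_cbox_iff[of "\<lambda>y. f (- y) * g (x - (- y))" "- x" _ "- b + x" "- a + x"] 
    by (simp add: o_def)
  then have i: "((\<lambda>y. f (x - y) * g y) has_integral conv a b f g x) (cbox (- b + x) (- a + x))"
    by simp
  have "((\<lambda>y. f (x - y) * g y) has_integral conv a b f g x) (cbox c d)"
  proof (rule has_integral_on_superset[OF i])
    fix y assume "y \<notin> cbox (- b + x) (- a + x)"
    then have "x - y \<notin> cbox a b" by (fastforce simp: mem_box inner_add_left inner_diff_left)
    then show "f (x - y) * g y = 0" using z by simp
  next
    show "cbox (- b + x) (- a + x) \<subseteq> cbox c d"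
    proof
      fix y assume "y \<in> cbox (- b + x) (- a + x)"
      then have "x - y \<in> cbox a b" by (fastforce simp: mem_box inner_add_left inner_diff_left)
      from sub[OF this] show "y \<in> cbox c d" by simp
    qed
  qed
  then show ?thesis by (rule integral_unique[symmetric])
qed

lemma symmetric_cbox_differences:
  fixes K :: "'a::euclidean_space set"
  assumes "bounded K"
  obtains M where "0 \<in> box (- M) M" "\<And>x y. x \<in> K \<Longrightarrow> y \<in> cbox a b \<Longrightarrow> x - y \<in> cbox (- M) M"
proof -
  obtain r1 where r1: "\<And>x. x \<in> K \<Longrightarrow> norm x \<le> r1" using assms unfolding bounded_iff by blast
  obtain r2 where r2: "\<And>y. y \<in> cbox a b \<Longrightarrow> norm y \<le> r2" using bounded_cbox[of a b] unfolding bounded_iff by blast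
  obtain M :: 'a where M: "cball 0 (\<bar>r1\<bar> + \<bar>r2\<bar>) \<subseteq> box (- M) M"
    using bounded_subset_box_symmetric[OF bounded_cball] by blast
  show ?thesis
  proof (rule that)
    have "(0::'a) \<in> cball 0 (\<bar>r1\<bar> + \<bar>r2\<bar>)" by simp
    then show "0 \<in> box (- M) M" using M by blast
    fix x y assume xy: "x \<in> K" "y \<in> cbox a b"
    have "norm (x - y) \<le> \<bar>r1\<bar> + \<bar>r2\<bar>"
      using r1[OF xy(1)] r2[OF xy(2)] norm_triangle_ineq4[of x y] by linarith
    then have "x - y \<in> cball 0 (\<bar>r1\<bar> + \<bar>r2\<bar>)" by simp
    then show "x - y \<in> cbox (- M) M" using M box_subset_cbox by blast
  qed
qed

text \<open>Here the derivative falls on \<open>f\<close>. After \<open>conv_commute\<close> the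
  variable of differentiation sits in \<open>f\<close>, and one domain of integration serves all
  points of a unit ball, so the integral can be differentiated and turned back.\<close>

lemma conv_has_derivative:
  assumes f: "Cn_on 1 UNIV f" and g: "continuous_on UNIV g" and z: "\<And>y. y \<notin> cbox a b \<Longrightarrow> f y = 0"
  shows "(conv a b f g has_derivative (\<lambda>v. conv a b (\<lambda>y. FD f y v) g x)) (at x)"
    and "\<And>y v. y \<notin> cbox a b \<Longrightarrow> FD f y v = 0"
proof -
  have fc: "continuous_on UNIV f" and f': "continuous_on UNIV (\<lambda>x. FD f x v)" for v
    using Cn_on_continuous[OF f] f by simp_all
  have fd: "(f has_derivative FD f x) (at x)" for x using Cn_on_has_FD[OF f] by simp
  show z': "FD f y v = 0" if y: "y \<notin> cbox a b" for y v
  proof -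
    have "(f has_derivative (\<lambda>v. 0)) (at y)"
      by (rule has_derivative_transform_within_open[OF has_derivative_const[of 0] open_Compl[OF closed_cbox[of a b]]])
        (use y z in auto)
    then show ?thesis using FD_eqI by metis
  qed
  obtain M where M: "\<And>x' y. x' \<in> ball x 1 \<Longrightarrow> y \<in> cbox a b \<Longrightarrow> x' - y \<in> cbox (- M) M"
    using symmetric_cbox_differences[OF bounded_ball, of x 1 a b] by blast
  have "((\<lambda>x. integral (cbox (- M) M) (\<lambda>y. f (x - y) * g y)) has_derivative 
      (\<lambda>v. integral (cbox (- M) M) (\<lambda>y. FD f (x - y) v * g y))) (at x)"
  proof (rule leibniz_directional)
    fix x y :: 'a
    have "((\<lambda>x. x - y) has_derivative (\<lambda>v. v)) (at x)" by (auto intro!: derivative_eq_intros)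
    from has_derivative_compose[OF this fd] have "((\<lambda>x. f (x - y)) has_derivative FD f (x - y)) (at x)" .
    then show "((\<lambda>x. f (x - y) * g y) has_derivative (\<lambda>v. FD f (x - y) v * g y)) (at x)"
      by (rule has_derivative_mult_left)
  next
    show "continuous_on (UNIV \<times> cbox (- M) M) (\<lambda>(x, y). FD f (x - y) v * g y)" for v
      by (auto simp: case_prod_beta' intro!: continuous_intros continuous_on_compose2[OF g] continuous_on_compose2[OF f'])
    show "continuous_on (cbox (- M) M) (\<lambda>y. f (x - y) * g y)" for x
      by (auto intro!: continuous_intros continuous_on_compose2[OF fc] continuous_on_compose2[OF g])
  qed
  then have "(conv a b f g has_derivative (\<lambda>v. integral (cbox (- M) M) (\<lambda>y. FD f (x - y) v * g y))) (at x)"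
    by (rule has_derivative_transform_within_open[OF _ open_ball[of x 1]])
      (auto intro!: conv_commute[symmetric] fc g z M)
  moreover have "integral (cbox (- M) M) (\<lambda>y. FD f (x - y) v * g y) = conv a b (\<lambda>y. FD f y v) g x" for v
    by (rule conv_commute[symmetric, OF f' g z' M]) auto
  ultimately show "(conv a b f g has_derivative (\<lambda>v. conv a b (\<lambda>y. FD f y v) g x)) (at x)" by simp
qed

section \<open>Approximation by convolution with Gaussians\<close>

definition gauss :: "nat \<Rightarrow> 'a::euclidean_space \<Rightarrow> real" where
  "gauss n x = exp (- real n * (x \<bullet> x))"

lemma Cn_on_gauss: "Cn_on m UNIV (gauss n)"
  unfolding gauss_def[abs_def]
  by (rule Cn_on_compose[OF open_UNIV open_UNIV _ Cn_on_norm_square[OF open_UNIV] Cn_on_exp]) auto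

lemma continuous_on_gauss: "continuous_on S (gauss n)"
  unfolding gauss_def[abs_def] by (intro continuous_intros)

text \<open>The mass over the box of integration instead of the whole space: dividing by it gives
  the kernel mass exactly 1 there, without evaluating a Gaussian integral.\<close>

definition gmass :: "nat \<Rightarrow> 'a::euclidean_space \<Rightarrow> real" where
  "gmass n M = integral (cbox (- M) M) (gauss n)"

text \<open>Near the origin uniform continuity controls \<open>f\<close>. At distance d and beyond
  the kernel is at most exp(-n d^2), while its mass is at least a constant times exp(-n d^2 / 4);
  the quotient decays exponentially.\<close>

lemma conv_gauss_uniform:
  fixes f :: "'a::euclidean_space \<Rightarrow> real"
  assumes f: "continuous_on UNIV f" and z: "\<And>y. y \<notin> cbox a b \<Longrightarrow> f y = 0" and e: "e > 0"
    and M: "0 \<in> box (- M) M" "\<And>x y. x \<in> K \<Longrightarrow> y \<in> cbox a b \<Longrightarrow> x - y \<in> cbox (- M) M"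
  shows "\<forall>\<^sub>F n in sequentially. \<forall>x\<in>K. \<bar>conv a b f (\<lambda>y. gauss n y / gmass n M) x - f x\<bar> \<le> e"
proof -
  have "compact (f ` cbox a b)" using f by (intro compact_continuous_image continuous_on_subset[OF f]) auto
  then obtain A0 where "\<forall>y\<in>f ` cbox a b. \<bar>y\<bar> \<le> A0" using bounded_real compact_imp_bounded by blast
  then have A0: "\<bar>f y\<bar> \<le> \<bar>A0\<bar>" for y using z by (cases "y \<in> cbox a b") fastforce+
  define A where "A = \<bar>A0\<bar>"
  have A: "\<bar>f y\<bar> \<le> A" "0 \<le> A" for y using A0 by (auto simp: A_def)
  \<comment> \<open>On a ball whose radius exceeds that of the support by 1 this is compactness. Two
    points at distance less than 1 that are not both in this ball both lie off the support.\<close>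
  have "uniformly_continuous_on UNIV f"
  proof -
    have "uniformly_continuous_on (cball 0 r) f" for r
      using f by (intro compact_uniformly_continuous continuous_on_subset[OF f]) auto
    obtain r where r: "\<And>y. y \<in> cbox a b \<Longrightarrow> norm y \<le> r" using bounded_cbox[of a b] unfolding bounded_iff by blast
    show ?thesis
      unfolding uniformly_continuous_on_def
    proof (intro allI impI)
      fix e :: real assume "e > 0"
      then obtain d where d: "d > 0" "\<And>x x'. x \<in> cball 0 (r + 1) \<Longrightarrow> x' \<in> cball 0 (r + 1) \<Longrightarrow> dist x' x < d \<Longrightarrow> dist (f x') (f x) < e"
        using \<open>uniformly_continuous_on (cball 0 (r + 1)) f\<close> unfolding uniformly_continuous_on_def by meson
      show "\<exists>d>0. \<forall>x\<in>UNIV. \<forall>x'\<in>UNIV. dist x' x < d \<longrightarrow> dist (f x') (f x) < e"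
      proof (intro exI[of _ "min d 1"] conjI ballI impI)
        fix x x' :: 'a assume xx: "dist x' x < min d 1"
        show "dist (f x') (f x) < e"
        proof (cases "x \<in> cball 0 (r + 1) \<and> x' \<in> cball 0 (r + 1)")
          case True
          then show ?thesis using d(2) xx by simp
        next
          case False
          have "norm x \<le> norm x' + dist x' x" "norm x' \<le> norm x + dist x' x"
            by (metis dist_commute dist_norm norm_triangle_sub)+
          then have "norm x > r \<and> norm x' > r" using False xx by auto
          then have "f x = 0" "f x' = 0" using z r by (meson not_le)+
          then show ?thesis using \<open>e > 0\<close> by simp
        qed
      qed (use d in auto)
    qed
  qed
  then obtain d where d: "d > 0" "\<And>x x'. dist x' x < d \<Longrightarrow> dist (f x') (f x) < e / 2"
    unfolding uniformly_continuous_on_def using e by (metis UNIV_I half_gt_zero)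
  have "open (ball 0 (d/2) \<inter> box (- M) M)" "0 \<in> ball 0 (d/2) \<inter> box (- M) M" using M d by auto
  then obtain p q where pq: "cbox p q \<subseteq> ball 0 (d/2) \<inter> box (- M) M" "\<forall>i\<in>Basis. p \<bullet> i < q \<bullet> i"
    by (rule open_contains_cbox)
  define V where "V = measure lborel (cbox p q)"
  define B where "B = measure lborel (cbox (- M) M)"
  have V: "V > 0" using pq(2) unfolding V_def content_pos_lt_eq .
  have B: "0 \<le> B" by (simp add: B_def)
  have mass: "gmass n M \<ge> exp (- real n * (d/2)\<^sup>2) * V" for n
  proof -
    have "((\<lambda>y. exp (- real n * (d/2)\<^sup>2)) has_integral exp (- real n * (d/2)\<^sup>2) * V) (cbox p q)"
      using has_integral_const[of "exp (- real n * (d/2)\<^sup>2)" p q] by (simp add: V_def mult.commute)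
    moreover have "(gauss n has_integral integral (cbox p q) (gauss n)) (cbox p q)"
      by (intro integrable_integral integrable_continuous continuous_on_gauss)
    moreover have "exp (- real n * (d/2)\<^sup>2) \<le> gauss n y" if "y \<in> cbox p q" for y
    proof -
      have "norm y < d / 2" using pq(1) that by auto
      then have "y \<bullet> y \<le> (d/2)\<^sup>2" using d by (metis norm_ge_zero order_less_imp_le power2_norm_eq_inner power_mono)
      then show ?thesis by (simp add: gauss_def mult_left_mono)
    qed
    ultimately have "exp (- real n * (d/2)\<^sup>2) * V \<le> integral (cbox p q) (gauss n)"
      by (rule has_integral_le)
    also have "\<dots> \<le> gmass n M"
      unfolding gmass_def using pq(1) box_subset_cbox[of "- M" M]
      by (intro integral_subset_le integrable_continuous continuous_on_gauss) (auto simp: gauss_def)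
    finally show ?thesis .
  qed
  have mpos: "gmass n M > 0" for n using mass[of n] V by (metis exp_gt_zero less_le_trans mult_pos_pos)
  have est: "\<bar>conv a b f (\<lambda>y. gauss n y / gmass n M) x - f x\<bar> \<le> e / 2 + 2 * A * B / V * exp (- (3 / 4 * d\<^sup>2) * real n)" if x: "x \<in> K" for n x
  proof -
    let ?m = "gmass n M" and ?B = "cbox (- M) M"
    have "conv a b f (\<lambda>y. gauss n y / ?m) x = integral ?B (\<lambda>y. f (x - y) * (gauss n y / ?m))"
      using mpos[of n] by (intro conv_commute f z M(2)[OF x]) (auto intro!: continuous_intros continuous_on_gauss)
    also have "\<dots> - f x = integral ?B (\<lambda>y. (f (x - y) - f x) * (gauss n y / ?m))"
    proof -
      have "integral ?B (\<lambda>y. f x * (gauss n y / ?m)) = f x"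
        using mpos[of n] by (simp add: gmass_def)
      moreover have "integral ?B (\<lambda>y. f (x - y) * (gauss n y / ?m) - f x * (gauss n y / ?m)) =
        integral ?B (\<lambda>y. f (x - y) * (gauss n y / ?m)) - integral ?B (\<lambda>y. f x * (gauss n y / ?m))"
        using mpos[of n] by (intro integral_diff integrable_continuous) (auto intro!: continuous_intros continuous_on_gauss continuous_on_compose2[OF f])
      ultimately show ?thesis by (simp only: left_diff_distrib)
    qed
    finally have eq: "conv a b f (\<lambda>y. gauss n y / ?m) x - f x = integral ?B (\<lambda>y. (f (x - y) - f x) * (gauss n y / ?m))" .
    have "norm (integral ?B (\<lambda>y. (f (x - y) - f x) * (gauss n y / ?m))) \<le> 
       integral ?B (\<lambda>y. e / 2 / ?m * gauss n y + 2 * A * exp (- real n * d\<^sup>2) / ?m)"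
    proof (rule integral_norm_bound_integral)
      show "(\<lambda>y. (f (x - y) - f x) * (gauss n y / ?m)) integrable_on ?B"
        using mpos[of n] by (intro integrable_continuous) (auto intro!: continuous_intros continuous_on_gauss continuous_on_compose2[OF f])
      show "(\<lambda>y. e / 2 / ?m * gauss n y + 2 * A * exp (- real n * d\<^sup>2) / ?m) integrable_on ?B"
        using mpos[of n] by (intro integrable_continuous) (auto intro!: continuous_intros continuous_on_gauss)
      fix y
      have "\<bar>f (x - y) - f x\<bar> * gauss n y \<le> e / 2 * gauss n y + 2 * A * exp (- real n * d\<^sup>2)"
      proof (cases "norm y < d")
        case True
        then have "\<bar>f (x - y) - f x\<bar> \<le> e / 2"
          using d(2)[of "x - y" x] by (simp add: dist_norm)
        then have "\<bar>f (x - y) - f x\<bar> * gauss n y \<le> e / 2 * gauss n y" by (intro mult_right_mono) (auto simp: gauss_def)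
        then show ?thesis using A(2) by (simp add: add_increasing2)
      next
        case False
        then have "d\<^sup>2 \<le> y \<bullet> y" using d by (metis linorder_not_less less_imp_le power2_norm_eq_inner power_mono)
        then have g: "gauss n y \<le> exp (- real n * d\<^sup>2)" by (simp add: gauss_def mult_left_mono)
        have "\<bar>f (x - y) - f x\<bar> \<le> 2 * A" using A(1)[of x] A(1)[of "x - y"] by linarith
        then have "\<bar>f (x - y) - f x\<bar> * gauss n y \<le> 2 * A * exp (- real n * d\<^sup>2)"
          using g A(2) by (intro mult_mono) (auto simp: gauss_def)
        then show ?thesis using e by (simp add: add_increasing gauss_def)
      qed
      then have "\<bar>f (x - y) - f x\<bar> * gauss n y / ?m \<le> (e / 2 * gauss n y + 2 * A * exp (- real n * d\<^sup>2)) / ?m"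
        using mpos[of n] by (intro divide_right_mono) auto
      moreover have "norm ((f (x - y) - f x) * (gauss n y / ?m)) = \<bar>f (x - y) - f x\<bar> * gauss n y / ?m"
        using mpos[of n] by (simp add: abs_mult gauss_def)
      ultimately show "norm ((f (x - y) - f x) * (gauss n y / ?m)) \<le> e / 2 / ?m * gauss n y + 2 * A * exp (- real n * d\<^sup>2) / ?m"
        by (simp add: add_divide_distrib)
    qed
    also have "\<dots> = e / 2 / ?m * ?m + B * (2 * A * exp (- real n * d\<^sup>2) / ?m)"
    proof -
      have "((\<lambda>y. e / 2 / ?m * gauss n y + 2 * A * exp (- real n * d\<^sup>2) / ?m) has_integral
         (e / 2 / ?m * ?m + B *\<^sub>R (2 * A * exp (- real n * d\<^sup>2) / ?m))) ?B"
        unfolding gmass_def B_def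
        by (intro has_integral_add has_integral_mult_right has_integral_const integrable_integral integrable_continuous continuous_on_gauss)
      from integral_unique[OF this] show ?thesis by simp
    qed
    also have "\<dots> = e / 2 + 2 * A * B * exp (- real n * d\<^sup>2) / ?m" using mpos[of n] by simp
    also have "\<dots> \<le> e / 2 + 2 * A * B * exp (- real n * d\<^sup>2) / (exp (- real n * (d/2)\<^sup>2) * V)"
      using mass[of n] A(2) B V mpos[of n] by (intro add_left_mono divide_left_mono mult_nonneg_nonneg) auto
    also have "\<dots> = e / 2 + 2 * A * B / V * (exp (- real n * d\<^sup>2) / exp (- real n * (d/2)\<^sup>2))" by (simp add: field_simps)
    also have "exp (- real n * d\<^sup>2) / exp (- real n * (d/2)\<^sup>2) = exp (- (3 / 4 * d\<^sup>2) * real n)"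
      by (simp add: exp_diff[symmetric] power_divide algebra_simps)
    finally show ?thesis unfolding eq by simp
  qed
  have "(\<lambda>n. exp (- (3 / 4 * d\<^sup>2)) ^ n) \<longlonglongrightarrow> 0"
    using d by (intro LIMSEQ_power_zero) auto
  then have "(\<lambda>n. 2 * A * B / V * exp (- (3 / 4 * d\<^sup>2)) ^ n) \<longlonglongrightarrow> 0"
    by (rule tendsto_mult_right_zero)
  from order_tendstoD(2)[OF this, of "e / 2"] have "\<forall>\<^sub>F n in sequentially. 2 * A * B / V * exp (- (3 / 4 * d\<^sup>2)) ^ n < e / 2"
    using e by simp
  then show ?thesis
  proof eventually_elim
    case (elim n)
    have "exp (- (3 / 4 * d\<^sup>2)) ^ n = exp (- (3 / 4 * d\<^sup>2) * real n)"
      by (rule exp_of_nat2_mult[symmetric])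
    then show ?case using elim est[of _ n] by fastforce
  qed
qed

text \<open>Convolution with the normalised Gaussian commutes with derivatives, so one kernel
  approximates the first and second derivatives simultaneously. The basis directions are finitely
  many, which makes the choice of \<open>n\<close> uniform.\<close>

proposition smooth_C2_approximation:
  fixes f :: "'a::euclidean_space \<Rightarrow> real"
  assumes f: "Cn_on 2 UNIV f" and z: "\<And>y. y \<notin> cbox a b \<Longrightarrow> f y = 0" and K: "bounded K" and e: "e > 0"
  obtains g where "\<And>m. Cn_on m UNIV g"
    "\<And>x v. x \<in> K \<Longrightarrow> \<bar>FD g x v - FD f x v\<bar> \<le> e * norm v"
    "\<And>x v w. x \<in> K \<Longrightarrow> \<bar>D2 g x v w - D2 f x v w\<bar> \<le> e * norm v * norm w"
proof -
  obtain M where M: "0 \<in> box (- M) M" "\<And>x y. x \<in> K \<Longrightarrow> y \<in> cbox a b \<Longrightarrow> x - y \<in> cbox (- M) M"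
    using symmetric_cbox_differences[OF K] by blast
  have f': "Cn_on (Suc (Suc 0)) UNIV f" using f by (simp only: numeral_2_eq_2)
  have f1: "Cn_on 1 UNIV f" by (rule Cn_on_mono[OF f]) simp
  have f1': "Cn_on 1 UNIV (\<lambda>x. FD f x v)" for v
    using Cn_on_FD[OF f'] by (simp only: One_nat_def)
  have f2: "continuous_on UNIV (\<lambda>x. D2 f x v w)" for v w
    using Cn_on_FD[OF Cn_on_FD[OF f']] by (simp only: D2_def Cn_on.simps)
  have z1: "y \<notin> cbox a b \<Longrightarrow> FD f y v = 0" for y v
    using conv_has_derivative(2)[OF f1 continuous_on_const z] .
  have z2: "y \<notin> cbox a b \<Longrightarrow> D2 f y v w = 0" for y v w
    unfolding D2_def using conv_has_derivative(2)[OF f1' continuous_on_const z1] .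
  define D where "D = real DIM('a)"
  have D: "D > 0" by (simp add: D_def)
  \<comment> \<open>A vector has D coordinates and a pair of vectors has D * D products of
    coordinates; dividing by the sum serves both estimates.\<close>
  define e' where "e' = e / (D + D * D)"
  have D2: "D + D * D > 0" using D by (simp add: add_pos_pos)
  have e': "e' > 0" using e D2 by (simp add: e'_def)
  let ?g = "\<lambda>n y. gauss n y / gmass n M"
  have "\<forall>\<^sub>F n in sequentially. \<forall>x\<in>K. \<bar>conv a b (\<lambda>y. FD f y v) (?g n) x - FD f x v\<bar> \<le> e'" for v
    by (rule conv_gauss_uniform[OF Cn_on_continuous[OF f1'] z1 e' M])
  then have ev1: "\<forall>\<^sub>F n in sequentially. \<forall>v\<in>Basis. \<forall>x\<in>K. \<bar>conv a b (\<lambda>y. FD f y v) (?g n) x - FD f x v\<bar> \<le> e'"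
    by (intro eventually_ball_finite) auto
  have "\<forall>\<^sub>F n in sequentially. \<forall>x\<in>K. \<bar>conv a b (\<lambda>y. D2 f y v w) (?g n) x - D2 f x v w\<bar> \<le> e'" for v w
    by (rule conv_gauss_uniform[OF f2 z2 e' M])
  then have "\<forall>\<^sub>F n in sequentially. \<forall>w\<in>Basis. \<forall>x\<in>K. \<bar>conv a b (\<lambda>y. D2 f y v w) (?g n) x - D2 f x v w\<bar> \<le> e'" for v
    by (intro eventually_ball_finite) auto
  then have ev2: "\<forall>\<^sub>F n in sequentially. \<forall>v\<in>Basis. \<forall>w\<in>Basis. \<forall>x\<in>K. \<bar>conv a b (\<lambda>y. D2 f y v w) (?g n) x - D2 f x v w\<bar> \<le> e'"
    by (intro eventually_ball_finite) auto
  from eventually_happens'[OF sequentially_bot eventually_conj[OF ev1 ev2]] obtain n where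
    n1: "\<And>v x. v \<in> Basis \<Longrightarrow> x \<in> K \<Longrightarrow> \<bar>conv a b (\<lambda>y. FD f y v) (?g n) x - FD f x v\<bar> \<le> e'" and
    n2: "\<And>v w x. v \<in> Basis \<Longrightarrow> w \<in> Basis \<Longrightarrow> x \<in> K \<Longrightarrow> \<bar>conv a b (\<lambda>y. D2 f y v w) (?g n) x - D2 f x v w\<bar> \<le> e'"
    by blast
  define g where "g = conv a b f (?g n)"
  have Cg: "Cn_on m UNIV g" for m
    unfolding g_def
    by (intro Cn_on_conv Cn_on_continuous[OF f] Cn_on_bounded_linear[OF bounded_linear_divide] open_UNIV Cn_on_gauss)
  have gc: "continuous_on UNIV (?g n)"
    using Cn_on_continuous[OF Cn_on_bounded_linear[OF bounded_linear_divide open_UNIV Cn_on_gauss]] .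
  have FDg: "(g has_derivative (\<lambda>v. conv a b (\<lambda>y. FD f y v) (?g n) x)) (at x)" for x
    unfolding g_def by (rule conv_has_derivative(1)[OF f1 gc z])
  have D2g: "D2 g x v w = conv a b (\<lambda>y. D2 f y v w) (?g n) x" for x v w
  proof -
    have "((\<lambda>x. conv a b (\<lambda>y. FD f y v) (?g n) x) has_derivative (\<lambda>w. conv a b (\<lambda>y. FD (\<lambda>y. FD f y v) y w) (?g n) x)) (at x)"
      by (rule conv_has_derivative(1)[OF f1' gc z1])
    from D2_eqI[OF open_UNIV UNIV_I FDg this] show ?thesis by (simp add: D2_def)
  qed
  have C2g: "Cn_on 2 UNIV g" by (rule Cg)
  show ?thesis
  proof
    show "Cn_on m UNIV g" for m by (rule Cg)
    fix x v w assume x: "x \<in> K"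
    have "FD g x v - FD f x v = (\<Sum>b\<in>Basis. (v \<bullet> b) * (FD g x b - FD f x b))"
      unfolding linear_eq_sum_Basis[OF FD_linear[OF f _ UNIV_I], of x v, simplified] 
        linear_eq_sum_Basis[OF FD_linear[OF C2g _ UNIV_I], of x v, simplified]
      by (simp add: sum_subtractf right_diff_distrib)
    then have "\<bar>FD g x v - FD f x v\<bar> \<le> (\<Sum>b\<in>Basis. \<bar>(v \<bullet> b) * (FD g x b - FD f x b)\<bar>)"
      by (simp add: sum_abs)
    also have "\<dots> \<le> (\<Sum>b\<in>(Basis::'a set). norm v * e')"
      unfolding abs_mult
    proof (intro sum_mono mult_mono Basis_le_norm)
      fix b :: 'a assume "b \<in> Basis"
      then show "\<bar>FD g x b - FD f x b\<bar> \<le> e'" using n1[OF _ x] FD_eqI[OF FDg] by simp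
    qed auto
    also have "\<dots> = D * e' * norm v" by (simp add: D_def)
    also have "\<dots> \<le> e * norm v"
      using D D2 e by (intro mult_right_mono) (auto simp: e'_def field_simps)
    finally show "\<bar>FD g x v - FD f x v\<bar> \<le> e * norm v" .
    have "D2 g x v w - D2 f x v w = (\<Sum>b\<in>Basis. \<Sum>c\<in>Basis. ((v \<bullet> b) * (w \<bullet> c)) * (D2 g x b c - D2 f x b c))"
      unfolding D2_expand[OF open_UNIV f UNIV_I, of x v w] D2_expand[OF open_UNIV C2g UNIV_I, of x v w]
      by (simp add: sum_subtractf right_diff_distrib)
    then have "\<bar>D2 g x v w - D2 f x v w\<bar> \<le> (\<Sum>b\<in>Basis. \<bar>\<Sum>c\<in>Basis. ((v \<bullet> b) * (w \<bullet> c)) * (D2 g x b c - D2 f x b c)\<bar>)"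
      by (simp add: sum_abs)
    also have "\<dots> \<le> (\<Sum>b\<in>Basis. \<Sum>c\<in>Basis. \<bar>((v \<bullet> b) * (w \<bullet> c)) * (D2 g x b c - D2 f x b c)\<bar>)"
      by (intro sum_mono sum_abs)
    also have "\<dots> \<le> (\<Sum>b\<in>(Basis::'a set). \<Sum>c\<in>(Basis::'a set). norm v * norm w * e')"
      unfolding abs_mult
    proof (intro sum_mono mult_mono Basis_le_norm mult_nonneg_nonneg)
      fix b c :: 'a assume "b \<in> Basis" "c \<in> Basis"
      then show "\<bar>D2 g x b c - D2 f x b c\<bar> \<le> e'" using n2[OF _ _ x] D2g by simp
    qed auto
    also have "\<dots> = D * D * e' * (norm v * norm w)" by (simp add: D_def)
    also have "\<dots> \<le> e * (norm v * norm w)"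
      using D D2 e by (intro mult_right_mono) (auto simp: e'_def field_simps)
    finally show "\<bar>D2 g x v w - D2 f x v w\<bar> \<le> e * norm v * norm w" by (simp add: mult.assoc)
  qed
qed

text \<open>Base point and direction both move with n, so differentiability at the limit point would
  not be sufficient. The mean value theorem reduces the quotient to the continuous derivative at an
  intermediate point.\<close>

lemma difference_quotient_tendsto:
  fixes f :: "'a::euclidean_space \<Rightarrow> real"
  assumes S: "open S" and f: "Cn_on 1 S f" and x: "x \<in> S" and X: "X \<longlonglongrightarrow> x" and V: "V \<longlonglongrightarrow> v"
    and e: "\<And>n. e n > 0" "e \<longlonglongrightarrow> 0"
  shows "(\<lambda>n. (f (X n + e n *\<^sub>R V n) - f (X n)) / e n) \<longlonglongrightarrow> FD f x v"
proof -
  obtain d where d: "d > 0" "ball x d \<subseteq> S" using S x openE by blast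
  define seg where "seg n \<longleftrightarrow> (\<forall>t. 0 \<le> t \<and> t \<le> e n \<longrightarrow> X n + t *\<^sub>R V n \<in> S)" for n
  have "\<exists>t. 0 \<le> t \<and> t \<le> e n \<and> (seg n \<longrightarrow> f (X n + e n *\<^sub>R V n) - f (X n) = e n * FD f (X n + t *\<^sub>R V n) (V n))" for n
  proof (cases "seg n")
    case True
    have "((\<lambda>t. f (X n + t *\<^sub>R V n)) has_real_derivative FD f (X n + t *\<^sub>R V n) (V n)) (at t)" if "0 \<le> t" "t \<le> e n" for t
      using True that by (intro line_has_real_derivative Cn_on_has_FD[OF f]) (auto simp: seg_def)
    from MVT2[OF e(1) this] obtain t where "0 < t" "t < e n" 
      "f (X n + e n *\<^sub>R V n) - f (X n + 0 *\<^sub>R V n) = (e n - 0) * FD f (X n + t *\<^sub>R V n) (V n)" by blast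
    then show ?thesis by (intro exI[of _ t]) auto
  next
    \<comment> \<open>Segments that leave \<open>S\<close> occur for finitely many n only; the value
      0 is a placeholder.\<close>
    case False
    then show ?thesis using e(1)[of n] by (intro exI[of _ 0]) auto
  qed
  then obtain t where t: "\<And>n. 0 \<le> t n" "\<And>n. t n \<le> e n" 
    "\<And>n. seg n \<Longrightarrow> f (X n + e n *\<^sub>R V n) - f (X n) = e n * FD f (X n + t n *\<^sub>R V n) (V n)" by metis
  have t0: "t \<longlonglongrightarrow> 0" by (rule tendsto_sandwich[OF _ _ tendsto_const e(2)]) (use t in auto)
  have "(\<lambda>n. X n + t n *\<^sub>R V n) \<longlonglongrightarrow> x + 0 *\<^sub>R v" by (intro tendsto_intros X V t0)
  then have lim: "(\<lambda>n. FD f (X n + t n *\<^sub>R V n) (V n)) \<longlonglongrightarrow> FD f x v"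
    by (intro FD_tendsto[OF S f _ x _ V]) auto
  have "(\<lambda>n. norm (X n - x) + e n * norm (V n)) \<longlonglongrightarrow> norm (x - x) + 0 * norm v"
    by (intro tendsto_intros X V e(2))
  then have "\<forall>\<^sub>F n in sequentially. norm (X n - x) + e n * norm (V n) < d"
    using order_tendstoD(2)[of _ _ sequentially d] d(1) by fastforce
  then have "\<forall>\<^sub>F n in sequentially. seg n"
  proof eventually_elim
    case (elim n)
    show ?case
      unfolding seg_def
    proof (intro allI impI)
      fix t assume t: "0 \<le> t \<and> t \<le> e n"
      have "norm (X n + t *\<^sub>R V n - x) \<le> norm (X n - x) + norm (t *\<^sub>R V n)"
        using norm_triangle_ineq[of "X n - x" "t *\<^sub>R V n"] by (simp add: algebra_simps)
      also have "norm (t *\<^sub>R V n) \<le> e n * norm (V n)" using t by (simp add: mult_right_mono)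
      finally have "dist (X n + t *\<^sub>R V n) x < d" using elim by (simp add: dist_norm)
      then show "X n + t *\<^sub>R V n \<in> S" using d(2) by (auto simp: dist_commute)
    qed
  qed
  then have "\<forall>\<^sub>F n in sequentially. FD f (X n + t n *\<^sub>R V n) (V n) = (f (X n + e n *\<^sub>R V n) - f (X n)) / e n"
    by eventually_elim (use t(3) e(1) in \<open>simp add: less_imp_neq[symmetric]\<close>)
  then show ?thesis using lim tendsto_cong by fastforce
qed

section \<open>A cutoff function of class C^2\<close>

lemma max_power_has_derivative:
  assumes "1 \<le> k"
  shows "((\<lambda>x::real. max 0 x ^ Suc k) has_real_derivative real (Suc k) * max 0 x ^ k) (at x)"
proof -
  consider "x < 0" | "x = 0" | "0 < x" by linarith
  then show ?thesis
  proof cases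
    case 1
    have "((\<lambda>x::real. 0) has_real_derivative 0) (at x)" by simp
    then have "((\<lambda>x::real. max 0 x ^ Suc k) has_real_derivative 0) (at x)"
      by (rule has_field_derivative_transform_within_open[of _ _ _ "{..<0}"]) (use 1 in auto)
    then show ?thesis using 1 assms by (simp add: power_0_left)
  next
    case 2
    have "((\<lambda>y. (max 0 y ^ Suc k - max 0 0 ^ Suc k) / (y - 0)) \<longlongrightarrow> 0) (at (0::real))"
    proof (rule Lim_null_comparison)
      show "((\<lambda>y::real. \<bar>y\<bar> ^ k) \<longlongrightarrow> 0) (at 0)"
        using assms by (auto intro!: tendsto_eq_intros)
      have "norm ((max 0 y ^ Suc k - max 0 0 ^ Suc k) / (y - 0)) \<le> \<bar>y\<bar> ^ k" for y :: real
        by (cases "y > 0") (auto simp: max_def)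
      then show "\<forall>\<^sub>F y in at (0::real). norm ((max 0 y ^ Suc k - max 0 0 ^ Suc k) / (y - 0)) \<le> \<bar>y\<bar> ^ k" by simp
    qed
    then show ?thesis using 2 assms by (simp add: has_field_derivative_iff power_0_left)
  next
    case 3
    have "((\<lambda>x::real. x ^ Suc k) has_real_derivative real (Suc k) * x ^ k) (at x)"
      using DERIV_pow[of "Suc k" x] by simp
    then have "((\<lambda>x::real. max 0 x ^ Suc k) has_real_derivative real (Suc k) * x ^ k) (at x)"
      by (rule has_field_derivative_transform_within_open[of _ _ _ "{0<..}"]) (use 3 in auto)
    then show ?thesis using 3 by simp
  qed
qed

text \<open>A cutoff built from this cube has the same class C^2 as the function it will multiply;
  smoothness is produced later by convolution.\<close>

lemma Cn_on_max_cube: "Cn_on 2 UNIV (\<lambda>x::real. max 0 x ^ 3)"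
proof -
  have C0: "Cn_on 0 UNIV (\<lambda>x::real. real 2 * max 0 x ^ 1)" by (auto intro!: continuous_intros)
  have D1: "((\<lambda>x::real. max 0 x ^ 2) has_real_derivative real 2 * max 0 x ^ 1) (at x)" for x
    using max_power_has_derivative[of 1 x] by (simp add: numeral_2_eq_2)
  have D2: "((\<lambda>x::real. max 0 x ^ 3) has_real_derivative real 3 * max 0 x ^ 2) (at x)" for x
    using max_power_has_derivative[of 2 x] by (simp add: numeral_3_eq_3)
  have "Cn_on (Suc 0) UNIV (\<lambda>x::real. max 0 x ^ 2)"
    by (rule Cn_on_real_SucI[OF open_UNIV D1 C0])
  then have "Cn_on (Suc 0) UNIV (\<lambda>x::real. real 3 * max 0 x ^ 2)"
    by (intro Cn_on_mult Cn_on_const open_UNIV)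
  from Cn_on_real_SucI[OF open_UNIV D2 this] show ?thesis by (simp only: numeral_2_eq_2)
qed

lemma cutoff_exists:
  assumes d: "0 < (d::real)"
  obtains \<theta> :: "real \<Rightarrow> real" where "Cn_on 2 UNIV \<theta>" "\<And>t. \<bar>t\<bar> \<le> d / 2 \<Longrightarrow> \<theta> t = 1" "\<And>t. d \<le> \<bar>t\<bar> \<Longrightarrow> \<theta> t = 0"
proof -
  \<comment> \<open>At |t| = d the base of the cube in \<open>h\<close> equals 3 d^2 / 4, so this
    \<open>M\<close> makes M * h reach 1 there.\<close>
  define M where "M = 1 / (3 * d\<^sup>2 / 4) ^ 3"
  define h where "h t = max 0 (t * t - d\<^sup>2 / 4) ^ 3" for t :: real
  define \<theta> where "\<theta> t = max 0 (1 - M * h t) ^ 3" for t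
  have "Cn_on 2 UNIV h"
    unfolding h_def[abs_def]
    by (rule Cn_on_compose[OF open_UNIV open_UNIV _ _ Cn_on_max_cube])
      (auto intro!: Cn_on_diff Cn_on_mult Cn_on_id simp del: Cn_on.simps)
  then have 1: "Cn_on 2 UNIV \<theta>"
    unfolding \<theta>_def[abs_def]
    by (intro Cn_on_compose[OF open_UNIV open_UNIV _ _ Cn_on_max_cube] Cn_on_diff Cn_on_mult Cn_on_const open_UNIV) auto
  have 2: "\<theta> t = 1" if "\<bar>t\<bar> \<le> d / 2" for t
  proof -
    have "t * t \<le> (d / 2)\<^sup>2" using power_mono[OF that, of 2] by (simp add: power2_eq_square)
    then have "h t = 0" by (simp add: h_def power_divide max_def)
    then show ?thesis by (simp add: \<theta>_def)
  qed
  have 3: "\<theta> t = 0" if "d \<le> \<bar>t\<bar>" for t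
  proof -
    have "d\<^sup>2 \<le> t * t" using power_mono[OF that, of 2] d by (simp add: power2_eq_square)
    then have "3 * d\<^sup>2 / 4 \<le> t * t - d\<^sup>2 / 4" by simp
    then have "3 * d\<^sup>2 / 4 \<le> max 0 (t * t - d\<^sup>2 / 4)" by (rule order_trans[OF _ max.cobounded2])
    then have "(3 * d\<^sup>2 / 4) ^ 3 \<le> h t" unfolding h_def using d by (intro power_mono) auto
    moreover have "0 < (3 * d\<^sup>2 / 4) ^ 3" using d by simp
    ultimately have "1 \<le> M * h t" by (simp add: M_def field_simps)
    then show ?thesis by (simp add: \<theta>_def max_def)
  qed
  show ?thesis using that 1 2 3 by blast
qed

section \<open>Regularity of the signed distance function\<close>

text \<open>Let \<open>h\<close> be the part of \<open>g\<close> orthogonal to \<open>a\<close>.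
  Tilted slightly towards \<open>a\<close> it becomes an admissible \<open>w\<close>; letting the
  tilt tend to zero gives g \<bullet> h \<le> 0, but this product is |h|^2.\<close>

lemma obtuse_imp_antiparallel:
  fixes a g :: "'a::real_inner"
  assumes a: "a \<noteq> 0" and obt: "\<And>w. 0 < w \<bullet> a \<Longrightarrow> g \<bullet> w \<le> 0"
  obtains \<mu> where "0 \<le> \<mu>" "g = - (\<mu> *\<^sub>R a)"
proof -
  have aa: "a \<bullet> a > 0" using a by simp
  define h where "h = g - ((g \<bullet> a) / (a \<bullet> a)) *\<^sub>R a"
  have ha: "h \<bullet> a = 0" using aa by (simp add: h_def inner_diff_left)
  have "g \<bullet> h \<le> 0"
  proof (rule field_le_epsilon)
    fix e :: real assume e: "0 < e"
    define c where "c = e / (1 + \<bar>g \<bullet> a\<bar>)"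
    have c: "0 < c" using e by (simp add: c_def add_pos_nonneg)
    have "(h + c *\<^sub>R a) \<bullet> a > 0" using c aa by (simp add: inner_add_left ha)
    from obt[OF this] have "g \<bullet> h + c * (g \<bullet> a) \<le> 0" by (simp add: inner_add_right)
    moreover have "- (c * (g \<bullet> a)) \<le> c * \<bar>g \<bullet> a\<bar>" 
      using mult_left_mono[OF abs_ge_minus_self[of "g \<bullet> a"], of c] c by simp
    moreover have "c * \<bar>g \<bullet> a\<bar> \<le> e" using e by (simp add: c_def field_simps)
    ultimately show "g \<bullet> h \<le> 0 + e" by linarith
  qed
  moreover have "g \<bullet> h = h \<bullet> h"
    using ha by (simp add: h_def inner_diff_left inner_diff_right inner_commute)
  ultimately have "h = 0" by (metis inner_gt_zero_iff not_le)
  then have "g = ((g \<bullet> a) / (a \<bullet> a)) *\<^sub>R a" by (simp add: h_def)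
  moreover have "g \<bullet> a \<le> 0" using obt[of a] aa by simp
  ultimately show ?thesis
    using that[of "- ((g \<bullet> a) / (a \<bullet> a))"] aa by (auto simp: divide_nonpos_pos)
qed

definition grad :: "('a::euclidean_space \<Rightarrow> real) \<Rightarrow> 'a \<Rightarrow> 'a" where
  "grad f x = (\<Sum>b\<in>Basis. FD f x b *\<^sub>R b)"

lemma inner_grad: "(f has_derivative f') (at x) \<Longrightarrow> grad f x \<bullet> v = f' v"
proof -
  assume f: "(f has_derivative f') (at x)"
  have "f' v = (\<Sum>b\<in>Basis. (v \<bullet> b) *\<^sub>R f' b)"
    by (rule linear_eq_sum_Basis[OF has_derivative_linear[OF f]])
  then show ?thesis
    by (simp add: grad_def FD_eqI[OF f] inner_sum_left inner_sum_right inner_commute mult.commute)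
qed

lemma grad_eqI:
  assumes "(f has_derivative (\<lambda>v. g \<bullet> v)) (at x)"
  shows "grad f x = g"
  using inner_grad[OF assms] by (metis inner_eq_zero_iff inner_diff_left right_minus_eq)

lemma Cn_on_grad: "open S \<Longrightarrow> Cn_on (Suc m) S f \<Longrightarrow> Cn_on m S (grad f)"
  unfolding grad_def[abs_def] by (intro Cn_on_sum Cn_on_scaleR Cn_on_FD Cn_on_const) auto

text \<open>The derivative of the inverse solves a linear system with operator
  \<open>FD F (G y)\<close>. Its coefficients are as regular as \<open>G\<close> allows, so
  \<open>Cn_on_linear_solve\<close> raises the class of \<open>G\<close> by one at each step until
  that of \<open>F\<close> is reached.\<close>

lemma Cn_on_inverse_function:
  fixes F :: "'a::euclidean_space \<Rightarrow> 'a"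
  assumes T: "open T" and V: "open V" and F: "Cn_on m T F" and GT: "\<And>y. y \<in> V \<Longrightarrow> G y \<in> T" and G: "continuous_on V G"
    and dG: "\<And>y. y \<in> V \<Longrightarrow> (G has_derivative G' y) (at y)"
    and inj: "\<And>y. y \<in> V \<Longrightarrow> inj (FD F (G y))"
    and inv: "\<And>y w. y \<in> V \<Longrightarrow> FD F (G y) (G' y w) = w"
  shows "Cn_on m V G"
proof -
  have "l \<le> m \<Longrightarrow> Cn_on l V G" for l
  proof (induction l)
    case (Suc l)
    have "Cn_on (Suc l) T F" using Cn_on_mono[OF F Suc.prems] .
    then have FDC: "Cn_on l T (\<lambda>x. FD F x w)" for w by (rule Cn_on_FD)
    have lin: "linear (FD F (G y))" if "y \<in> V" for y
      using FD_linear[OF F _ GT[OF that]] Suc.prems by simp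
    have IH: "Cn_on l V G" using Suc by simp
    have "Cn_on l V (\<lambda>y. G' y w)" for w
    proof (rule Cn_on_linear_solve[OF V lin inj])
      show "Cn_on l V (\<lambda>y. FD F (G y) w)" for w
        by (rule Cn_on_compose[OF V T GT IH FDC])
    qed (use inv in auto)
    with dG show ?case by (intro Cn_on_SucI[OF V, of G G'])
  qed (use G in simp)
  then show ?thesis by blast
qed

text \<open>The open ball about \<open>z\<close> with the nearest point \<open>y\<close> on its
  sphere avoids the boundary, hence lies entirely on one side. In directions entering the ball at
  \<open>y\<close> the function \<rho> therefore cannot increase (inside) or decrease (outside),
  which makes its gradient parallel to z - y and fixes the sign.\<close>

lemma nearest_point_normal:
  fixes \<Omega> :: "'a::euclidean_space set"
  assumes op: "open \<Omega>" and df: "defining_function k \<Omega> W \<rho>" and k: "1 \<le> k"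
    and y: "y \<in> frontier \<Omega>" "infdist z (frontier \<Omega>) = dist z y" and g: "grad \<rho> y \<noteq> 0"
  obtains s where "z = y + s *\<^sub>R grad \<rho> y" "sdist \<Omega> z = s * norm (grad \<rho> y)"
proof (cases "z = y")
  case True
  have "y \<notin> \<Omega>" using op y(1) by (simp add: frontier_def interior_open)
  then show ?thesis
    using that[of 0] y by (simp add: sdist_def True)
next
  case False
  have W: "open W" "frontier \<Omega> \<subseteq> W" using df by (auto simp: defining_function_def nbhd_of_boundary_def)
  have neg: "z \<in> W \<Longrightarrow> z \<in> \<Omega> \<Longrightarrow> \<rho> z < 0" and pos: "z \<in> W \<Longrightarrow> z \<notin> closure \<Omega> \<Longrightarrow> \<rho> z > 0"
    and zero: "z \<in> frontier \<Omega> \<Longrightarrow> \<rho> z = 0" for z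
    using df by (auto simp: defining_function_def)
  have yW: "y \<in> W" using W y by blast
  have "Cn_on 1 W \<rho>" using df k by (auto simp: defining_function_def Ck_on_def one_enat_def)
  then have der: "(\<rho> has_derivative FD \<rho> y) (at y)" using Cn_on_has_FD yW by blast
  define R where "R = dist z y"
  have R: "R > 0" using False by (simp add: R_def)
  have ball: "ball z R \<inter> frontier \<Omega> = {}"
    using y(2) infdist_le[of _ "frontier \<Omega>" z] by (fastforce simp: R_def)
  \<comment> \<open>Directions with a positive component along z - y enter the ball; tangential ones
    need not, whence the strict inequality assumed in
    \<open>obtuse_imp_antiparallel\<close>.\<close>
  have key: "\<forall>\<^sub>F s in at_right 0. y + s *\<^sub>R w \<in> ball z R \<inter> W" if w: "0 < w \<bullet> (z - y)" for w
  proof -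
    have "\<forall>\<^sub>F s in at_right 0. s * (w \<bullet> w) < 2 * (w \<bullet> (z - y))"
    proof -
      have "((\<lambda>s. s * (w \<bullet> w)) \<longlongrightarrow> 0 * (w \<bullet> w)) (at_right 0)" by (intro tendsto_intros)
      then have "((\<lambda>s. s * (w \<bullet> w)) \<longlongrightarrow> 0) (at_right 0)" by simp
      from order_tendstoD(2)[OF this, of "2 * (w \<bullet> (z - y))"] show ?thesis using w by simp
    qed
    moreover have "\<forall>\<^sub>F s in at_right 0. y + s *\<^sub>R w \<in> W"
    proof -
      have "((\<lambda>s. y + s *\<^sub>R w) \<longlongrightarrow> y + 0 *\<^sub>R w) (at_right 0)" by (intro tendsto_intros)
      then show ?thesis using topological_tendstoD[OF _ W(1)] yW by simp
    qed
    moreover have "\<forall>\<^sub>F s in at_right 0. (0::real) < s" by (simp add: eventually_at_right_less)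
    ultimately show ?thesis
    proof eventually_elim
      case (elim s)
      have "(dist z (y + s *\<^sub>R w))\<^sup>2 = (z - y - s *\<^sub>R w) \<bullet> (z - y - s *\<^sub>R w)"
        by (simp add: dist_norm power2_norm_eq_inner algebra_simps)
      also have "\<dots> = R\<^sup>2 - s * (2 * (w \<bullet> (z - y)) - s * (w \<bullet> w))"
        by (simp add: R_def dist_norm power2_norm_eq_inner inner_diff_left inner_diff_right inner_commute algebra_simps)
      also have "\<dots> < R\<^sup>2" using elim by simp
      finally have "dist z (y + s *\<^sub>R w) < R"
        using R by (simp add: power_less_imp_less_base)
      then show ?case using elim by simp
    qed
  qed
  have line: "((\<lambda>s. \<rho> (y + s *\<^sub>R w)) has_real_derivative grad \<rho> y \<bullet> w) (at 0)" for w
    using line_has_real_derivative[of \<rho> "FD \<rho> y" y 0 w] der inner_grad[OF der] by simp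
  have zy: "z - y \<noteq> 0" using False by simp
  show ?thesis
  proof (cases "z \<in> \<Omega>")
    case True
    have "ball z R \<subseteq> \<Omega>"
    proof (rule ccontr)
      assume *: "\<not> ball z R \<subseteq> \<Omega>"
      have "ball z R \<inter> frontier \<Omega> \<noteq> {}"
      proof (rule connected_Int_frontier[OF connected_ball])
        show "ball z R \<inter> \<Omega> \<noteq> {}" using True R by (metis IntI centre_in_ball empty_iff)
      qed (use * in blast)
      then show False using ball by blast
    qed
    have "grad \<rho> y \<bullet> w \<le> 0" if w: "0 < w \<bullet> (z - y)" for w
    proof (rule ccontr)
      assume "\<not> grad \<rho> y \<bullet> w \<le> 0"
      then obtain d where d: "0 < d" "\<And>h. 0 < h \<Longrightarrow> h < d \<Longrightarrow> \<rho> y < \<rho> (y + h *\<^sub>R w)"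
        using DERIV_pos_inc_right[OF line[of w]] by auto
      then have "\<forall>\<^sub>F s in at_right 0. \<rho> y < \<rho> (y + s *\<^sub>R w)"
        by (auto simp: eventually_at_right_field)
      with key[OF w] have "\<forall>\<^sub>F s in at_right 0. \<rho> y < \<rho> (y + s *\<^sub>R w) \<and> y + s *\<^sub>R w \<in> ball z R \<inter> W"
        by (simp add: eventually_conj_iff)
      then obtain s where "\<rho> y < \<rho> (y + s *\<^sub>R w)" "y + s *\<^sub>R w \<in> ball z R \<inter> W"
        using eventually_happens trivial_limit_at_right_real by blast
      then show False using neg[of "y + s *\<^sub>R w"] zero[OF y(1)] \<open>ball z R \<subseteq> \<Omega>\<close> by force
    qed
    then obtain \<mu> where mu: "0 \<le> \<mu>" "grad \<rho> y = - (\<mu> *\<^sub>R (z - y))"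
      using obtuse_imp_antiparallel[OF zy] by metis
    with g have "\<mu> > 0" by (cases "\<mu> = 0") auto
    then show ?thesis
      using that[of "- (1 / \<mu>)"] mu True y(2) by (simp add: sdist_def dist_norm)
  next
    case nz: False
    have "ball z R \<inter> closure \<Omega> = {}"
    proof (rule ccontr)
      assume "ball z R \<inter> closure \<Omega> \<noteq> {}"
      then have "ball z R \<inter> \<Omega> \<noteq> {}" by (simp add: open_Int_closure_eq_empty)
      then have "ball z R \<inter> frontier \<Omega> \<noteq> {}"
      proof (rule connected_Int_frontier[OF connected_ball])
        show "ball z R - \<Omega> \<noteq> {}" using nz R by (metis Diff_iff centre_in_ball empty_iff)
      qed
      then show False using ball by blast
    qed
    have "(- grad \<rho> y) \<bullet> w \<le> 0" if w: "0 < w \<bullet> (z - y)" for w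
    proof (rule ccontr)
      assume "\<not> (- grad \<rho> y) \<bullet> w \<le> 0"
      then obtain d where d: "0 < d" "\<And>h. 0 < h \<Longrightarrow> h < d \<Longrightarrow> \<rho> y > \<rho> (y + h *\<^sub>R w)"
        using DERIV_neg_dec_right[OF line[of w]] by auto
      then have "\<forall>\<^sub>F s in at_right 0. \<rho> y > \<rho> (y + s *\<^sub>R w)"
        by (auto simp: eventually_at_right_field)
      with key[OF w] have "\<forall>\<^sub>F s in at_right 0. \<rho> y > \<rho> (y + s *\<^sub>R w) \<and> y + s *\<^sub>R w \<in> ball z R \<inter> W"
        by (simp add: eventually_conj_iff)
      then obtain s where "\<rho> y > \<rho> (y + s *\<^sub>R w)" "y + s *\<^sub>R w \<in> ball z R \<inter> W"
        using eventually_happens trivial_limit_at_right_real by blast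
      then show False using pos[of "y + s *\<^sub>R w"] zero[OF y(1)] \<open>ball z R \<inter> closure \<Omega> = {}\<close> by force
    qed
    then obtain \<mu> where mu: "0 \<le> \<mu>" "- grad \<rho> y = - (\<mu> *\<^sub>R (z - y))"
      using obtuse_imp_antiparallel[OF zy] by metis
    with g have "\<mu> > 0" by (cases "\<mu> = 0") auto
    then show ?thesis
      using that[of "1 / \<mu>"] mu nz y(2) by (simp add: sdist_def dist_norm)
  qed
qed

lemma Cn_on_normalize:
  fixes g :: "'a::real_normed_vector \<Rightarrow> 'b::euclidean_space"
  assumes "open S" "Cn_on m S g" "\<And>x. x \<in> S \<Longrightarrow> g x \<noteq> 0"
  shows "Cn_on m S (\<lambda>x. g x /\<^sub>R norm (g x))"
proof -
  have "Cn_on m S (\<lambda>x. sqrt (g x \<bullet> g x))"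
    by (rule Cn_on_compose[OF assms(1) _ _ Cn_on_inner[OF assms(1,2,2)] Cn_on_sqrt]) (use assms(3) in auto)
  then have "Cn_on m S (\<lambda>x. inverse (sqrt (g x \<bullet> g x)))"
    by (rule Cn_on_compose[OF assms(1) _ _ _ Cn_on_inverse, rotated 2]) (use assms(3) in auto)
  then show ?thesis
    using Cn_on_scaleR[OF assms(1) _ assms(2)] by (simp add: norm_eq_sqrt_inner)
qed

text \<open>The pair \<open>(x, t)\<close> below inverts \<open>(x, t) \<mapsto> x + t \<nabla>\<rho>(x)\<close> on the boundary times the line.\<close>

lemma local_projection:
  fixes \<Omega> :: "'a::euclidean_space set"
  assumes op: "open \<Omega>" and df: "defining_function k \<Omega> W \<rho>" and k: "2 \<le> k" and p: "p \<in> frontier \<Omega>"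
  obtains V x t where "open V" "p \<in> V" 
    "\<And>m. enat (Suc m) \<le> k \<Longrightarrow> Cn_on m V x" "\<And>m. enat (Suc m) \<le> k \<Longrightarrow> Cn_on m V t"
    "\<And>z. z \<in> V \<Longrightarrow> x z \<in> frontier \<Omega>" "\<And>z. z \<in> V \<Longrightarrow> z = x z + t z *\<^sub>R grad \<rho> (x z)"
    "\<And>z. z \<in> V \<Longrightarrow> sdist \<Omega> z = t z * norm (grad \<rho> (x z))"
    "\<And>z. z \<in> V \<Longrightarrow> z \<in> frontier \<Omega> \<Longrightarrow> x z = z"
proof -
  have W: "open W" "frontier \<Omega> \<subseteq> W" using df by (auto simp: defining_function_def nbhd_of_boundary_def)
  have zero: "z \<in> frontier \<Omega> \<Longrightarrow> \<rho> z = 0" for z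
    using df by (auto simp: defining_function_def)
  have pW: "p \<in> W" using W p by blast
  have C\<rho>: "Cn_on m W \<rho>" if "enat m \<le> k" for m
    using df that by (auto simp: defining_function_def Ck_on_def)
  have k1: "1 \<le> k" using k by (metis one_le_numeral order_trans)
  have C1: "Cn_on 1 W \<rho>" and C2: "Cn_on (Suc 1) W \<rho>"
    using C\<rho>[of 1] C\<rho>[of 2] k k1 by (simp_all only: one_enat_def numeral_eq_enat Suc_1)
  have der\<rho>: "(\<rho> has_derivative (\<lambda>v. grad \<rho> y \<bullet> v)) (at y)" if "y \<in> W" for y
    using Cn_on_has_FD[OF C1 _ that] inner_grad[of \<rho> _ y] by auto
  have g0: "grad \<rho> y \<noteq> 0" if y: "y \<in> frontier \<Omega>" for y
  proof
    assume "grad \<rho> y = 0"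
    then have "FD \<rho> y = (\<lambda>v. 0)" using FD_eqI[OF der\<rho>[of y]] y W by auto
    then show False using df y by (auto simp: defining_function_def)
  qed
  define T where "T = W \<times> (UNIV :: real set)"
  have T: "open T" unfolding T_def using W by (intro open_Times) auto
  \<comment> \<open>The extra coordinate \<rho> x replaces the boundary by the open set
    \<open>W\<close>: the map goes between spaces of equal dimension, and the inverse function
    theorem applies without charts. Points of the boundary are recovered as those with last
    coordinate 0.\<close>
  define F where "F = (\<lambda>(x, s). (x + s *\<^sub>R grad \<rho> x, \<rho> x))"
  \<comment> \<open>One derivative is lost because \<open>F\<close> contains the gradient of
    \<rho>.\<close>
  have CF: "Cn_on m T F" if "enat (Suc m) \<le> k" for m
  proof -
    have f: "Cn_on m T fst" and s: "Cn_on m T snd"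
      by (intro Cn_on_linear bounded_linear_fst bounded_linear_snd T)+
    have gr: "Cn_on m W (grad \<rho>)" by (rule Cn_on_grad[OF W(1) C\<rho>[OF that]])
    have "enat m \<le> k" using that by (metis Suc_ile_eq order_less_imp_le)
    then have r: "Cn_on m T (\<lambda>z. \<rho> (fst z))"
      by (intro Cn_on_compose[OF T W(1) _ f C\<rho>]) (auto simp: T_def)
    have "Cn_on m T (\<lambda>z. grad \<rho> (fst z))"
      by (intro Cn_on_compose[OF T W(1) _ f gr]) (auto simp: T_def)
    then have "Cn_on m T (\<lambda>z. (fst z + snd z *\<^sub>R grad \<rho> (fst z), \<rho> (fst z)))"
      by (intro Cn_on_Pair Cn_on_add Cn_on_scaleR T f s r)
    then show ?thesis by (simp add: F_def case_prod_beta')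
  qed
  have "enat (Suc 1) \<le> k" using k by (metis Suc_1 numeral_eq_enat)
  then have CF1: "Cn_on 1 T F" by (rule CF)
  let ?p = "(p, 0::real)"
  have pT: "?p \<in> T" using pW by (simp add: T_def)
  have derF: "(F has_derivative FD F z) (at z)" if "z \<in> T" for z
    using Cn_on_has_FD[OF CF1 _ that] by simp
  have bl: "bounded_linear (FD F z)" if "z \<in> T" for z
    using has_derivative_bounded_linear[OF derF[OF that]] .
  define F' where "F' z = Blinfun (FD F z)" for z
  have F': "blinfun_apply (F' z) = FD F z" if "z \<in> T" for z
    using bl[OF that] by (simp add: F'_def bounded_linear_Blinfun_apply)
  have contF': "continuous_on T F'"
  proof (rule continuous_on_blinfun_componentwise)
    fix i :: "'a \<times> real" assume "i \<in> Basis"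
    have "Cn_on (Suc 0) T F" using CF1 by (simp only: One_nat_def)
    from Cn_on_FD[OF this, of i] have "continuous_on T (\<lambda>z. FD F z i)" by (simp only: Cn_on.simps)
    then show "continuous_on T (\<lambda>z. blinfun_apply (F' z) i)"
      by (rule continuous_on_eq) (simp add: F')
  qed
  have FDp: "FD F ?p = (\<lambda>(v, s). (v + s *\<^sub>R grad \<rho> p, grad \<rho> p \<bullet> v))"
  proof (rule FD_eqI)
    have f: "(fst has_derivative fst) (at ?p)" "(snd has_derivative snd) (at ?p)"
      by (auto intro!: derivative_eq_intros)
    have "(grad \<rho> has_derivative FD (grad \<rho>) (fst ?p)) (at (fst ?p))"
      using Cn_on_has_FD[OF Cn_on_grad[OF W(1) C2] _ pW] by simp
    from has_derivative_compose[OF f(1) this]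
    have g: "((\<lambda>z. grad \<rho> (fst z)) has_derivative (\<lambda>v. FD (grad \<rho>) p (fst v))) (at ?p)" by simp
    have r: "((\<lambda>z. \<rho> (fst z)) has_derivative (\<lambda>v. grad \<rho> p \<bullet> fst v)) (at ?p)"
      using has_derivative_compose[OF f(1), of \<rho>] der\<rho>[OF pW] by simp
    have "((\<lambda>z. (fst z + snd z *\<^sub>R grad \<rho> (fst z), \<rho> (fst z))) has_derivative
      (\<lambda>v. (fst v + (snd ?p *\<^sub>R FD (grad \<rho>) p (fst v) + snd v *\<^sub>R grad \<rho> (fst ?p)), grad \<rho> p \<bullet> fst v))) (at ?p)"
      by (intro has_derivative_Pair has_derivative_add has_derivative_scaleR f g r)
    then show "(F has_derivative (\<lambda>(v, s). (v + s *\<^sub>R grad \<rho> p, grad \<rho> p \<bullet> v))) (at ?p)"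
      by (simp add: F_def case_prod_beta')
  qed
  have linp: "linear (FD F ?p)" using bl[OF pT] by (rule bounded_linear.linear)
  have "inj (FD F ?p)"
  proof (rule linear_injective_0[OF linp, THEN iffD2], clarify)
    fix v s assume "FD F ?p (v, s) = 0"
    then have *: "v + s *\<^sub>R grad \<rho> p = 0" "grad \<rho> p \<bullet> v = 0" by (auto simp: FDp zero_prod_def)
    then have "v = - (s *\<^sub>R grad \<rho> p)" by (simp add: eq_neg_iff_add_eq_0)
    with *(2) have "s * (grad \<rho> p \<bullet> grad \<rho> p) = 0" by simp
    then have "s = 0" using g0[OF p] by simp
    then show "(v, s) = 0" using * by (simp add: zero_prod_def)
  qed
  then obtain I where I: "linear I" "I \<circ> FD F ?p = id"
    using linear_injective_left_inverse[OF linp] by blast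
  have I': "blinfun_apply (Blinfun I) = I" using I(1) by (simp add: bounded_linear_Blinfun_apply linear_conv_bounded_linear)
  have "Blinfun I o\<^sub>L F' ?p = id_blinfun"
  proof (rule blinfun_eqI)
    fix i show "blinfun_apply (Blinfun I o\<^sub>L F' ?p) i = blinfun_apply id_blinfun i"
      using fun_cong[OF I(2), of i] unfolding blinfun_apply_blinfun_compose I' F'[OF pT] by simp
  qed
  moreover have "(F has_derivative blinfun_apply (F' z)) (at z)" if "z \<in> T" for z
    unfolding F'[OF that] by (rule derF[OF that])
  ultimately obtain U' V' G G' where UV: "open U'" "U' \<subseteq> T" "?p \<in> U'" "open V'" "F ?p \<in> V'" "homeomorphism U' V' F G"
    and G': "\<And>y. y \<in> V' \<Longrightarrow> (G has_derivative G' y) (at y)" "\<And>y. y \<in> V' \<Longrightarrow> G' y = inv (blinfun_apply (F' (G y)))"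
      "\<And>y. y \<in> V' \<Longrightarrow> bij (blinfun_apply (F' (G y)))"
    using inverse_function_theorem[OF T _ contF' pT] by metis
  have GU: "G y \<in> U'" if "y \<in> V'" for y using UV(6) that by (auto simp: homeomorphism_def)
  have GT: "G y \<in> T" if "y \<in> V'" for y using GU[OF that] UV(2) by blast
  have CG: "Cn_on m V' G" if "enat (Suc m) \<le> k" for m
  proof (rule Cn_on_inverse_function[OF T UV(4) CF[OF that] GT _ G'(1)])
    show "continuous_on V' G" using UV(6) by (simp add: homeomorphism_def)
    show "inj (FD F (G y))" if "y \<in> V'" for y
      using G'(3)[OF that] F'[OF GT[OF that]] by (simp add: bij_def)
    show "FD F (G y) (G' y w) = w" if "y \<in> V'" for y w
      using G'(2,3)[OF that] F'[OF GT[OF that]] by (simp add: bij_def surj_f_inv_f)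
  qed
  define c where "c = norm (grad \<rho> p)"
  have c: "c > 0" using g0[OF p] by (simp add: c_def)
  have "continuous_on W (grad \<rho>)" using Cn_on_continuous[OF Cn_on_grad[OF W(1) C2]] .
  then have "isCont (grad \<rho>) p" using W(1) pW by (simp add: continuous_on_eq_continuous_at)
  then have "((\<lambda>y. norm (grad \<rho> y)) \<longlongrightarrow> c) (at p)"
    unfolding c_def isCont_def by (intro tendsto_norm)
  from order_tendstoD(1)[OF this, of "c / 2"] obtain d1 where d1: "d1 > 0" "\<And>y. y \<noteq> p \<Longrightarrow> dist y p < d1 \<Longrightarrow> norm (grad \<rho> y) > c / 2"
    using c by (auto simp: eventually_at)
  obtain e where e: "e > 0" "ball ?p e \<subseteq> U'" using UV(1,3) openE by blast
  \<comment> \<open>For z in the ball of radius d a nearest point \<open>y\<close> satisfies |y - p|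
    < 2 d, so its gradient is longer than c / 2, and the parameter satisfies |s| \<le> 2 d / c.
    Hence (y, s) is within d (2 + 2 / c) of (p, 0), which has to stay below e.\<close>
  define d where "d = min (d1 / 2) (e / (2 * (2 + 2 / c)))"
  have c2: "2 + 2 / c > 0" using c by (simp add: add_pos_pos)
  have d: "d > 0" "2 * d \<le> d1" using d1 e c2 by (auto simp: d_def)
  have "d * (2 + 2 / c) \<le> e / (2 * (2 + 2 / c)) * (2 + 2 / c)"
    using c2 by (intro mult_right_mono) (auto simp: d_def)
  also have "e / (2 * (2 + 2 / c)) * (2 + 2 / c) = e / 2"
  proof -
    have "e / (2 * X) * X = e / 2" if "X > 0" for X using that by simp
    then show ?thesis using c2 .
  qed
  also have "\<dots> < e" using e by simp
  finally have de: "d * (2 + 2 / c) < e" .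
  \<comment> \<open>Identifies the local inverse with the nearest point: the pair coming from a
    nearest point is a preimage of (z, 0) in \<open>U'\<close>, where \<open>G\<close> inverts
    \<open>F\<close>.\<close>
  have main: "\<exists>y s. (y, s) \<in> U' \<and> y \<in> frontier \<Omega> \<and> z = y + s *\<^sub>R grad \<rho> y \<and> sdist \<Omega> z = s * norm (grad \<rho> y) \<and> 
    (z \<in> frontier \<Omega> \<longrightarrow> y = z) \<and> (z, 0) \<in> V' \<and> G (z, 0) = (y, s)" if z: "z \<in> ball p d" for z
  proof -
    obtain y where y: "y \<in> frontier \<Omega>" "infdist z (frontier \<Omega>) = dist z y"
      using infdist_attains_inf[of "frontier \<Omega>" z] p by auto
    obtain s where s: "z = y + s *\<^sub>R grad \<rho> y" "sdist \<Omega> z = s * norm (grad \<rho> y)"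
      using nearest_point_normal[OF op df k1 y g0[OF y(1)]] by blast
    have "dist z y \<le> dist z p" using infdist_le[OF p, of z] y(2) by simp
    then have zy: "dist z y < d" using z by (simp add: dist_commute)
    then have yp: "dist y p < 2 * d" using z dist_triangle[of y p z] by (simp add: dist_commute)
    have gy: "norm (grad \<rho> y) > c / 2"
      using d1(2)[of y] yp d c by (cases "y = p") (auto simp: c_def)
    have "dist z y = \<bar>s\<bar> * norm (grad \<rho> y)"
      using s(1) by (metis add_diff_cancel_left' dist_norm norm_scaleR)
    then have "\<bar>s\<bar> * (c / 2) \<le> d"
      using gy zy by (smt (verit) mult_left_mono)
    then have sd: "\<bar>s\<bar> \<le> 2 * d / c" using c by (simp add: field_simps)
    have "dist ?p (y, s) \<le> dist p y + dist 0 s"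
      unfolding dist_prod_def by (rule order_trans[OF sqrt_sum_squares_le_sum]) auto
    also have "\<dots> < d * (2 + 2 / c)" using yp sd by (simp add: dist_commute algebra_simps)
    finally have "(y, s) \<in> ball ?p e" using de by simp
    then have U: "(y, s) \<in> U'" using e by blast
    have "F (y, s) = (z, 0)" using s(1) zero[OF y(1)] by (simp add: F_def)
    moreover have "F (y, s) \<in> V'" "G (F (y, s)) = (y, s)"
      using UV(6) U unfolding homeomorphism_def by blast+
    ultimately have "(z, 0) \<in> V'" "G (z, 0) = (y, s)" by simp_all
    moreover have "z \<in> frontier \<Omega> \<Longrightarrow> y = z" using y(2) by simp
    ultimately show ?thesis using U y s by blast
  qed
  show ?thesis
  proof
    show "open (ball p d)" "p \<in> ball p d" using d by auto
    have CG0: "Cn_on m (ball p d) (\<lambda>z. G (z, 0))" if "enat (Suc m) \<le> k" for m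
      by (rule Cn_on_compose[OF open_ball UV(4) _ Cn_on_Pair[OF open_ball Cn_on_id[OF open_ball] Cn_on_const] CG[OF that]])
        (use main in blast)
    show "Cn_on m (ball p d) (\<lambda>z. fst (G (z, 0)))" "Cn_on m (ball p d) (\<lambda>z. snd (G (z, 0)))" if "enat (Suc m) \<le> k" for m
      by (intro Cn_on_bounded_linear[OF bounded_linear_fst] Cn_on_bounded_linear[OF bounded_linear_snd] open_ball CG0[OF that])+
    fix z assume "z \<in> ball p d"
    from main[OF this] obtain y s where ys: "y \<in> frontier \<Omega>" "z = y + s *\<^sub>R grad \<rho> y" "sdist \<Omega> z = s * norm (grad \<rho> y)"
      "z \<in> frontier \<Omega> \<longrightarrow> y = z" and G: "G (z, 0) = (y, s)" by blast
    show "fst (G (z, 0)) \<in> frontier \<Omega>" unfolding G fst_conv by (rule ys)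
    show "z = fst (G (z, 0)) + snd (G (z, 0)) *\<^sub>R grad \<rho> (fst (G (z, 0)))" unfolding G fst_conv snd_conv by (rule ys)
    show "sdist \<Omega> z = snd (G (z, 0)) * norm (grad \<rho> (fst (G (z, 0))))" unfolding G fst_conv snd_conv by (rule ys)
    show "fst (G (z, 0)) = z" if "z \<in> frontier \<Omega>" unfolding G fst_conv using ys(4) that by (rule mp)
  qed
qed

text \<open>As a product of \<open>t\<close> with the length of the gradient at \<open>x\<close>,
  the distance is of class k - 1 only. Its gradient, however, turns out to be the unit normal at the
  foot point, which is also of class k - 1, and so the lost derivative is regained.\<close>

lemma sdist_local:
  fixes \<Omega> :: "'a::euclidean_space set"
  assumes op: "open \<Omega>" and df: "defining_function k \<Omega> W \<rho>" and k: "2 \<le> k" and p: "p \<in> frontier \<Omega>"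
  obtains V x where "open V" "p \<in> V" "Ck_on k V (sdist \<Omega>)"
    "\<And>z. z \<in> V \<Longrightarrow> x z \<in> frontier \<Omega>" 
    "\<And>z. z \<in> V \<Longrightarrow> (sdist \<Omega> has_derivative (\<lambda>v. (grad \<rho> (x z) /\<^sub>R norm (grad \<rho> (x z))) \<bullet> v)) (at z)"
    "\<And>z. z \<in> V \<Longrightarrow> z - sdist \<Omega> z *\<^sub>R (grad \<rho> (x z) /\<^sub>R norm (grad \<rho> (x z))) = x z"
    "\<And>z. z \<in> V \<Longrightarrow> norm (grad \<rho> (x z) /\<^sub>R norm (grad \<rho> (x z))) = 1"
    "\<And>z. z \<in> V \<Longrightarrow> z \<in> frontier \<Omega> \<Longrightarrow> x z = z"
proof -
  obtain V x t where V: "open V" "p \<in> V" 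
    and Cx: "\<And>m. enat (Suc m) \<le> k \<Longrightarrow> Cn_on m V x" and Ct: "\<And>m. enat (Suc m) \<le> k \<Longrightarrow> Cn_on m V t"
    and xf: "\<And>z. z \<in> V \<Longrightarrow> x z \<in> frontier \<Omega>" and zxt: "\<And>z. z \<in> V \<Longrightarrow> z = x z + t z *\<^sub>R grad \<rho> (x z)"
    and sd: "\<And>z. z \<in> V \<Longrightarrow> sdist \<Omega> z = t z * norm (grad \<rho> (x z))"
    and xz: "\<And>z. z \<in> V \<Longrightarrow> z \<in> frontier \<Omega> \<Longrightarrow> x z = z"
    using local_projection[OF op df k p] by blast
  have W: "open W" "frontier \<Omega> \<subseteq> W" using df by (auto simp: defining_function_def nbhd_of_boundary_def)
  have zero: "z \<in> frontier \<Omega> \<Longrightarrow> \<rho> z = 0" for z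
    using df by (auto simp: defining_function_def)
  have C\<rho>: "Cn_on m W \<rho>" if "enat m \<le> k" for m
    using df that by (auto simp: defining_function_def Ck_on_def)
  have k1: "1 \<le> k" using k by (metis one_le_numeral order_trans)
  have k2: "enat (Suc 1) \<le> k" using k by (metis Suc_1 numeral_eq_enat)
  have C1: "Cn_on 1 W \<rho>" and C2: "Cn_on (Suc 1) W \<rho>"
    using C\<rho>[of 1] C\<rho>[OF k2] k1 by (simp_all only: one_enat_def)
  have der\<rho>: "(\<rho> has_derivative (\<lambda>v. grad \<rho> y \<bullet> v)) (at y)" if "y \<in> W" for y
    using Cn_on_has_FD[OF C1 _ that] inner_grad[of \<rho> _ y] by auto
  have g0: "grad \<rho> y \<noteq> 0" if y: "y \<in> frontier \<Omega>" for y
  proof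
    assume "grad \<rho> y = 0"
    then have "FD \<rho> y = (\<lambda>v. 0)" using FD_eqI[OF der\<rho>[of y]] y W by auto
    then show False using df y by (auto simp: defining_function_def)
  qed
  let ?n = "\<lambda>z. grad \<rho> (x z) /\<^sub>R norm (grad \<rho> (x z))"
  have xW: "x z \<in> W" if "z \<in> V" for z using xf[OF that] W by blast
  have der: "(sdist \<Omega> has_derivative (\<lambda>v. ?n z \<bullet> v)) (at z)" if z: "z \<in> V" for z
  proof -
    let ?g = "grad \<rho> (x z)"
    have gn: "norm ?g > 0" using g0[OF xf[OF z]] by simp
    obtain x' t' where x': "(x has_derivative x') (at z)" and t': "(t has_derivative t') (at z)"
      using Cn_on_has_FD[OF Cx[OF k2] _ z] Cn_on_has_FD[OF Ct[OF k2] _ z] by auto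
    obtain D where "(grad \<rho> has_derivative D) (at (x z))"
      using Cn_on_has_FD[OF Cn_on_grad[OF W(1) C2] _ xW[OF z]] by auto
    then have gx: "((\<lambda>z. grad \<rho> (x z)) has_derivative (\<lambda>v. D (x' v))) (at z)"
      using has_derivative_compose[OF x'] by blast
    have "((\<lambda>z. norm (grad \<rho> (x z))) has_derivative (\<lambda>v. D (x' v) \<bullet> sgn ?g)) (at z)"
      by (rule has_derivative_compose[OF gx has_derivative_norm]) (use gn in auto)
    then have "((\<lambda>z. t z * norm (grad \<rho> (x z))) has_derivative 
        (\<lambda>v. t z * (D (x' v) \<bullet> sgn ?g) + t' v * norm ?g)) (at z)"
      by (rule has_derivative_mult[OF t'])
    then have sder: "(sdist \<Omega> has_derivative (\<lambda>v. t z * (D (x' v) \<bullet> sgn ?g) + t' v * norm ?g)) (at z)"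
      by (rule has_derivative_transform_within_open[OF _ V(1) z]) (simp add: sd)
    \<comment> \<open>Two identities are differentiated: the representation of z by its foot point,
      and \<rho> = 0 at the foot point. Pairing the first with the gradient eliminates the
      derivative of \<open>x\<close> by means of the second.\<close>
    have "((\<lambda>z. x z + t z *\<^sub>R grad \<rho> (x z)) has_derivative (\<lambda>v. x' v + (t z *\<^sub>R D (x' v) + t' v *\<^sub>R ?g))) (at z)"
      by (intro has_derivative_add has_derivative_scaleR x' t' gx)
    moreover have "((\<lambda>z. x z + t z *\<^sub>R grad \<rho> (x z)) has_derivative (\<lambda>v. v)) (at z)"
      by (rule has_derivative_transform_within_open[OF has_derivative_ident V(1) z]) (use zxt in auto)
    ultimately have "(\<lambda>v. x' v + (t z *\<^sub>R D (x' v) + t' v *\<^sub>R ?g)) = (\<lambda>v. v)"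
      by (rule has_derivative_unique)
    then have v: "x' v + (t z *\<^sub>R D (x' v) + t' v *\<^sub>R ?g) = v" for v by meson
    have "((\<lambda>z. \<rho> (x z)) has_derivative (\<lambda>v. ?g \<bullet> x' v)) (at z)"
      by (rule has_derivative_compose[OF x' der\<rho>[OF xW[OF z]]])
    moreover have "((\<lambda>z. \<rho> (x z)) has_derivative (\<lambda>v. 0)) (at z)"
      by (rule has_derivative_transform_within_open[OF has_derivative_const[of 0] V(1) z]) (use zero xf in auto)
    ultimately have "(\<lambda>v. ?g \<bullet> x' v) = (\<lambda>v. 0)" by (rule has_derivative_unique)
    then have gx': "?g \<bullet> x' v = 0" for v by meson
    have "t z * (D (x' v) \<bullet> sgn ?g) + t' v * norm ?g = ?n z \<bullet> v" for v
    proof -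
      have "?n z \<bullet> v = (?g \<bullet> (x' v + (t z *\<^sub>R D (x' v) + t' v *\<^sub>R ?g))) / norm ?g"
        unfolding v by (simp add: divide_inverse_commute)
      also have "\<dots> = (t z * (?g \<bullet> D (x' v)) + t' v * (norm ?g * norm ?g)) / norm ?g"
        by (simp add: inner_add_right gx' flip: power2_eq_square power2_norm_eq_inner)
      also have "\<dots> = t z * (D (x' v) \<bullet> sgn ?g) + t' v * norm ?g"
        using gn by (simp add: sgn_div_norm inner_commute field_simps)
      finally show ?thesis by simp
    qed
    then show ?thesis using sder by simp
  qed
  have n1: "norm (?n z) = 1" if "z \<in> V" for z using g0[OF xf[OF that]] by simp
  have "Cn_on m V (sdist \<Omega>)" if "enat m \<le> k" for m
  proof -
    have n: "Cn_on l V ?n" if "enat (Suc l) \<le> k" for l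
    proof (rule Cn_on_normalize[OF V(1)])
      show "Cn_on l V (\<lambda>z. grad \<rho> (x z))"
        by (rule Cn_on_compose[OF V(1) W(1) xW Cx[OF that] Cn_on_grad[OF W(1) C\<rho>[OF that]]])
    qed (use g0 xf in auto)
    have S: "Cn_on (Suc l) V (sdist \<Omega>)" if "enat (Suc l) \<le> k" for l
    proof (rule Cn_on_SucI[OF V(1)])
      show "Cn_on l V (\<lambda>z. ?n z \<bullet> v)" for v
        by (intro Cn_on_inner V(1) n[OF that] Cn_on_const)
    qed (rule der)
    show ?thesis
    proof (cases m)
      case 0
      then show ?thesis using Cn_on_mono[OF S[OF k2], of 0] by simp
    qed (use S that in simp)
  qed
  then have Ck: "Ck_on k V (sdist \<Omega>)" by (simp add: Ck_on_def)
  have pr: "z - sdist \<Omega> z *\<^sub>R ?n z = x z" if z: "z \<in> V" for z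
  proof -
    have "norm (grad \<rho> (x z)) > 0" using g0[OF xf[OF z]] by simp
    then have "sdist \<Omega> z *\<^sub>R ?n z = t z *\<^sub>R grad \<rho> (x z)" by (simp add: sd[OF z])
    then show ?thesis using zxt[OF z] by (metis add_diff_cancel_right')
  qed
  show ?thesis using that[OF V Ck xf der pr n1 xz] .
qed

text \<open>The local foot point maps need no comparison on overlaps, because the gradient of the
  distance determines the foot point. The normal is constant along normals because a boundary point
  is its own foot point, so both gradients are the unit normal of \<rho> at the same point.\<close>

proposition sdist_regular:
  fixes \<Omega> :: "'a::euclidean_space set"
  assumes op: "open \<Omega>" and bd: "has_Ck_boundary k \<Omega>" and k: "2 \<le> k"
  obtains U where "open U" "frontier \<Omega> \<subseteq> U" "Ck_on k U (sdist \<Omega>)"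
    "\<And>m. enat (Suc m) \<le> k \<Longrightarrow> Cn_on m U (grad (sdist \<Omega>))"
    "\<And>z. z \<in> U \<Longrightarrow> (sdist \<Omega> has_derivative (\<lambda>v. grad (sdist \<Omega>) z \<bullet> v)) (at z)"
    "\<And>z. z \<in> U \<Longrightarrow> norm (grad (sdist \<Omega>) z) = 1"
    "\<And>z. z \<in> U \<Longrightarrow> z - sdist \<Omega> z *\<^sub>R grad (sdist \<Omega>) z \<in> frontier \<Omega>"
    "\<And>z. z \<in> U \<Longrightarrow> grad (sdist \<Omega>) (z - sdist \<Omega> z *\<^sub>R grad (sdist \<Omega>) z) = grad (sdist \<Omega>) z"
proof -
  obtain W \<rho> where df: "defining_function k \<Omega> W \<rho>" using bd by (auto simp: has_Ck_boundary_def)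
  let ?n = "\<lambda>x. grad \<rho> x /\<^sub>R norm (grad \<rho> x)"
  define good where "good V x \<longleftrightarrow> open V \<and> Ck_on k V (sdist \<Omega>) \<and>
    (\<forall>z\<in>V. x z \<in> frontier \<Omega> \<and> (sdist \<Omega> has_derivative (\<lambda>v. ?n (x z) \<bullet> v)) (at z) \<and>
      z - sdist \<Omega> z *\<^sub>R ?n (x z) = x z \<and> norm (?n (x z)) = 1 \<and> (z \<in> frontier \<Omega> \<longrightarrow> x z = z))" for V x
  have ex: "\<exists>V x. p \<in> V \<and> good V x" if p: "p \<in> frontier \<Omega>" for p
  proof (rule sdist_local[OF op df k p])
    fix V x
    assume V: "open V" "p \<in> V" "Ck_on k V (sdist \<Omega>)"
      and x: "\<And>z. z \<in> V \<Longrightarrow> x z \<in> frontier \<Omega>"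
        "\<And>z. z \<in> V \<Longrightarrow> (sdist \<Omega> has_derivative (\<lambda>v. ?n (x z) \<bullet> v)) (at z)"
        "\<And>z. z \<in> V \<Longrightarrow> z - sdist \<Omega> z *\<^sub>R ?n (x z) = x z"
        "\<And>z. z \<in> V \<Longrightarrow> norm (?n (x z)) = 1"
        "\<And>z. z \<in> V \<Longrightarrow> z \<in> frontier \<Omega> \<Longrightarrow> x z = z"
    have "good V x"
      unfolding good_def by (intro conjI ballI impI V x)
    then show "\<exists>V x. p \<in> V \<and> good V x" using V(2) by blast
  qed
  define U where "U = \<Union> {V. \<exists>x. good V x}"
  have loc: "\<exists>V x. z \<in> V \<and> V \<subseteq> U \<and> good V x" if "z \<in> U" for z
    using that unfolding U_def by blast
  have fU: "frontier \<Omega> \<subseteq> U" using ex unfolding U_def by blast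
  have oU: "open U" unfolding U_def good_def by blast
  have Cm: "Cn_on m U (sdist \<Omega>)" if "enat m \<le> k" for m
  proof (rule Cn_on_localI)
    fix z assume "z \<in> U"
    then obtain V x where "z \<in> V" "good V x" using loc by blast
    then show "\<exists>T. open T \<and> z \<in> T \<and> Cn_on m T (sdist \<Omega>)"
      using that by (intro exI[of _ V]) (auto simp: good_def Ck_on_def)
  qed
  have pt: "\<exists>x. x \<in> frontier \<Omega> \<and> (sdist \<Omega> has_derivative (\<lambda>v. grad (sdist \<Omega>) z \<bullet> v)) (at z) \<and> grad (sdist \<Omega>) z = ?n x \<and>
      z - sdist \<Omega> z *\<^sub>R grad (sdist \<Omega>) z = x \<and> norm (grad (sdist \<Omega>) z) = 1 \<and> (z \<in> frontier \<Omega> \<longrightarrow> x = z)" if "z \<in> U" for z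
  proof -
    obtain V x where V: "z \<in> V" "good V x" using loc \<open>z \<in> U\<close> by blast
    then have d: "(sdist \<Omega> has_derivative (\<lambda>v. ?n (x z) \<bullet> v)) (at z)" by (simp add: good_def)
    have "grad (sdist \<Omega>) z = ?n (x z)" by (rule grad_eqI[OF d])
    then show ?thesis
      using V d by (intro exI[of _ "x z"]) (auto simp: good_def)
  qed
  show ?thesis
  proof
    show "open U" "frontier \<Omega> \<subseteq> U" by fact+
    show "Ck_on k U (sdist \<Omega>)" using Cm by (simp add: Ck_on_def)
    show "Cn_on m U (grad (sdist \<Omega>))" if "enat (Suc m) \<le> k" for m
      by (rule Cn_on_grad[OF oU Cm[OF that]])
    fix z assume z: "z \<in> U"
    from pt[OF z] obtain x where x: "x \<in> frontier \<Omega>" "(sdist \<Omega> has_derivative (\<lambda>v. grad (sdist \<Omega>) z \<bullet> v)) (at z)" 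
      "grad (sdist \<Omega>) z = ?n x" "z - sdist \<Omega> z *\<^sub>R grad (sdist \<Omega>) z = x" "norm (grad (sdist \<Omega>) z) = 1" by blast
    show "(sdist \<Omega> has_derivative (\<lambda>v. grad (sdist \<Omega>) z \<bullet> v)) (at z)" by (rule x(2))
    show "norm (grad (sdist \<Omega>) z) = 1" by (rule x(5))
    show "z - sdist \<Omega> z *\<^sub>R grad (sdist \<Omega>) z \<in> frontier \<Omega>" unfolding x(4) by (rule x(1))
    have "x \<in> U" using x(1) fU by blast
    from pt[OF this] obtain y where "grad (sdist \<Omega>) x = ?n y" "x \<in> frontier \<Omega> \<longrightarrow> y = x" by blast
    then have "grad (sdist \<Omega>) x = ?n x" using x(1) by simp
    then show "grad (sdist \<Omega>) (z - sdist \<Omega> z *\<^sub>R grad (sdist \<Omega>) z) = grad (sdist \<Omega>) z"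
      unfolding x(4) by (rule trans[OF _ x(3)[symmetric]])
  qed
qed

section \<open>Levi forms in real terms\<close>

definition J :: "complex^'n \<Rightarrow> complex^'n" where "J v = \<i> *s v"

lemma inner_vec_complex: "x \<bullet> y = (\<Sum>j\<in>UNIV. Re (x $ j) * Re (y $ j) + Im (x $ j) * Im (y $ j))"
  for x y :: "complex^'n"
  by (simp add: inner_vec_def inner_complex_def)

lemma linear_J: "linear J"
  by (rule linearI) (simp_all add: J_def vec_eq_iff algebra_simps)

lemma J_add [simp]: "J (x + y) = J x + J y" and J_scaleR [simp]: "J (c *\<^sub>R x) = c *\<^sub>R J x"
  and J_minus [simp]: "J (- x) = - J x" and J_diff [simp]: "J (x - y) = J x - J y" and J_zero [simp]: "J 0 = 0"
  using linear_add[OF linear_J] linear_scale[OF linear_J] linear_neg[OF linear_J] linear_diff[OF linear_J]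
    linear_0[OF linear_J] by auto

lemma J_J [simp]: "J (J x) = - x"
  by (simp add: J_def vec_eq_iff flip: mult.assoc)

lemma inner_J_J [simp]: "J x \<bullet> J y = x \<bullet> y"
  by (simp add: inner_vec_complex J_def algebra_simps)

lemma inner_J_left: "J x \<bullet> y = - (x \<bullet> J y)"
  by (simp add: inner_vec_complex J_def flip: sum_negf)

lemma inner_J_self [simp]: "J x \<bullet> x = 0" "x \<bullet> J x = 0"
  by (simp_all add: inner_vec_complex J_def)

lemma norm_J [simp]: "norm (J x) = norm x"
  by (simp add: norm_eq_sqrt_inner)

lemma tendsto_J [tendsto_intros]: "(f \<longlongrightarrow> l) F \<Longrightarrow> ((\<lambda>x. J (f x)) \<longlongrightarrow> J l) F"
  by (rule bounded_linear.tendsto[OF linear_J[unfolded linear_conv_bounded_linear]])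

text \<open>Four times the Levi form of \<open>f\<close> and four times \<open>|\<partial>f(v)|\<^sup>2\<close>.\<close>

definition levi_re :: "(complex^'n \<Rightarrow> real) \<Rightarrow> complex^'n \<Rightarrow> complex^'n \<Rightarrow> real" where
  "levi_re f x v = D2 f x v v + D2 f x (J v) (J v)"

definition grad_sq :: "(complex^'n \<Rightarrow> real) \<Rightarrow> complex^'n \<Rightarrow> complex^'n \<Rightarrow> real" where
  "grad_sq f x v = (FD f x v)\<^sup>2 + (FD f x (J v))\<^sup>2"

lemma cis_smult: "cis \<theta> *s w = cos \<theta> *\<^sub>R w + sin \<theta> *\<^sub>R J w"
  by (simp add: vec_eq_iff J_def complex_eq_iff)

lemma norm_smult_vec: "norm (c *s w) = cmod c * norm w" for w :: "complex^'n"
proof -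
  have "norm (c *s w) = L2_set (\<lambda>i. cmod c * norm (w $ i)) UNIV"
    by (simp add: norm_vec_def norm_mult)
  also have "\<dots> = cmod c * norm w"
    by (simp add: L2_set_right_distrib norm_vec_def)
  finally show ?thesis .
qed

section \<open>From the sub-mean value inequality to the Levi form\<close>

lemma taylor2_upper:
  fixes u :: "'a::euclidean_space \<Rightarrow> real"
  assumes S: "open S" and u: "Cn_on 2 S u" and sub: "ball a d \<subseteq> S" and t: "0 < t" "t * norm w < d"
    and close: "\<And>y v. y \<in> ball a d \<Longrightarrow> \<bar>D2 u y v v - D2 u a v v\<bar> \<le> e * (norm v)\<^sup>2"
  shows "u (a + t *\<^sub>R w) \<le> u a + t * FD u a w + t\<^sup>2 / 2 * (D2 u a w w + e * (norm w)\<^sup>2)"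
proof -
  have in_ball: "a + s *\<^sub>R w \<in> ball a d" if "0 \<le> s" "s \<le> t" for s
  proof -
    have "norm (s *\<^sub>R w) \<le> t * norm w" using that by (simp add: mult_right_mono)
    then show ?thesis
      unfolding mem_ball dist_norm using t by simp
  qed
  define diff where "diff m s = (if m = 0 then u (a + s *\<^sub>R w) else if m = 1 then FD u (a + s *\<^sub>R w) w else D2 u (a + s *\<^sub>R w) w w)" for m :: nat and s
  have "(diff m has_real_derivative diff (Suc m) s) (at s)" if "m < 2" "0 \<le> s" "s \<le> t" for m s
  proof -
    have inS: "a + s *\<^sub>R w \<in> S" using in_ball[OF that(2,3)] sub by blast
    have "m = 0 \<or> m = 1" using that by auto
    then show ?thesis
    proof
      assume "m = 0"
      then show ?thesis
        using line_has_real_derivative[OF Cn_on_has_FD[OF u _ inS]] by (simp add: diff_def[abs_def])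
    next
      assume "m = 1"
      then show ?thesis
        using line_has_real_derivative[OF C2_has_D2[OF u inS]] by (simp add: diff_def[abs_def])
    qed
  qed
  then obtain s where s: "0 < s" "s < t" "diff 0 t = (\<Sum>m<2. diff m 0 / fact m * t ^ m) + diff 2 s / fact 2 * t\<^sup>2"
    using Maclaurin[of t 2 diff "diff 0"] t by auto
  have "D2 u (a + s *\<^sub>R w) w w \<le> D2 u a w w + e * (norm w)\<^sup>2"
    using close[OF in_ball, of s w] s by auto
  then have "t\<^sup>2 / 2 * D2 u (a + s *\<^sub>R w) w w \<le> t\<^sup>2 / 2 * (D2 u a w w + e * (norm w)\<^sup>2)"
    by (intro mult_left_mono) auto
  moreover have "u (a + t *\<^sub>R w) = u a + t * FD u a w + t\<^sup>2 / 2 * D2 u (a + s *\<^sub>R w) w w"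
    using s(3) by (simp add: diff_def numeral_2_eq_2 algebra_simps)
  ultimately show ?thesis by simp
qed

text \<open>The second order Taylor polynomial along a circle: linear and mixed terms average to
  zero, each square averages to one half.\<close>

lemma circle_integral:
  fixes c A B D E F G :: real
  shows "((\<lambda>\<theta>. c + (cos \<theta> * A + sin \<theta> * B) + ((cos \<theta>)\<^sup>2 * D + cos \<theta> * sin \<theta> * E + (sin \<theta>)\<^sup>2 * F + G)) 
    has_integral (2 * pi * c + pi * (D + F) + 2 * pi * G)) {0..2*pi}"
proof -
  let ?a = "\<lambda>\<theta>. c * \<theta> + (sin \<theta> * A - cos \<theta> * B) + ((\<theta> + cos \<theta> * sin \<theta>) / 2 * D + (sin \<theta>)\<^sup>2 / 2 * E + (\<theta> - cos \<theta> * sin \<theta>) / 2 * F + G * \<theta>)"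
  have "(?a has_real_derivative (c + (cos \<theta> * A + sin \<theta> * B) + ((cos \<theta>)\<^sup>2 * D + cos \<theta> * sin \<theta> * E + (sin \<theta>)\<^sup>2 * F + G))) (at \<theta> within {0..2*pi})" for \<theta>
  proof -
    have 1: "1 + (cos \<theta> * cos \<theta> - sin \<theta> * sin \<theta>) = 2 * (cos \<theta>)\<^sup>2" "1 - (cos \<theta> * cos \<theta> - sin \<theta> * sin \<theta>) = 2 * (sin \<theta>)\<^sup>2"
      using sin_cos_squared_add[of \<theta>] by (auto simp: power2_eq_square)
    have "(?a has_real_derivative (c + (cos \<theta> * A + sin \<theta> * B) + ((1 + (cos \<theta> * cos \<theta> - sin \<theta> * sin \<theta>)) / 2 * D + cos \<theta> * sin \<theta> * E + (1 - (cos \<theta> * cos \<theta> - sin \<theta> * sin \<theta>)) / 2 * F + G))) (at \<theta> within {0..2*pi})"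
      by (auto intro!: derivative_eq_intros simp: field_simps)
    then show ?thesis unfolding 1 by simp
  qed
  then have "((\<lambda>\<theta>. c + (cos \<theta> * A + sin \<theta> * B) + ((cos \<theta>)\<^sup>2 * D + cos \<theta> * sin \<theta> * E + (sin \<theta>)\<^sup>2 * F + G)) 
    has_integral (?a (2*pi) - ?a 0)) {0..2*pi}"
    by (intro fundamental_theorem_of_calculus) (auto simp: has_real_derivative_iff_has_vector_derivative)
  then show ?thesis by (simp add: algebra_simps)
qed

text \<open>A Taylor bound is averaged over a circle of radius t; what remains above the value at
  the centre is (t^2 / 4) times \<open>levi_re\<close>, plus an error governed by the modulus of
  continuity of the Hessian.\<close>

lemma psh_imp_levi_re_nonneg:
  assumes S: "open S" and u: "Cn_on 2 S u" and psh: "psh_on S u" and a: "a \<in> S"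
  shows "0 \<le> levi_re u a w"
proof (rule field_le_epsilon)
  fix e :: real assume e: "0 < e"
  define e' where "e' = e / (2 * (1 + (norm w)\<^sup>2))"
  have pos: "0 < 1 + (norm w)\<^sup>2" by (rule add_pos_nonneg) auto
  have e': "e' > 0" using e pos by (simp add: e'_def)
  obtain d where d: "d > 0" "ball a d \<subseteq> S" and
    close: "\<And>y v. y \<in> ball a d \<Longrightarrow> \<bar>D2 u y v v - D2 u a v v\<bar> \<le> e' * (norm v)\<^sup>2"
    using D2_close[OF S u a e'] by blast
  define t where "t = d / (2 * (1 + norm w))"
  have n1: "0 < 1 + norm w" by (rule add_pos_nonneg) auto
  have t: "t > 0" using d n1 by (simp add: t_def)
  have "t * norm w \<le> d * (norm w / (1 + norm w)) / 2" by (simp add: t_def mult.commute)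
  also have "\<dots> \<le> d * 1 / 2" using d n1 by (intro divide_right_mono mult_left_mono) (auto simp: field_simps)
  also have "\<dots> < d" using d by simp
  finally have t: "t > 0" "t * norm w < d" using t by auto
  have "a + \<zeta> *s (t *\<^sub>R w) \<in> S" if "cmod \<zeta> \<le> 1" for \<zeta>
  proof -
    have "norm (\<zeta> *s (t *\<^sub>R w)) \<le> 1 * (t * norm w)"
      unfolding norm_smult_vec using that t by (intro mult_mono) auto
    then have "a + \<zeta> *s (t *\<^sub>R w) \<in> ball a d" using t by (simp add: dist_norm)
    then show ?thesis using d by blast
  qed
  then have int: "(\<lambda>\<theta>. u (a + cis \<theta> *s (t *\<^sub>R w))) absolutely_integrable_on {0..2*pi}"
    and sub: "u a \<le> integral {0..2*pi} (\<lambda>\<theta>. u (a + cis \<theta> *s (t *\<^sub>R w))) / (2*pi)"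
    using psh unfolding psh_on_def by blast+
  define W where "W \<theta> = cos \<theta> *\<^sub>R w + sin \<theta> *\<^sub>R J w" for \<theta> :: real
  have nW: "norm (W \<theta>) = norm w" for \<theta>
    using norm_smult_vec[of "cis \<theta>" w] by (simp add: W_def cis_smult)
  have tW: "a + cis \<theta> *s (t *\<^sub>R w) = a + t *\<^sub>R W \<theta>" for \<theta>
    by (simp add: cis_smult W_def scaleR_add_right mult.commute)
  note lin = linear_add[OF FD_linear[OF u _ a]] linear_scale[OF FD_linear[OF u _ a]]
    linear_add[OF D2_linear_right[OF u a]] linear_scale[OF D2_linear_right[OF u a]]
    linear_add[OF D2_linear_left[OF S u a]] linear_scale[OF D2_linear_left[OF S u a]]
  have le: "u (a + cis \<theta> *s (t *\<^sub>R w)) \<le> u a + (cos \<theta> * (t * FD u a w) + sin \<theta> * (t * FD u a (J w)))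
      + ((cos \<theta>)\<^sup>2 * (t\<^sup>2 / 2 * D2 u a w w) + cos \<theta> * sin \<theta> * (t\<^sup>2 / 2 * (D2 u a w (J w) + D2 u a (J w) w))
        + (sin \<theta>)\<^sup>2 * (t\<^sup>2 / 2 * D2 u a (J w) (J w)) + t\<^sup>2 / 2 * (e' * (norm w)\<^sup>2))" for \<theta>
    using taylor2_upper[OF S u d(2) t(1) _ close, of "W \<theta>"] t(2)
    unfolding nW tW by (simp add: W_def lin power2_eq_square algebra_simps)
  have "integral {0..2*pi} (\<lambda>\<theta>. u (a + cis \<theta> *s (t *\<^sub>R w))) \<le> 
      2 * pi * u a + pi * (t\<^sup>2 / 2 * D2 u a w w + t\<^sup>2 / 2 * D2 u a (J w) (J w)) + 2 * pi * (t\<^sup>2 / 2 * (e' * (norm w)\<^sup>2))"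
    by (rule has_integral_le[OF integrable_integral circle_integral le])
      (use int in \<open>simp add: absolutely_integrable_on_def\<close>)
  moreover have "2 * pi * u a \<le> integral {0..2*pi} (\<lambda>\<theta>. u (a + cis \<theta> *s (t *\<^sub>R w)))"
    using sub by (simp add: field_simps)
  ultimately have "0 \<le> pi * (t\<^sup>2 / 2) * (levi_re u a w + 2 * (e' * (norm w)\<^sup>2))"
    by (simp add: levi_re_def algebra_simps)
  then have "0 \<le> levi_re u a w + 2 * (e' * (norm w)\<^sup>2)"
    using mult_le_cancel_left_pos[of "pi * (t\<^sup>2 / 2)" 0 "levi_re u a w + 2 * (e' * (norm w)\<^sup>2)"] t by simp
  moreover have "2 * (e' * (norm w)\<^sup>2) \<le> e"
    using e pos by (simp add: e'_def field_simps)
  ultimately show "0 \<le> levi_re u a w + e" by simp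
qed

section \<open>Complex derivatives through real ones\<close>

lemma vec_axis_expansion: "X = (\<Sum>j\<in>UNIV. Re (X $ j) *\<^sub>R axis j 1 + Im (X $ j) *\<^sub>R axis j \<i>)"
  for X :: "complex^'n"
proof -
  have "(\<Sum>j\<in>UNIV. Re (X $ j) *\<^sub>R axis j 1 + Im (X $ j) *\<^sub>R axis j \<i>) $ i = 
     (\<Sum>j\<in>UNIV. if j = i then X $ i else 0)" for i
    unfolding sum_component
    by (rule sum.cong) (auto simp: axis_def complex_eq_iff)
  then show ?thesis by (simp add: vec_eq_iff)
qed

lemma linear_axis_expansion:
  fixes L :: "complex^'n \<Rightarrow> 'b::real_vector"
  assumes "linear L"
  shows "L X = (\<Sum>j\<in>UNIV. Re (X $ j) *\<^sub>R L (axis j 1) + Im (X $ j) *\<^sub>R L (axis j \<i>))"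
proof -
  have "L X = L (\<Sum>j\<in>UNIV. Re (X $ j) *\<^sub>R axis j 1 + Im (X $ j) *\<^sub>R axis j \<i>)"
    using vec_axis_expansion[of X] by simp
  also have "\<dots> = (\<Sum>j\<in>UNIV. Re (X $ j) *\<^sub>R L (axis j 1) + Im (X $ j) *\<^sub>R L (axis j \<i>))"
    by (simp add: linear_sum[OF assms] linear_add[OF assms] linear_scale[OF assms])
  finally show ?thesis .
qed

text \<open>The coordinate sum collapses to the complex linear part of the real derivative, so later
  computations are free of coordinates.\<close>

lemma del_eq:
  assumes "(g has_derivative g') (at p)"
  shows "del g p V = (g' (fst V) - \<i> * g' (J (fst V))) / 2"
proof -
  have L: "linear g'" using assms by (rule has_derivative_linear)
  have "g' (fst V) - \<i> * g' (J (fst V)) = (\<Sum>j\<in>UNIV. (g' (axis j 1) - \<i> * g' (axis j \<i>)) * fst V $ j)"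
    unfolding linear_axis_expansion[OF L, of "fst V"] linear_axis_expansion[OF L, of "J (fst V)"]
      sum_distrib_left sum_subtractf[symmetric]
  proof (rule sum.cong)
    fix j :: 'a
    show "Re (fst V $ j) *\<^sub>R g' (axis j 1) + Im (fst V $ j) *\<^sub>R g' (axis j \<i>) - 
       \<i> * (Re (J (fst V) $ j) *\<^sub>R g' (axis j 1) + Im (J (fst V) $ j) *\<^sub>R g' (axis j \<i>)) =
       (g' (axis j 1) - \<i> * g' (axis j \<i>)) * fst V $ j"
      by (simp add: J_def complex_eq_iff algebra_simps)
  qed simp
  then show ?thesis
    by (simp add: del_def d_dz_def FD_eqI[OF assms] sum_divide_distrib)
qed

lemma delbar_eq:
  assumes "(g has_derivative g') (at p)"
  shows "delbar g p V = (g' (cnj_vec (snd V)) + \<i> * g' (J (cnj_vec (snd V)))) / 2"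
proof -
  have L: "linear g'" using assms by (rule has_derivative_linear)
  let ?X = "cnj_vec (snd V)"
  have "g' ?X + \<i> * g' (J ?X) = (\<Sum>j\<in>UNIV. (g' (axis j 1) + \<i> * g' (axis j \<i>)) * snd V $ j)"
    unfolding linear_axis_expansion[OF L, of ?X] linear_axis_expansion[OF L, of "J ?X"]
      sum_distrib_left sum.distrib[symmetric]
  proof (rule sum.cong)
    fix j :: 'a
    show "Re (?X $ j) *\<^sub>R g' (axis j 1) + Im (?X $ j) *\<^sub>R g' (axis j \<i>) + 
       \<i> * (Re (J ?X $ j) *\<^sub>R g' (axis j 1) + Im (J ?X $ j) *\<^sub>R g' (axis j \<i>)) =
       (g' (axis j 1) + \<i> * g' (axis j \<i>)) * snd V $ j"
      by (simp add: J_def cnj_vec_def complex_eq_iff algebra_simps)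
  qed simp
  then show ?thesis
    by (simp add: delbar_def d_dzbar_def FD_eqI[OF assms] sum_divide_distrib)
qed

lemma cnj_vec_cnj_vec [simp]: "cnj_vec (cnj_vec X) = X"
  by (simp add: cnj_vec_def vec_eq_iff)

lemma of_real_has_derivative:
  "(f has_derivative f') F \<Longrightarrow> ((\<lambda>z. complex_of_real (f z)) has_derivative (\<lambda>v. complex_of_real (f' v))) F"
  by (rule bounded_linear.has_derivative[OF bounded_linear_of_real])

lemma has_derivative_divide_const:
  "(f has_derivative f') F \<Longrightarrow> ((\<lambda>z. f z / c :: complex) has_derivative (\<lambda>v. f' v / c)) F"
  by (rule bounded_linear.has_derivative[OF bounded_linear_divide])

lemma Re_levi:
  assumes S: "open S" and f: "Cn_on 2 S f" and p: "p \<in> S"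
  shows "Re (form11_at (i_del_delbar (\<lambda>z. complex_of_real (f z)) p) X X) = levi_re f p X / 4"
proof -
  define c where "c k v = (complex_of_real (D2 f p (axis k 1) v) + \<i> * complex_of_real (D2 f p (axis k \<i>) v)) / 2" for k v
  have dbar: "d_dzbar k (\<lambda>z. complex_of_real (f z)) z =
      (complex_of_real (FD f z (axis k 1)) + \<i> * complex_of_real (FD f z (axis k \<i>))) / 2" if "z \<in> S" for k z
    using FD_eqI[OF of_real_has_derivative[OF Cn_on_has_FD[OF f _ that]]] by (simp add: d_dzbar_def)
  have "((\<lambda>z. (complex_of_real (FD f z (axis k 1)) + \<i> * complex_of_real (FD f z (axis k \<i>))) / 2) has_derivative c k) (at p)" for k
    unfolding c_def[abs_def]
    by (intro has_derivative_divide_const has_derivative_add has_derivative_mult_right of_real_has_derivative C2_has_D2[OF f p])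
  then have der: "(d_dzbar k (\<lambda>z. complex_of_real (f z)) has_derivative c k) (at p)" for k
    by (rule has_derivative_transform_within_open[OF _ S p]) (simp add: dbar)
  have sum: "(\<Sum>k\<in>UNIV. c k v * cnj (X $ k)) = (complex_of_real (D2 f p X v) + \<i> * complex_of_real (D2 f p (J X) v)) / 2" for v
  proof -
    note L = linear_axis_expansion[OF D2_linear_left[OF S f p], of _ v]
    show ?thesis
      unfolding L[of X] L[of "J X"] of_real_sum sum_distrib_left sum.distrib[symmetric] sum_divide_distrib
      by (rule sum.cong) (auto simp: c_def J_def complex_eq_iff algebra_simps)
  qed
  have "form11_at (i_del_delbar (\<lambda>z. complex_of_real (f z)) p) X X = 
     (\<Sum>k\<in>UNIV. (c k X - \<i> * c k (J X)) / 2 * cnj (X $ k))"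
    by (simp add: form11_at_def i_del_delbar_def wedge_def del_eq[OF der] vec10_def cnj_ctvec_def cnj_vec_def flip: mult.assoc)
  also have "\<dots> = ((\<Sum>k\<in>UNIV. c k X * cnj (X $ k)) - \<i> * (\<Sum>k\<in>UNIV. c k (J X) * cnj (X $ k))) / 2"
    by (simp add: sum_distrib_left sum_subtractf[symmetric] sum_divide_distrib algebra_simps diff_divide_distrib)
  finally have eq: "form11_at (i_del_delbar (\<lambda>z. complex_of_real (f z)) p) X X = \<dots>" .
  show ?thesis
    unfolding eq sum by (simp add: levi_re_def)
qed

section \<open>The unit normal field and the forms \<alpha> and \<beta>\<close>

lemma sum_cnj_mult:
  "(\<Sum>j\<in>UNIV. cnj (x $ j) * y $ j) = complex_of_real (y \<bullet> x) + \<i> * complex_of_real (y \<bullet> J x)"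
  for x y :: "complex^'n"
  by (simp add: complex_eq_iff inner_vec_complex J_def algebra_simps sum.distrib sum_subtractf)

text \<open>\<open>N\<close> stands for the gradient of the signed distance. Requiring it to be of
  class C^2 is what a C^3 boundary provides; the last two assumptions encode that the normal is
  constant along normal segments.\<close>

locale normal_field =
  fixes \<Omega> :: "(complex^'n) set" and U :: "(complex^'n) set" and N :: "complex^'n \<Rightarrow> complex^'n"
  assumes open_\<Omega>: "open \<Omega>" and bounded_\<Omega>: "bounded \<Omega>" and frontier_ne: "frontier \<Omega> \<noteq> {}"
    and open_U: "open U" and frontier_sub: "frontier \<Omega> \<subseteq> U"
    and C2_sdist: "Cn_on 2 U (sdist \<Omega>)" and C2_N: "Cn_on 2 U N"
    and der_sdist: "\<And>z. z \<in> U \<Longrightarrow> (sdist \<Omega> has_derivative (\<lambda>v. N z \<bullet> v)) (at z)"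
    and norm_N: "\<And>z. z \<in> U \<Longrightarrow> norm (N z) = 1"
    and proj: "\<And>z. z \<in> U \<Longrightarrow> z - sdist \<Omega> z *\<^sub>R N z \<in> frontier \<Omega>"
    and N_proj: "\<And>z. z \<in> U \<Longrightarrow> N (z - sdist \<Omega> z *\<^sub>R N z) = N z"
begin

lemma compact_frontier: "compact (frontier \<Omega>)"
  using bounded_\<Omega> by (simp add: compact_frontier_bounded)

lemma FD_sdist: "z \<in> U \<Longrightarrow> FD (sdist \<Omega>) z v = N z \<bullet> v"
  using FD_eqI[OF der_sdist] by simp

lemma der_N: "z \<in> U \<Longrightarrow> (N has_derivative FD N z) (at z)"
  using Cn_on_has_FD[OF C2_N] by simp

lemma linear_FD_N: "z \<in> U \<Longrightarrow> linear (FD N z)"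
  using FD_linear[OF C2_N] by simp

lemma inner_N_self: "z \<in> U \<Longrightarrow> N z \<bullet> N z = 1"
  using norm_N by (simp add: norm_eq_1)

lemma inner_FD_N_N:
  assumes "z \<in> U"
  shows "FD N z v \<bullet> N z = 0"
proof -
  have "((\<lambda>z. N z \<bullet> N z) has_derivative (\<lambda>v. N z \<bullet> FD N z v + FD N z v \<bullet> N z)) (at z)"
    by (intro has_derivative_inner der_N assms)
  moreover have "((\<lambda>z. N z \<bullet> N z) has_derivative (\<lambda>v. 0)) (at z)"
    by (rule has_derivative_transform_within_open[OF _ open_U assms, of "\<lambda>_. 1"])
      (auto simp: inner_N_self)
  ultimately have "(\<lambda>v. N z \<bullet> FD N z v + FD N z v \<bullet> N z) = (\<lambda>v. 0)"
    by (rule has_derivative_unique)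
  then have "N z \<bullet> FD N z v + FD N z v \<bullet> N z = 0" by meson
  then show ?thesis by (simp add: inner_commute)
qed

lemma D2_sdist:
  assumes "z \<in> U"
  shows "D2 (sdist \<Omega>) z v w = FD N z w \<bullet> v"
  by (rule D2_eqI[OF open_U assms der_sdist has_derivative_inner_left[OF der_N[OF assms]]])

lemma FD_N_symmetric: "z \<in> U \<Longrightarrow> FD N z v \<bullet> w = FD N z w \<bullet> v"
  using D2_symmetric[OF open_U C2_sdist] by (simp add: D2_sdist)

text \<open>The Hessian of the distance is symmetric and its values are orthogonal to
  \<open>N\<close>; hence \<open>N\<close> is in its kernel.\<close>

lemma FD_N_N: "z \<in> U \<Longrightarrow> FD N z (N z) = 0"
  using FD_N_symmetric[of z "N z" "FD N z (N z)"] inner_FD_N_N[of z] by simp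

lemma d_dz_sdist: "z \<in> U \<Longrightarrow> d_dz j (csdist \<Omega>) z = cnj (N z $ j) / 2"
  and d_dzbar_sdist: "z \<in> U \<Longrightarrow> d_dzbar j (csdist \<Omega>) z = N z $ j / 2"
  using FD_eqI[OF of_real_has_derivative[OF der_sdist[of z]]]
  by (simp_all add: d_dz_def d_dzbar_def inner_axis inner_complex_def complex_eq_iff)

lemma der_d_dz_sdist: 
  assumes "z \<in> U"
  shows "(d_dz j (csdist \<Omega>) has_derivative (\<lambda>v. cnj (FD N z v $ j) / 2)) (at z)"
    and "(d_dzbar j (csdist \<Omega>) has_derivative (\<lambda>v. FD N z v $ j / 2)) (at z)"
proof -
  have *: "((\<lambda>z. N z $ j) has_derivative (\<lambda>v. FD N z v $ j)) (at z)"
    by (rule bounded_linear.has_derivative[OF bounded_linear_vec_nth der_N[OF assms]])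
  show "(d_dz j (csdist \<Omega>) has_derivative (\<lambda>v. cnj (FD N z v $ j) / 2)) (at z)"
    by (rule has_derivative_transform_within_open[OF has_derivative_divide_const[OF bounded_linear.has_derivative[OF bounded_linear_cnj *]] open_U assms])
      (simp add: d_dz_sdist)
  show "(d_dzbar j (csdist \<Omega>) has_derivative (\<lambda>v. FD N z v $ j / 2)) (at z)"
    by (rule has_derivative_transform_within_open[OF has_derivative_divide_const[OF *] open_U assms])
      (simp add: d_dzbar_sdist)
qed

lemma T10_iff: "(p, \<tau>) \<in> T10_boundary \<Omega> \<longleftrightarrow> p \<in> frontier \<Omega> \<and> N p \<bullet> \<tau> = 0 \<and> N p \<bullet> J \<tau> = 0"
proof -
  have "del (csdist \<Omega>) p (vec10 \<tau>) = (complex_of_real (N p \<bullet> \<tau>) - \<i> * complex_of_real (N p \<bullet> J \<tau>)) / 2" if "p \<in> frontier \<Omega>"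
    using del_eq[OF of_real_has_derivative[OF der_sdist[of p]]] that frontier_sub by (auto simp: vec10_def)
  then show ?thesis by (auto simp: T10_boundary_def complex_eq_iff)
qed

text \<open>Entries of the Hessian of the distance between the tangent vectors \<tau>, J \<tau> and
  the direction J N. Up to a factor 4, \<open>theta2\<close> and \<open>theta1\<close> are the real
  and imaginary parts of \<alpha>(\<tau>), see \<open>alpha_eq\<close>.\<close>

abbreviation theta1 where "theta1 p \<tau> \<equiv> FD N p \<tau> \<bullet> J (N p)"
abbreviation theta2 where "theta2 p \<tau> \<equiv> FD N p (J \<tau>) \<bullet> J (N p)"

lemma FD_N_zero: "p \<in> U \<Longrightarrow> FD N p 0 = 0"
  using linear_0[OF linear_FD_N] .

lemma alpha_eq:
  assumes p: "p \<in> U"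
  shows "alpha_form \<Omega> p (\<tau>, 0) = (complex_of_real (theta2 p \<tau>) + \<i> * complex_of_real (theta1 p \<tau>)) / 4"
    and "alpha_form \<Omega> p (0, cnj_vec \<tau>) = (complex_of_real (theta2 p \<tau>) - \<i> * complex_of_real (theta1 p \<tau>)) / 4"
    and "alpha_form \<Omega> p (0, 0) = 0"
proof -
  have z: "J 0 = (0::complex^'n)" by simp
  have db: "delbar (d_dz j (csdist \<Omega>)) p (X, cnj_vec \<tau>) = (cnj (FD N p \<tau> $ j) + \<i> * cnj (FD N p (J \<tau>) $ j)) / 4" for j X \<tau>
    by (simp add: delbar_eq[OF der_d_dz_sdist(1)[OF p]] algebra_simps add_divide_distrib)
  have c0: "cnj_vec 0 = (0 :: complex^'n)" by (simp add: cnj_vec_def vec_eq_iff)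
  have db0: "delbar (d_dz j (csdist \<Omega>)) p (X, 0) = 0" for j X
    by (simp add: delbar_def)
  have 1: "(\<Sum>j\<in>UNIV. cnj (N p $ j) * (FD N p \<tau> $ j - \<i> * FD N p (J \<tau>) $ j)) = 
     complex_of_real (theta2 p \<tau>) + \<i> * complex_of_real (theta1 p \<tau>)"
  proof -
    have "(\<Sum>j\<in>UNIV. cnj (N p $ j) * (FD N p \<tau> $ j - \<i> * FD N p (J \<tau>) $ j)) =
        (\<Sum>j\<in>UNIV. cnj (N p $ j) * FD N p \<tau> $ j) - \<i> * (\<Sum>j\<in>UNIV. cnj (N p $ j) * FD N p (J \<tau>) $ j)"
      by (simp add: sum_distrib_left sum_subtractf[symmetric] algebra_simps)
    then show ?thesis
      unfolding sum_cnj_mult by (simp add: inner_FD_N_N[OF p] flip: mult.assoc)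
  qed
  have 2: "alpha_form \<Omega> p (X, 0) = (\<Sum>j\<in>UNIV. cnj (N p $ j) * (FD N p X $ j - \<i> * FD N p (J X) $ j)) / 4" for X
    by (simp add: alpha_form_def Re_form_def cnj_ctvec_def c0 db0 db d_dzbar_sdist[OF p] sum_distrib_left sum_divide_distrib)
  then show "alpha_form \<Omega> p (\<tau>, 0) = (complex_of_real (theta2 p \<tau>) + \<i> * complex_of_real (theta1 p \<tau>)) / 4"
    by (simp add: 1)
  show "alpha_form \<Omega> p (0, 0) = 0" using 2[of 0] by (simp add: FD_N_zero[OF p])
  \<comment> \<open>Reality of the form: its value on the conjugate vector is the conjugate value,
    which yields the (0,1) part from the (1,0) part.\<close>
  have 3: "cnj (alpha_form \<Omega> p V) = alpha_form \<Omega> p (cnj_ctvec V)" for V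
    by (simp add: alpha_form_def Re_form_def cnj_ctvec_def add.commute)
  have "alpha_form \<Omega> p (0, cnj_vec \<tau>) = cnj (alpha_form \<Omega> p (\<tau>, 0))"
    unfolding 3 by (simp add: cnj_ctvec_def c0)
  then show "alpha_form \<Omega> p (0, cnj_vec \<tau>) = (complex_of_real (theta2 p \<tau>) - \<i> * complex_of_real (theta1 p \<tau>)) / 4"
    by (simp add: 2 1)
qed

text \<open>Up to the constant, \<beta> is the squared length of the Hessian of the distance on
  \<tau> and J \<tau> with the components along J N removed: the coordinate sums give the lengths,
  and the wedge of the two parts of \<alpha> subtracts those components.\<close>

lemma beta_eq:
  assumes p: "p \<in> U"
  shows "Re (form11_at (beta_form \<Omega> p) \<tau> \<tau>) = 
    ((norm (FD N p \<tau>))\<^sup>2 + (norm (FD N p (J \<tau>)))\<^sup>2 - (theta1 p \<tau>)\<^sup>2 - (theta2 p \<tau>)\<^sup>2) / 8"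
proof -
  have c0: "cnj_vec 0 = (0 :: complex^'n)" by (simp add: cnj_vec_def vec_eq_iff)
  let ?a = "\<lambda>j. FD N p \<tau> $ j" and ?b = "\<lambda>j. FD N p (J \<tau>) $ j"
  note d = del_eq[OF der_d_dz_sdist(1)[OF p]] del_eq[OF der_d_dz_sdist(2)[OF p]]
    delbar_eq[OF der_d_dz_sdist(1)[OF p]] delbar_eq[OF der_d_dz_sdist(2)[OF p]]
  have w1: "wedge (del (d_dz j (csdist \<Omega>)) p) (delbar (d_dzbar j (csdist \<Omega>)) p) (\<tau>, 0) (0, cnj_vec \<tau>) +
     wedge (del (d_dzbar j (csdist \<Omega>)) p) (delbar (d_dz j (csdist \<Omega>)) p) (\<tau>, 0) (0, cnj_vec \<tau>) =
     complex_of_real ((cmod (?a j))\<^sup>2 + (cmod (?b j))\<^sup>2) / 8" for j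
    by (simp add: wedge_def d FD_N_zero[OF p] c0 complex_eq_iff cmod_power2)
      (simp add: power2_eq_square field_simps)
  have "Re (form11_at (beta_form \<Omega> p) \<tau> \<tau>) = (\<Sum>j\<in>UNIV. (cmod (?a j))\<^sup>2 + (cmod (?b j))\<^sup>2) / 8
     - 2 * Re (alpha_form \<Omega> p (\<tau>, 0) * alpha_form \<Omega> p (0, cnj_vec \<tau>))"
    unfolding form11_at_def beta_form_def vec10_def cnj_ctvec_def fst_conv snd_conv c0 w1
    by (simp add: wedge_def pi10_def pi01_def alpha_eq(3)[OF p] sum_divide_distrib algebra_simps)
  also have "(\<Sum>j\<in>UNIV. (cmod (?a j))\<^sup>2 + (cmod (?b j))\<^sup>2) = (norm (FD N p \<tau>))\<^sup>2 + (norm (FD N p (J \<tau>)))\<^sup>2"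
    by (simp add: norm_vec_def L2_set_def sum_nonneg sum.distrib)
  also have "Re (alpha_form \<Omega> p (\<tau>, 0) * alpha_form \<Omega> p (0, cnj_vec \<tau>)) = ((theta1 p \<tau>)\<^sup>2 + (theta2 p \<tau>)\<^sup>2) / 16"
    unfolding alpha_eq[OF p] by (simp add: power2_eq_square algebra_simps)
  finally show ?thesis by (simp add: field_simps)
qed

text \<open>Four times the two sides of the boundary inequality, the left one without its factor s /
  (1 - s).\<close>

definition bd_lhs where "bd_lhs \<phi> p \<tau> = (FD \<phi> p \<tau> - theta2 p \<tau>)\<^sup>2 + (FD \<phi> p (J \<tau>) + theta1 p \<tau>)\<^sup>2"
definition bd_rhs where "bd_rhs \<phi> p \<tau> = levi_re \<phi> p \<tau> + (norm (FD N p \<tau>))\<^sup>2 + (norm (FD N p (J \<tau>)))\<^sup>2 - (theta1 p \<tau>)\<^sup>2 - (theta2 p \<tau>)\<^sup>2"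

lemma ineq_rhs_eq:
  assumes "open S" "Cn_on 2 S \<phi>" "p \<in> S" "p \<in> U"
  shows "ineq_rhs \<Omega> \<phi> p \<tau> = bd_rhs \<phi> p \<tau> / 4"
  unfolding ineq_rhs_def bd_rhs_def using Re_levi[OF assms(1-3), of \<tau>] beta_eq[OF assms(4), of \<tau>]
  by (simp add: field_simps)

lemma ineq_lhs_eq:
  assumes "open S" "Cn_on 2 S \<phi>" "p \<in> S" "p \<in> U"
  shows "ineq_lhs \<Omega> s \<phi> p \<tau> = s / (1 - s) * bd_lhs \<phi> p \<tau> / 4"
proof -
  have d: "del (\<lambda>z. complex_of_real (\<phi> z)) p (vec10 \<tau>) = (complex_of_real (FD \<phi> p \<tau>) - \<i> * complex_of_real (FD \<phi> p (J \<tau>))) / 2"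
    using del_eq[OF of_real_has_derivative[OF Cn_on_has_FD[OF assms(2) _ assms(3)]]] by (simp add: vec10_def)
  have "del (\<lambda>z. complex_of_real (\<phi> z)) p (vec10 \<tau>) - 2 * alpha_form \<Omega> p (vec10 \<tau>) = 
     Complex ((FD \<phi> p \<tau> - theta2 p \<tau>) / 2) (- (FD \<phi> p (J \<tau>) + theta1 p \<tau>) / 2)"
    unfolding d unfolding vec10_def alpha_eq(1)[OF assms(4)] by (simp add: complex_eq_iff)
  then have "(cmod (del (\<lambda>z. complex_of_real (\<phi> z)) p (vec10 \<tau>) - 2 * alpha_form \<Omega> p (vec10 \<tau>)))\<^sup>2 = bd_lhs \<phi> p \<tau> / 4"
    by (simp only: cmod_power2) (simp add: bd_lhs_def power2_eq_square field_simps)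
  then show ?thesis by (simp only: ineq_lhs_def times_divide_eq_right)
qed

end

section \<open>The strictly plurisubharmonic power\<close>

text \<open>The positive factor is pulled out so that the sign of the Levi form is that of the
  bracket, whose terms are homogeneous of degree 0 in \<rho>.\<close>

lemma levi_re_neg_powr:
  fixes \<rho> :: "complex^'n \<Rightarrow> real"
  assumes S: "open S" and \<rho>: "Cn_on 2 S \<rho>" and neg: "\<And>z. z \<in> S \<Longrightarrow> \<rho> z < 0" and x: "x \<in> S"
  shows "levi_re (\<lambda>z. - ((- \<rho> z) powr \<eta>)) x v =
    \<eta> * (- \<rho> x) powr \<eta> * (levi_re \<rho> x v / (- \<rho> x) + (1 - \<eta>) * grad_sq \<rho> x v / (\<rho> x)\<^sup>2)"
proof -
  have powr_der: "((\<lambda>t. (- t) powr a) has_real_derivative - (a * (- t) powr (a - 1))) (at t)" if "t < 0" for t a :: real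
    using DERIV_chain2[OF has_real_derivative_powr[of "- t" a] DERIV_minus[OF DERIV_ident]] that by simp
  have h: "((\<lambda>t. - ((- t) powr \<eta>)) has_real_derivative \<eta> * (- t) powr (\<eta> - 1)) (at t)" if "t < 0" for t :: real
    using DERIV_minus[OF powr_der[OF that, of \<eta>]] by simp
  have h': "((\<lambda>t. \<eta> * (- t) powr (\<eta> - 1)) has_real_derivative \<eta> * (1 - \<eta>) * (- t) powr (\<eta> - 2)) (at t)" if "t < 0" for t :: real
    using DERIV_cmult[OF powr_der[OF that, of "\<eta> - 1"], of \<eta>] by (simp add: algebra_simps)
  have D: "D2 (\<lambda>z. - ((- \<rho> z) powr \<eta>)) x v w = \<eta> * (1 - \<eta>) * (- \<rho> x) powr (\<eta> - 2) * FD \<rho> x v * FD \<rho> x w +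
     \<eta> * (- \<rho> x) powr (\<eta> - 1) * D2 \<rho> x v w" for v w
    by (rule D2_real_compose[OF S \<rho> x h h'], use neg x in auto)
  have r: "- \<rho> x > 0" using neg[OF x] by simp
  have p: "(- \<rho> x) powr (\<eta> - 1) = (- \<rho> x) powr \<eta> / (- \<rho> x)" "(- \<rho> x) powr (\<eta> - 2) = (- \<rho> x) powr \<eta> / (\<rho> x)\<^sup>2"
    using r by (simp_all add: powr_diff)
  show ?thesis
    unfolding levi_re_def grad_sq_def D p using r by (simp add: power2_eq_square field_simps)
qed

lemma Cn_on_neg_powr:
  fixes \<rho> :: "'a::real_normed_vector \<Rightarrow> real"
  assumes "open S" "Cn_on m S \<rho>" "\<And>z. z \<in> S \<Longrightarrow> \<rho> z < 0"
  shows "Cn_on m S (\<lambda>z. - ((- \<rho> z) powr \<eta>))"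
  by (intro Cn_on_minus assms(1) Cn_on_compose[OF assms(1) open_greaterThan[of 0] _ Cn_on_minus[OF assms(1,2)] Cn_on_powr])
    (use assms(3) in auto)

lemma psh_on_subset:
  assumes "psh_on S u" "T \<subseteq> S"
  shows "psh_on T u"
proof -
  have "usc_on T u"
    using assms unfolding psh_on_def usc_on_def by (meson at_le filter_leD subsetD)
  then show ?thesis
    using assms unfolding psh_on_def by (meson subsetD)
qed

text \<open>Multiplied by b - a, the difference of the two sides is the square of (b - a) x - a
  y.\<close>

lemma square_sum_le:
  fixes a b x y :: real
  assumes "0 \<le> a" "a < b"
  shows "a * (x + y)\<^sup>2 \<le> b * x\<^sup>2 + a * b / (b - a) * y\<^sup>2"
proof -
  have "(b - a) * (b * x\<^sup>2 + a * b / (b - a) * y\<^sup>2 - a * (x + y)\<^sup>2) = ((b - a) * x - a * y)\<^sup>2"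
    using assms by (simp add: power2_eq_square field_simps)
  then have "0 \<le> (b - a) * (b * x\<^sup>2 + a * b / (b - a) * y\<^sup>2 - a * (x + y)\<^sup>2)" by simp
  then show ?thesis using assms by (simp add: zero_le_mult_iff)
qed

section \<open>The Hessian of the distance near a pseudoconvex boundary\<close>

context normal_field
begin

lemma sdist_neg: "q \<in> \<Omega> \<Longrightarrow> sdist \<Omega> q < 0"
  using open_\<Omega> frontier_ne in_closed_iff_infdist_zero[of "frontier \<Omega>" q] infdist_nonneg[of q "frontier \<Omega>"]
  by (auto simp: sdist_def frontier_def interior_open less_le)

lemma sdist_frontier: "p \<in> frontier \<Omega> \<Longrightarrow> sdist \<Omega> p = 0"
  by (simp add: sdist_def)

lemma sdist_pos: "q \<notin> closure \<Omega> \<Longrightarrow> 0 < sdist \<Omega> q"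
  using frontier_ne in_closed_iff_infdist_zero[of "frontier \<Omega>" q] infdist_nonneg[of q "frontier \<Omega>"] closure_subset[of \<Omega>]
  by (auto simp: sdist_def frontier_def less_le)

lemma in_U: "p \<in> frontier \<Omega> \<Longrightarrow> p \<in> U"
  using frontier_sub by blast

lemma levi_re_sdist: "q \<in> U \<Longrightarrow> levi_re (sdist \<Omega>) q v = FD N q v \<bullet> v + FD N q (J v) \<bullet> J v"
  by (simp add: levi_re_def D2_sdist)

lemma grad_sq_sdist: "q \<in> U \<Longrightarrow> grad_sq (sdist \<Omega>) q v = (N q \<bullet> v)\<^sup>2 + (N q \<bullet> J v)\<^sup>2"
  by (simp add: grad_sq_def FD_sdist)

text \<open>In the Levi form of -log of the distance the gradient terms vanish on vectors complex
  tangential to the level set; what remains is a positive multiple of the Levi form of the signed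
  distance.\<close>

lemma levi_interior:
  assumes psc: "pseudoconvex \<Omega>" and q: "q \<in> U" "q \<in> \<Omega>" and v: "N q \<bullet> v = 0" "N q \<bullet> J v = 0"
  shows "0 \<le> FD N q v \<bullet> v + FD N q (J v) \<bullet> J v"
proof -
  let ?S = "U \<inter> \<Omega>" and ?u = "\<lambda>z. - ln (infdist z (frontier \<Omega>))"
  have S: "open ?S" using open_U open_\<Omega> by blast
  have C: "Cn_on 2 ?S (sdist \<Omega>)" using C2_sdist by (rule Cn_on_subset) auto
  have eq: "- ln (- sdist \<Omega> z) = ?u z" if "z \<in> ?S" for z
    using that by (simp add: sdist_def)
  have "Cn_on 2 ?S (\<lambda>z. - ln (- sdist \<Omega> z))"
    by (intro Cn_on_minus S Cn_on_compose[OF S open_greaterThan[of 0] _ Cn_on_minus[OF S C] Cn_on_ln])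
      (use sdist_neg in auto)
  then have Cu: "Cn_on 2 ?S ?u" by (rule Cn_on_transform[OF _ S eq])
  have "psh_on ?S ?u" using psc unfolding pseudoconvex_def by (rule psh_on_subset) auto
  from psh_imp_levi_re_nonneg[OF S Cu this, of q v] q have "0 \<le> levi_re ?u q v" by simp
  also have "levi_re ?u q v = levi_re (\<lambda>z. - ln (- sdist \<Omega> z)) q v"
    unfolding levi_re_def using D2_cong[OF S _ eq, of q] q by simp
  also have "\<dots> = - levi_re (sdist \<Omega>) q v / sdist \<Omega> q"
  proof -
    have h: "((\<lambda>t. - ln (- t)) has_real_derivative - (1 / t)) (at t)" if "t < 0" for t :: real
      using that by (auto intro!: derivative_eq_intros)
    have h': "((\<lambda>t. - (1 / t)) has_real_derivative 1 / t\<^sup>2) (at t)" if "t < 0" for t :: real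
      using that by (auto intro!: derivative_eq_intros simp: power2_eq_square)
    have "D2 (\<lambda>z. - ln (- sdist \<Omega> z)) q a a = 1 / (sdist \<Omega> q)\<^sup>2 * FD (sdist \<Omega>) q a * FD (sdist \<Omega>) q a + - (1 / sdist \<Omega> q) * D2 (sdist \<Omega>) q a a" for a
      by (rule D2_real_compose[OF S C _ h h']) (use q sdist_neg in auto)
    then show ?thesis
      using v q by (simp add: levi_re_def FD_sdist diff_divide_distrib)
  qed
  finally have "0 \<le> - levi_re (sdist \<Omega>) q v / sdist \<Omega> q" .
  moreover have "sdist \<Omega> q < 0" by (rule sdist_neg[OF q(2)])
  ultimately have "0 \<le> levi_re (sdist \<Omega>) q v" by (simp add: divide_le_0_iff)
  then show ?thesis using levi_re_sdist[OF q(1)] by simp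
qed

text \<open>A limit of \<open>levi_interior\<close> from inside, with the vector projected at each
  approximating point onto the complex tangent space of the level set.\<close>

lemma levi_boundary:
  assumes psc: "pseudoconvex \<Omega>" and p: "p \<in> frontier \<Omega>" and \<tau>: "N p \<bullet> \<tau> = 0" "N p \<bullet> J \<tau> = 0"
  shows "0 \<le> FD N p \<tau> \<bullet> \<tau> + FD N p (J \<tau>) \<bullet> J \<tau>"
proof -
  have pU: "p \<in> U" using p in_U by blast
  have "p \<in> closure \<Omega>" using p by (simp add: frontier_def)
  then obtain q where q: "\<And>n. q n \<in> \<Omega>" "q \<longlonglongrightarrow> p" unfolding closure_sequential by blast
  have evU: "\<forall>\<^sub>F n in sequentially. q n \<in> U" using topological_tendstoD[OF q(2) open_U pU] .
  have "continuous_on U N" using Cn_on_continuous[OF C2_N] .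
  then have Nq: "(\<lambda>n. N (q n)) \<longlonglongrightarrow> N p"
    using continuous_on_tendsto_compose[of U N q p sequentially] q(2) pU evU by blast
  define v where "v n = \<tau> - (N (q n) \<bullet> \<tau>) *\<^sub>R N (q n) - (J (N (q n)) \<bullet> \<tau>) *\<^sub>R J (N (q n))" for n
  have "v \<longlonglongrightarrow> \<tau> - (N p \<bullet> \<tau>) *\<^sub>R N p - (J (N p) \<bullet> \<tau>) *\<^sub>R J (N p)"
    unfolding v_def[abs_def] by (intro tendsto_intros Nq)
  then have v: "v \<longlonglongrightarrow> \<tau>" using \<tau> by (simp add: inner_J_left)
  have "(\<lambda>n. FD N (q n) (v n) \<bullet> v n + FD N (q n) (J (v n)) \<bullet> J (v n)) \<longlonglongrightarrow> FD N p \<tau> \<bullet> \<tau> + FD N p (J \<tau>) \<bullet> J \<tau>"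
    by (intro tendsto_intros FD_tendsto[OF open_U C2_N _ pU] q v) auto
  moreover have "\<forall>\<^sub>F n in sequentially. 0 \<le> FD N (q n) (v n) \<bullet> v n + FD N (q n) (J (v n)) \<bullet> J (v n)"
    using evU
  proof eventually_elim
    case (elim n)
    have "N (q n) \<bullet> v n = 0" "N (q n) \<bullet> J (v n) = 0"
      using inner_N_self[OF elim] by (simp_all add: v_def inner_diff_right inner_add_right inner_J_left)
    then show ?case using levi_interior[OF psc elim q(1)] by blast
  qed
  ultimately show ?thesis by (rule tendsto_lowerbound) simp
qed

text \<open>Differentiating the constancy of the normal along normals gives this exact relation
  between the Hessians at a point and at its foot point; third derivatives of the distance do not
  appear.\<close>

lemma FD_N_transport:
  assumes q: "q \<in> U" and v: "N q \<bullet> v = 0"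
  defines "p \<equiv> q - sdist \<Omega> q *\<^sub>R N q"
  shows "FD N q v = FD N p v - sdist \<Omega> q *\<^sub>R FD N p (FD N q v)"
proof -
  have pU: "p \<in> U" unfolding p_def using proj[OF q] in_U by blast
  have "((\<lambda>z. z - sdist \<Omega> z *\<^sub>R N z) has_derivative 
     (\<lambda>v. v - (sdist \<Omega> q *\<^sub>R FD N q v + (N q \<bullet> v) *\<^sub>R N q))) (at q)"
    by (intro has_derivative_diff has_derivative_scaleR has_derivative_ident der_sdist der_N q)
  moreover have "(N has_derivative FD N p) (at (q - sdist \<Omega> q *\<^sub>R N q))"
    using der_N[OF pU] by (simp add: p_def)
  ultimately have "((\<lambda>z. N (z - sdist \<Omega> z *\<^sub>R N z)) has_derivative 
     (\<lambda>v. FD N p (v - (sdist \<Omega> q *\<^sub>R FD N q v + (N q \<bullet> v) *\<^sub>R N q)))) (at q)"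
    by (rule has_derivative_compose)
  then have "(N has_derivative (\<lambda>v. FD N p (v - (sdist \<Omega> q *\<^sub>R FD N q v + (N q \<bullet> v) *\<^sub>R N q)))) (at q)"
    by (rule has_derivative_transform_within_open[OF _ open_U q]) (rule N_proj)
  from FD_eqI[OF this] have "FD N q v = FD N p (v - (sdist \<Omega> q *\<^sub>R FD N q v + (N q \<bullet> v) *\<^sub>R N q))" by metis
  then show ?thesis
    using linear_diff[OF linear_FD_N[OF pU]] linear_scale[OF linear_FD_N[OF pU]] v by simp
qed

text \<open>The gap between \<open>a\<close> and \<open>b\<close> pays, by
  \<open>square_sum_le\<close>, for the gradient of \<kappa> |z|^2. Its square costs an amount of
  order \<kappa>^2, while its Levi form gains one of order \<kappa>. The same \<kappa> serves every
  \<phi>, so \<phi> may be chosen after it.\<close>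

lemma strict_perturbation:
  assumes ab: "0 \<le> a" "a < b"
  obtains \<kappa> where "0 < \<kappa>" "\<And>S (\<phi> :: complex^'n \<Rightarrow> real) p \<tau>. open S \<Longrightarrow> Cn_on 2 S \<phi> \<Longrightarrow> p \<in> S \<Longrightarrow> p \<in> frontier \<Omega> \<Longrightarrow>
    a * bd_lhs (\<lambda>z. \<phi> z + \<kappa> * (z \<bullet> z)) p \<tau> + 2 * \<kappa> * (norm \<tau>)\<^sup>2 - bd_rhs (\<lambda>z. \<phi> z + \<kappa> * (z \<bullet> z)) p \<tau>
      \<le> b * bd_lhs \<phi> p \<tau> - bd_rhs \<phi> p \<tau>"
proof -
  obtain M where M: "\<And>p. p \<in> frontier \<Omega> \<Longrightarrow> norm p \<le> M"
    using compact_imp_bounded[OF compact_frontier] unfolding bounded_iff by blast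
  define C where "C = a * b / (b - a)"
  have C: "0 \<le> C" using ab by (simp add: C_def)
  \<comment> \<open>Makes the cost 8 C M^2 \<kappa>^2 |\<tau>|^2 of the gradient at most 2 \<kappa>
    |\<tau>|^2, half of the gain 4 \<kappa> |\<tau>|^2 from the Levi form. The other half is kept as
    strictness.\<close>
  define \<kappa> where "\<kappa> = 1 / (4 * C * M\<^sup>2 + 1)"
  have c1: "0 < 4 * C * M\<^sup>2 + 1" using C by (intro add_nonneg_pos) auto
  have k: "0 < \<kappa>" using c1 by (simp add: \<kappa>_def)
  have k1: "4 * C * M\<^sup>2 * \<kappa> \<le> 1" using c1 by (simp add: \<kappa>_def)
  show ?thesis
  proof
    show "0 < \<kappa>" by (rule k)
    fix S and \<phi> :: "complex^'n \<Rightarrow> real" and p \<tau> assume S: "open S" and \<phi>: "Cn_on 2 S \<phi>" and p: "p \<in> S" "p \<in> frontier \<Omega>"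
    let ?f = "\<lambda>z. \<phi> z + \<kappa> * (z \<bullet> z)"
    have F: "FD ?f p v = FD \<phi> p v + 2 * \<kappa> * (p \<bullet> v)" for v
      using FD_add[OF \<phi> Cn_on_norm_square[OF S] _ p(1)] by (simp add: FD_norm_square)
    have D: "D2 ?f p v w = D2 \<phi> p v w + 2 * \<kappa> * (v \<bullet> w)" for v w
      using D2_add[OF S \<phi> Cn_on_norm_square[OF S] p(1)] by (simp add: D2_norm_square)
    have R: "bd_rhs ?f p \<tau> = bd_rhs \<phi> p \<tau> + 4 * \<kappa> * (norm \<tau>)\<^sup>2"
      by (simp add: bd_rhs_def levi_re_def D power2_norm_eq_inner)
    have bd: "(p \<bullet> v)\<^sup>2 \<le> M\<^sup>2 * (norm \<tau>)\<^sup>2" if "norm v = norm \<tau>" for v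
    proof -
      have "\<bar>p \<bullet> v\<bar> \<le> norm p * norm v" by (rule Cauchy_Schwarz_ineq2)
      also have "\<dots> \<le> M * norm \<tau>" using M[OF p(2)] that by (simp add: mult_right_mono)
      finally have "\<bar>p \<bullet> v\<bar>\<^sup>2 \<le> (M * norm \<tau>)\<^sup>2" by (rule power_mono) simp
      then show ?thesis by (simp add: power_mult_distrib)
    qed
    have "a * bd_lhs ?f p \<tau> = a * ((FD \<phi> p \<tau> - theta2 p \<tau>) + 2 * \<kappa> * (p \<bullet> \<tau>))\<^sup>2 + a * ((FD \<phi> p (J \<tau>) + theta1 p \<tau>) + 2 * \<kappa> * (p \<bullet> J \<tau>))\<^sup>2"
      by (simp add: bd_lhs_def F algebra_simps)
    also have "\<dots> \<le> (b * (FD \<phi> p \<tau> - theta2 p \<tau>)\<^sup>2 + C * (2 * \<kappa> * (p \<bullet> \<tau>))\<^sup>2) + (b * (FD \<phi> p (J \<tau>) + theta1 p \<tau>)\<^sup>2 + C * (2 * \<kappa> * (p \<bullet> J \<tau>))\<^sup>2)"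
      unfolding C_def by (intro add_mono square_sum_le ab)
    also have "\<dots> = b * bd_lhs \<phi> p \<tau> + 4 * C * \<kappa>\<^sup>2 * ((p \<bullet> \<tau>)\<^sup>2 + (p \<bullet> J \<tau>)\<^sup>2)"
      by (simp add: bd_lhs_def power2_eq_square algebra_simps)
    also have "\<dots> \<le> b * bd_lhs \<phi> p \<tau> + 4 * C * \<kappa>\<^sup>2 * (M\<^sup>2 * (norm \<tau>)\<^sup>2 + M\<^sup>2 * (norm \<tau>)\<^sup>2)"
      using C bd[of \<tau>] bd[of "J \<tau>"] by (intro add_left_mono mult_left_mono add_mono) auto
    also have "\<dots> = b * bd_lhs \<phi> p \<tau> + (4 * C * M\<^sup>2 * \<kappa>) * (2 * \<kappa> * (norm \<tau>)\<^sup>2)"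
      by (simp add: power2_eq_square)
    also have "\<dots> \<le> b * bd_lhs \<phi> p \<tau> + 1 * (2 * \<kappa> * (norm \<tau>)\<^sup>2)"
      using k1 k by (intro add_left_mono mult_right_mono) auto
    finally show "a * bd_lhs ?f p \<tau> + 2 * \<kappa> * (norm \<tau>)\<^sup>2 - bd_rhs ?f p \<tau> \<le> b * bd_lhs \<phi> p \<tau> - bd_rhs \<phi> p \<tau>"
      unfolding R by simp
  qed
qed

text \<open>This is \<open>4 / (\<eta> (- \<rho>)\<^sup>\<eta>)\<close> times the Levi form of \<open>- (- \<rho>)\<^sup>\<eta>\<close> for \<open>\<rho> = sdist \<Omega> \<cdot> exp (- f)\<close>.\<close>

definition weighted_levi :: "real \<Rightarrow> (complex^'n \<Rightarrow> real) \<Rightarrow> complex^'n \<Rightarrow> complex^'n \<Rightarrow> real" where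
  "weighted_levi \<eta> f q v = levi_re (sdist \<Omega>) q v / (- sdist \<Omega> q) + (1 - \<eta>) * grad_sq (sdist \<Omega>) q v / (sdist \<Omega> q)\<^sup>2
     - 2 * \<eta> / (- sdist \<Omega> q) * (N q \<bullet> v * FD f q v + N q \<bullet> J v * FD f q (J v)) + levi_re f q v - \<eta> * grad_sq f q v"

lemma weighted_levi_eq:
  assumes S: "open S" "S \<subseteq> U" "S \<subseteq> \<Omega>" and f: "Cn_on 2 S f" and q: "q \<in> S"
  defines "\<rho> \<equiv> \<lambda>z. sdist \<Omega> z * exp (- f z)"
  shows "levi_re \<rho> q v / (- \<rho> q) + (1 - \<eta>) * grad_sq \<rho> q v / (\<rho> q)\<^sup>2 = weighted_levi \<eta> f q v"
proof -
  have C: "Cn_on 2 S (sdist \<Omega>)" using C2_sdist S(2) by (rule Cn_on_subset)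
  have h: "((\<lambda>t. exp (- t)) has_real_derivative - exp (- t)) (at t)" for t :: real
    by (auto intro!: derivative_eq_intros)
  have h': "((\<lambda>t. - exp (- t)) has_real_derivative exp (- t)) (at t)" for t :: real
    by (auto intro!: derivative_eq_intros)
  have Ce: "Cn_on 2 S (\<lambda>z. exp (- f z))"
    by (rule Cn_on_compose[OF S(1) open_UNIV _ Cn_on_minus[OF S(1) f] Cn_on_exp]) simp
  have Fe: "FD (\<lambda>z. exp (- f z)) q w = - exp (- f q) * FD f q w" for w
    by (rule FD_real_compose[OF f _ q h]) simp
  have De: "D2 (\<lambda>z. exp (- f z)) q w w = exp (- f q) * FD f q w * FD f q w + - exp (- f q) * D2 f q w w" for w
    by (rule D2_real_compose[OF S(1) f q h h'])
  have F: "FD \<rho> q w = exp (- f q) * (FD (sdist \<Omega>) q w - sdist \<Omega> q * FD f q w)" for w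
    unfolding \<rho>_def using FD_mult[OF C Ce _ q, of w] by (simp add: Fe algebra_simps)
  have D: "D2 \<rho> q w w = exp (- f q) * (D2 (sdist \<Omega>) q w w - 2 * FD (sdist \<Omega>) q w * FD f q w + sdist \<Omega> q * ((FD f q w)\<^sup>2 - D2 f q w w))" for w
    unfolding \<rho>_def using D2_mult[OF S(1) C Ce q, of w w] by (simp add: Fe De power2_eq_square algebra_simps)
  have r: "sdist \<Omega> q < 0" using sdist_neg S q by blast
  have q': "q \<in> U" using S q by blast
  define r where "r = sdist \<Omega> q"
  define e where "e = exp (- f q)"
  have e: "e \<noteq> 0" "r \<noteq> 0" using r by (auto simp: e_def r_def)
  have "levi_re \<rho> q v / (- \<rho> q) = (levi_re (sdist \<Omega>) q v - 2 * (N q \<bullet> v * FD f q v + N q \<bullet> J v * FD f q (J v))) / (- r) - grad_sq f q v + levi_re f q v"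
    unfolding levi_re_def grad_sq_def D FD_sdist[OF q'] e_def[symmetric] r_def[symmetric] using e
    by (simp add: \<rho>_def e_def[symmetric] r_def[symmetric] field_simps)
  note A = this
  have B: "grad_sq \<rho> q v / (\<rho> q)\<^sup>2 = grad_sq (sdist \<Omega>) q v / r\<^sup>2 + 2 * (N q \<bullet> v * FD f q v + N q \<bullet> J v * FD f q (J v)) / (- r) + grad_sq f q v"
    unfolding grad_sq_def F FD_sdist[OF q'] e_def[symmetric] r_def[symmetric] using e
    by (simp add: \<rho>_def e_def[symmetric] r_def[symmetric] power2_eq_square field_simps)
  show ?thesis
    unfolding times_divide_eq_right[symmetric] A B
    unfolding weighted_levi_def r_def[symmetric] using e by (simp add: field_simps)
qed

lemma weighted_levi_scale:
  assumes "open S" "Cn_on 2 S f" "q \<in> S" "q \<in> U"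
  shows "weighted_levi \<eta> f q (c *\<^sub>R v) = c\<^sup>2 * weighted_levi \<eta> f q v"
proof -
  note lin = linear_scale[OF FD_linear[OF assms(2) _ assms(3)]] linear_scale[OF linear_FD_N[OF assms(4)]]
    linear_scale[OF D2_linear_left[OF assms(1-3)]] linear_scale[OF D2_linear_right[OF assms(2,3)]]
  show ?thesis
    by (simp add: weighted_levi_def levi_re_sdist[OF assms(4)] grad_sq_sdist[OF assms(4)])
      (simp add: levi_re_def grad_sq_def lin power2_eq_square algebra_simps)
qed

text \<open>Scaling the normal part by the distance \<delta> compensates the factors 1 / \<delta>
  and 1 / \<delta>^2 in the gradient terms; only the tangential Levi form keeps a factor 1 /
  \<delta>.\<close>

lemma weighted_levi_split:
  fixes a b :: real
  assumes q: "q \<in> U" "q \<in> \<Omega>" and \<tau>: "N q \<bullet> \<tau> = 0" "N q \<bullet> J \<tau> = 0"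
  defines "\<delta> \<equiv> - sdist \<Omega> q"
  defines "v \<equiv> \<tau> + \<delta> *\<^sub>R (a *\<^sub>R N q + b *\<^sub>R J (N q))"
  shows "weighted_levi \<eta> f q v = (FD N q \<tau> \<bullet> \<tau> + FD N q (J \<tau>) \<bullet> J \<tau>) / \<delta> + 2 * (b * theta1 q \<tau> + a * theta2 q \<tau>)
    + \<delta> * (a\<^sup>2 + b\<^sup>2) * (FD N q (J (N q)) \<bullet> J (N q)) + (1 - \<eta>) * (a\<^sup>2 + b\<^sup>2)
    - 2 * \<eta> * (a * FD f q v - b * FD f q (J v)) + levi_re f q v - \<eta> * grad_sq f q v"
proof -
  have d: "\<delta> > 0" using sdist_neg[OF q(2)] by (simp add: \<delta>_def)
  note lin = linear_add[OF linear_FD_N[OF q(1)]] linear_scale[OF linear_FD_N[OF q(1)]] linear_diff[OF linear_FD_N[OF q(1)]]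
    linear_neg[OF linear_FD_N[OF q(1)]]
  have NN: "N q \<bullet> N q = 1" by (rule inner_N_self[OF q(1)])
  have Nv: "N q \<bullet> v = \<delta> * a" "N q \<bullet> J v = - \<delta> * b"
    using NN \<tau> by (simp_all add: v_def inner_add_right inner_diff_right)
  have H1: "FD N q v \<bullet> v = FD N q \<tau> \<bullet> \<tau> + 2 * \<delta> * b * theta1 q \<tau> + \<delta>\<^sup>2 * b\<^sup>2 * (FD N q (J (N q)) \<bullet> J (N q))"
    using FD_N_symmetric[OF q(1), of "J (N q)" \<tau>] inner_FD_N_N[OF q(1)]
    by (simp add: v_def lin FD_N_N[OF q(1)] inner_add_left inner_add_right power2_eq_square algebra_simps)
  have H2: "FD N q (J v) \<bullet> J v = FD N q (J \<tau>) \<bullet> J \<tau> + 2 * \<delta> * a * theta2 q \<tau> + \<delta>\<^sup>2 * a\<^sup>2 * (FD N q (J (N q)) \<bullet> J (N q))"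
    using FD_N_symmetric[OF q(1), of "J (N q)" "J \<tau>"] inner_FD_N_N[OF q(1)]
    by (simp add: v_def lin FD_N_N[OF q(1)] inner_add_left inner_add_right inner_diff_right power2_eq_square algebra_simps)
  have r: "- sdist \<Omega> q = \<delta>" "(sdist \<Omega> q)\<^sup>2 = \<delta>\<^sup>2" by (simp_all add: \<delta>_def)
  show ?thesis
    unfolding weighted_levi_def r levi_re_sdist[OF q(1)] grad_sq_sdist[OF q(1)] Nv H1 H2 using d
    by (simp add: power2_eq_square field_simps)
qed

text \<open>Bad vectors \<tau> + \<delta>(a N + b J N) near the boundary are normalised in (\<tau>,
  a, b) rather than in length, which keeps the normal component visible in the limit. There the
  strict term and the completed squares force \<tau>, a and b to vanish, against the
  normalisation.\<close>

lemma weighted_levi_pos: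
  assumes psc: "pseudoconvex \<Omega>" and S: "open S" "frontier \<Omega> \<subseteq> S" "S \<subseteq> U" and f: "Cn_on 2 S f" and \<eta>: "0 < \<eta>" "\<eta> < 1"
    and \<kappa>: "\<kappa> > 0" and ineq: "\<And>p \<tau>. p \<in> frontier \<Omega> \<Longrightarrow> N p \<bullet> \<tau> = 0 \<Longrightarrow> N p \<bullet> J \<tau> = 0 \<Longrightarrow>
      \<eta> / (1 - \<eta>) * bd_lhs f p \<tau> + 2 * \<kappa> * (norm \<tau>)\<^sup>2 \<le> bd_rhs f p \<tau>"
  obtains d where "d > 0" "{z. infdist z (frontier \<Omega>) \<le> d} \<subseteq> S" 
    "\<And>q v. q \<in> \<Omega> \<Longrightarrow> infdist q (frontier \<Omega>) < d \<Longrightarrow> v \<noteq> 0 \<Longrightarrow> 0 < weighted_levi \<eta> f q v"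
proof -
  obtain d0 where d0: "d0 > 0" "{z. infdist z (frontier \<Omega>) \<le> d0} \<subseteq> S"
    using compact_in_open_separated[OF frontier_ne compact_frontier S(1,2)] by blast
  have "\<exists>n. \<forall>q v. q \<in> \<Omega> \<longrightarrow> infdist q (frontier \<Omega>) < d0 / real (Suc n) \<longrightarrow> v \<noteq> 0 \<longrightarrow> 0 < weighted_levi \<eta> f q v"
  proof (rule ccontr)
    assume "\<not> ?thesis"
    then have "\<forall>n. \<exists>q v. q \<in> \<Omega> \<and> infdist q (frontier \<Omega>) < d0 / real (Suc n) \<and> v \<noteq> 0 \<and> weighted_levi \<eta> f q v \<le> 0"
      by (meson not_less)
    then obtain q v where qv: "\<And>n. q n \<in> \<Omega>" "\<And>n. infdist (q n) (frontier \<Omega>) < d0 / real (Suc n)" 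
      "\<And>n. v n \<noteq> 0" "\<And>n. weighted_levi \<eta> f (q n) (v n) \<le> 0" by metis
    have qS: "q n \<in> S" for n
    proof -
      have "d0 / real (Suc n) \<le> d0" using d0(1) by (simp add: field_simps)
      then have "infdist (q n) (frontier \<Omega>) \<le> d0" using qv(2)[of n] by linarith
      then show ?thesis using d0(2) by blast
    qed
    have qU: "q n \<in> U" for n using qS S by blast
    define \<delta> where "\<delta> n = - sdist \<Omega> (q n)" for n
    have \<delta>: "\<delta> n > 0" for n using sdist_neg[OF qv(1)] by (simp add: \<delta>_def)
    have "\<delta> n = infdist (q n) (frontier \<Omega>)" for n using qv(1) by (simp add: \<delta>_def sdist_def)
    then have \<delta>_less: "\<delta> n < d0 * inverse (real (Suc n))" for n using qv(2)[of n] by (simp add: divide_inverse)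
    have lim0: "(\<lambda>n. d0 * inverse (real (Suc n))) \<longlonglongrightarrow> 0"
      by (intro tendsto_mult_right_zero LIMSEQ_inverse_real_of_nat)
    have \<delta>0: "\<delta> \<longlonglongrightarrow> 0"
      by (rule tendsto_sandwich[OF _ _ tendsto_const lim0]) (auto intro!: always_eventually less_imp_le \<delta> \<delta>_less simp del: of_nat_Suc)
    define p where "p n = q n - sdist \<Omega> (q n) *\<^sub>R N (q n)" for n
    have p: "p n \<in> frontier \<Omega>" "N (p n) = N (q n)" for n
      unfolding p_def using proj[OF qU] N_proj[OF qU] by auto
    define \<nu> where "\<nu> n = N (q n)" for n
    define a where "a n = (\<nu> n \<bullet> v n) / \<delta> n" for n
    define b where "b n = (J (\<nu> n) \<bullet> v n) / \<delta> n" for n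
    define \<tau> where "\<tau> n = v n - \<delta> n *\<^sub>R (a n *\<^sub>R \<nu> n + b n *\<^sub>R J (\<nu> n))" for n
    \<comment> \<open>The normalising factor; dividing by it preserves the sign because
      \<open>weighted_levi\<close> is quadratic in the vector.\<close>
    define c where "c n = norm (\<tau> n, a n, b n)" for n
    have c: "c n > 0" for n
    proof -
      have "(\<tau> n, a n, b n) \<noteq> 0"
      proof
        assume "(\<tau> n, a n, b n) = 0"
        then have "v n = 0" by (simp add: \<tau>_def zero_prod_def)
        then show False using qv(3) by blast
      qed
      then show ?thesis by (simp add: c_def)
    qed
    define T where "T n = (\<tau> n /\<^sub>R c n, a n / c n, b n / c n)" for n
    have Teq: "T n = (\<tau> n, a n, b n) /\<^sub>R c n" for n by (simp add: T_def divide_inverse_commute)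
    have T1: "norm (T n) = 1" for n
      unfolding Teq norm_scaleR c_def[symmetric] using c[of n] by simp
    have cpt: "compact (frontier \<Omega> \<times> sphere (0 :: (complex^'n) \<times> real \<times> real) 1)"
      by (intro compact_Times compact_frontier compact_sphere)
    have mem: "\<forall>n. (p n, T n) \<in> frontier \<Omega> \<times> sphere 0 1" using p(1) T1 by simp
    obtain l \<sigma> where l: "l \<in> frontier \<Omega> \<times> sphere 0 1" "strict_mono \<sigma>" "((\<lambda>n. (p n, T n)) \<circ> \<sigma>) \<longlonglongrightarrow> l"
      by (rule seq_compactE[OF compact_imp_seq_compact[OF cpt] mem])
    obtain p0 t0 a0 b0 where l_eq: "l = (p0, t0, a0, b0)" by (rule prod_cases4)
    have p0: "p0 \<in> frontier \<Omega>" and n1: "norm (t0, a0, b0) = 1" using l(1) by (auto simp: l_eq)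
    have p0U: "p0 \<in> U" and p0S: "p0 \<in> S" using p0 in_U S by auto
    have lp: "(\<lambda>n. p (\<sigma> n)) \<longlonglongrightarrow> p0" and lt: "(\<lambda>n. \<tau> (\<sigma> n) /\<^sub>R c (\<sigma> n)) \<longlonglongrightarrow> t0"
      and la: "(\<lambda>n. a (\<sigma> n) / c (\<sigma> n)) \<longlonglongrightarrow> a0" and lb: "(\<lambda>n. b (\<sigma> n) / c (\<sigma> n)) \<longlonglongrightarrow> b0"
      using tendsto_fst[OF l(3)] tendsto_fst[OF tendsto_snd[OF l(3)]] tendsto_fst[OF tendsto_snd[OF tendsto_snd[OF l(3)]]]
        tendsto_snd[OF tendsto_snd[OF tendsto_snd[OF l(3)]]]
      by (simp_all add: l_eq T_def o_def)
    have ld: "(\<lambda>n. \<delta> (\<sigma> n)) \<longlonglongrightarrow> 0" using LIMSEQ_subseq_LIMSEQ[OF \<delta>0 l(2)] by (simp add: o_def)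
    have cN: "continuous_on U N" using Cn_on_continuous[OF C2_N] .
    have lnu: "(\<lambda>n. \<nu> (\<sigma> n)) \<longlonglongrightarrow> N p0"
    proof -
      have "(\<lambda>n. N (p (\<sigma> n))) \<longlonglongrightarrow> N p0"
        by (rule continuous_on_tendsto_compose[OF cN lp p0U]) (use p in_U in auto)
      then show ?thesis by (simp add: \<nu>_def p)
    qed
    have lq: "(\<lambda>n. q (\<sigma> n)) \<longlonglongrightarrow> p0"
    proof -
      have "(\<lambda>n. p (\<sigma> n) - \<delta> (\<sigma> n) *\<^sub>R \<nu> (\<sigma> n)) \<longlonglongrightarrow> p0 - 0 *\<^sub>R N p0"
        by (intro tendsto_intros lp ld lnu)
      then show ?thesis by (simp add: p_def \<delta>_def \<nu>_def)
    qed
    define tt where "tt n = \<tau> n /\<^sub>R c n" for n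
    define aa where "aa n = a n / c n" for n
    define bb where "bb n = b n / c n" for n
    define w where "w n = tt n + \<delta> n *\<^sub>R (aa n *\<^sub>R \<nu> n + bb n *\<^sub>R J (\<nu> n))" for n
    have weq: "w n = v n /\<^sub>R c n" for n
      by (simp add: w_def tt_def aa_def bb_def \<tau>_def divide_inverse algebra_simps)
    have NN: "\<nu> n \<bullet> \<nu> n = 1" for n unfolding \<nu>_def by (rule inner_N_self[OF qU])
    have tt: "N (q n) \<bullet> tt n = 0" "N (q n) \<bullet> J (tt n) = 0" for n
    proof -
      have "\<nu> n \<bullet> \<tau> n = 0" using NN[of n] \<delta>[of n] by (simp add: \<tau>_def a_def inner_diff_right inner_add_right)
      then show "N (q n) \<bullet> tt n = 0" by (simp add: tt_def \<nu>_def)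
      have "J (\<nu> n) \<bullet> \<tau> n = 0" using NN[of n] \<delta>[of n] by (simp add: \<tau>_def b_def inner_diff_right inner_add_right)
      then show "N (q n) \<bullet> J (tt n) = 0" by (simp add: tt_def \<nu>_def inner_J_left)
    qed
    \<comment> \<open>\<open>weighted_levi\<close> after dropping the nonnegative Levi form at the
      foot point divided by \<delta>. By \<open>FD_N_transport\<close> the rest of the tangential
      term is the bounded first line, which tends to the squared lengths of the Hessian in
      \<open>bd_rhs\<close>.\<close>
    define E where "E n = FD N (q n) (tt n) \<bullet> FD N (p n) (tt n) + FD N (q n) (J (tt n)) \<bullet> FD N (p n) (J (tt n))
      + 2 * (bb n * theta1 (q n) (tt n) + aa n * theta2 (q n) (tt n))
      + \<delta> n * ((aa n)\<^sup>2 + (bb n)\<^sup>2) * (FD N (q n) (J (N (q n))) \<bullet> J (N (q n))) + (1 - \<eta>) * ((aa n)\<^sup>2 + (bb n)\<^sup>2)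
      - 2 * \<eta> * (aa n * FD f (q n) (w n) - bb n * FD f (q n) (J (w n))) + levi_re f (q n) (w n) - \<eta> * grad_sq f (q n) (w n)" for n
    have E: "E n \<le> 0" for n
    proof -
      have pU: "p n \<in> U" using p in_U by blast
      have K: "FD N (q n) x \<bullet> x = FD N (p n) x \<bullet> x + \<delta> n * (FD N (q n) x \<bullet> FD N (p n) x)" if x: "N (q n) \<bullet> x = 0" for x
      proof -
        have "FD N (q n) x \<bullet> x = FD N (p n) x \<bullet> x + \<delta> n * (FD N (p n) (FD N (q n) x) \<bullet> x)"
          using FD_N_transport[OF qU x] unfolding p_def[symmetric] \<delta>_def
          by (metis (no_types, opaque_lifting) inner_add_left inner_minus_left inner_scaleR_left scaleR_minus_left diff_conv_add_uminus)
        then show ?thesis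
          using FD_N_symmetric[OF pU, of "FD N (q n) x" x] by (simp add: inner_commute)
      qed
      have "0 \<le> FD N (p n) (tt n) \<bullet> tt n + FD N (p n) (J (tt n)) \<bullet> J (tt n)"
        using levi_boundary[OF psc p(1)] tt p(2) by simp
      then have "\<delta> n * (FD N (q n) (tt n) \<bullet> FD N (p n) (tt n) + FD N (q n) (J (tt n)) \<bullet> FD N (p n) (J (tt n))) \<le>
         FD N (q n) (tt n) \<bullet> tt n + FD N (q n) (J (tt n)) \<bullet> J (tt n)"
        using K[OF tt(1)] K[OF tt(2)] by (simp add: algebra_simps)
      then have "FD N (q n) (tt n) \<bullet> FD N (p n) (tt n) + FD N (q n) (J (tt n)) \<bullet> FD N (p n) (J (tt n)) \<le>
         (FD N (q n) (tt n) \<bullet> tt n + FD N (q n) (J (tt n)) \<bullet> J (tt n)) / \<delta> n"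
        using \<delta>[of n] by (simp add: field_simps)
      then have "E n \<le> weighted_levi \<eta> f (q n) (w n)"
        using weighted_levi_split[where \<eta>=\<eta> and f=f and a="aa n" and b="bb n", OF qU[of n] qv(1)[of n] tt(1)[of n] tt(2)[of n]]
        unfolding E_def w_def \<delta>_def \<nu>_def by simp
      also have "\<dots> \<le> 0"
        unfolding weq using weighted_levi_scale[OF S(1) f qS[of n] qU[of n], of \<eta> "inverse (c n)" "v n"] qv(4)[of n]
        by (simp add: mult_nonneg_nonpos)
      finally show ?thesis .
    qed
    define f1 where "f1 = FD f p0 t0"
    define f2 where "f2 = FD f p0 (J t0)"
    define y1 where "y1 = theta1 p0 t0"
    define y2 where "y2 = theta2 p0 t0"
    have ltt: "(\<lambda>n. tt (\<sigma> n)) \<longlonglongrightarrow> t0" and laa: "(\<lambda>n. aa (\<sigma> n)) \<longlonglongrightarrow> a0" and lbb: "(\<lambda>n. bb (\<sigma> n)) \<longlonglongrightarrow> b0"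
      using lt la lb by (simp_all add: tt_def aa_def bb_def)
    have lN: "(\<lambda>n. N (q (\<sigma> n))) \<longlonglongrightarrow> N p0" using lnu by (simp add: \<nu>_def)
    have lw: "(\<lambda>n. w (\<sigma> n)) \<longlonglongrightarrow> t0"
    proof -
      have "(\<lambda>n. w (\<sigma> n)) \<longlonglongrightarrow> t0 + 0 *\<^sub>R (a0 *\<^sub>R N p0 + b0 *\<^sub>R J (N p0))"
        unfolding w_def by (intro tendsto_intros ltt ld laa lbb lnu)
      then show ?thesis by simp
    qed
    have one2: "(1::nat) \<le> 2" by simp
    have "(\<lambda>n. E (\<sigma> n)) \<longlonglongrightarrow> FD N p0 t0 \<bullet> FD N p0 t0 + FD N p0 (J t0) \<bullet> FD N p0 (J t0)
      + 2 * (b0 * theta1 p0 t0 + a0 * theta2 p0 t0)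
      + 0 * (a0\<^sup>2 + b0\<^sup>2) * (FD N p0 (J (N p0)) \<bullet> J (N p0)) + (1 - \<eta>) * (a0\<^sup>2 + b0\<^sup>2)
      - 2 * \<eta> * (a0 * FD f p0 t0 - b0 * FD f p0 (J t0)) + levi_re f p0 t0 - \<eta> * grad_sq f p0 t0" (is "_ \<longlonglongrightarrow> ?L")
      unfolding E_def levi_re_def grad_sq_def
      by (intro tendsto_intros FD_tendsto[OF open_U C2_N one2 p0U] FD_tendsto[OF S(1) f one2 p0S] D2_tendsto[OF S(1) f p0S]
          lq lp ltt laa lbb lN lw ld)
    then have "?L \<le> 0" by (rule LIMSEQ_le_const2) (use E in auto)
    \<comment> \<open>Completion of squares in a0 and b0; the division by 1 - \<eta> creates the
      weight in front of \<open>bd_lhs\<close>.\<close>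
    moreover have "?L = (bd_rhs f p0 t0 - \<eta> / (1 - \<eta>) * bd_lhs f p0 t0) + (1 - \<eta>) * ((a0 + (y2 - \<eta> * f1) / (1 - \<eta>))\<^sup>2 + (b0 + (y1 + \<eta> * f2) / (1 - \<eta>))\<^sup>2)"
    proof -
      have "?L = bd_rhs f p0 t0 + (y1\<^sup>2 + y2\<^sup>2 + 2 * (b0 * y1 + a0 * y2) + (1 - \<eta>) * (a0\<^sup>2 + b0\<^sup>2) - 2 * \<eta> * (a0 * f1 - b0 * f2) - \<eta> * (f1\<^sup>2 + f2\<^sup>2))"
        by (simp add: bd_rhs_def y1_def y2_def f1_def f2_def grad_sq_def power2_norm_eq_inner)
      also have "y1\<^sup>2 + y2\<^sup>2 + 2 * (b0 * y1 + a0 * y2) + (1 - \<eta>) * (a0\<^sup>2 + b0\<^sup>2) - 2 * \<eta> * (a0 * f1 - b0 * f2) - \<eta> * (f1\<^sup>2 + f2\<^sup>2) =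
        - (\<eta> / (1 - \<eta>) * ((f1 - y2)\<^sup>2 + (f2 + y1)\<^sup>2)) + (1 - \<eta>) * ((a0 + (y2 - \<eta> * f1) / (1 - \<eta>))\<^sup>2 + (b0 + (y1 + \<eta> * f2) / (1 - \<eta>))\<^sup>2)"
      proof -
        define m where "m = 1 - \<eta>"
        have m: "m \<noteq> 0" "\<eta> = 1 - m" using \<eta> by (auto simp: m_def)
        show ?thesis unfolding m(2) using m(1) by (simp add: power2_eq_square field_simps)
      qed
      finally show ?thesis by (simp add: bd_lhs_def y1_def y2_def f1_def f2_def)
    qed
    moreover have tg: "N p0 \<bullet> t0 = 0" "N p0 \<bullet> J t0 = 0"
    proof -
      have "(\<lambda>n. N (q (\<sigma> n)) \<bullet> tt (\<sigma> n)) \<longlonglongrightarrow> N p0 \<bullet> t0" "(\<lambda>n. N (q (\<sigma> n)) \<bullet> J (tt (\<sigma> n))) \<longlonglongrightarrow> N p0 \<bullet> J t0"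
        by (intro tendsto_intros lN ltt)+
      then show "N p0 \<bullet> t0 = 0" "N p0 \<bullet> J t0 = 0"
        using tt by (simp_all add: LIMSEQ_const_iff)
    qed
    moreover have "2 * \<kappa> * (norm t0)\<^sup>2 \<le> bd_rhs f p0 t0 - \<eta> / (1 - \<eta>) * bd_lhs f p0 t0"
      using ineq[OF p0 tg] by simp
    ultimately have le: "2 * \<kappa> * (norm t0)\<^sup>2 + (1 - \<eta>) * ((a0 + (y2 - \<eta> * f1) / (1 - \<eta>))\<^sup>2 + (b0 + (y1 + \<eta> * f2) / (1 - \<eta>))\<^sup>2) \<le> 0"
      by linarith
    have nn: "0 \<le> (1 - \<eta>) * ((a0 + (y2 - \<eta> * f1) / (1 - \<eta>))\<^sup>2 + (b0 + (y1 + \<eta> * f2) / (1 - \<eta>))\<^sup>2)" using \<eta> by simp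
    have "2 * \<kappa> * (norm t0)\<^sup>2 \<le> 0" using le nn by linarith
    then have "(norm t0)\<^sup>2 \<le> 0" using \<kappa> by (simp add: mult_le_0_iff)
    then have t0: "t0 = 0" by simp
    \<comment> \<open>The centres of the two squares are linear in t0, so they vanish with it and
      a0, b0 can be read off.\<close>
    have z: "y1 = 0" "y2 = 0" "f1 = 0" "f2 = 0"
      using linear_0[OF FD_linear[OF f one2 p0S]] FD_N_zero[OF p0U] by (simp_all add: y1_def y2_def f1_def f2_def t0)
    have "(1 - \<eta>) * (a0\<^sup>2 + b0\<^sup>2) \<le> 0" using le by (simp add: z t0)
    then have "a0\<^sup>2 + b0\<^sup>2 \<le> 0" using \<eta> by (simp add: mult_le_0_iff)
    then have "a0 = 0" "b0 = 0" by (smt (verit) zero_le_power2 power2_less_eq_zero_iff)+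
    then show False using n1 t0 by (simp flip: zero_prod_def)
  qed
  then obtain n where n: "\<And>q v. q \<in> \<Omega> \<Longrightarrow> infdist q (frontier \<Omega>) < d0 / real (Suc n) \<Longrightarrow> v \<noteq> 0 \<Longrightarrow> 0 < weighted_levi \<eta> f q v" by blast
  have "d0 / real (Suc n) \<le> d0" "0 < d0 / real (Suc n)" using d0(1) by (simp_all add: field_simps)
  then show ?thesis using that[of "d0 / real (Suc n)"] n d0(2) by fastforce
qed

end

section \<open>The boundary inequality\<close>

context normal_field
begin

lemma sdist_neg_iff: "sdist \<Omega> q < 0 \<longleftrightarrow> q \<in> \<Omega>"
  using sdist_neg infdist_nonneg[of q "frontier \<Omega>"] by (auto simp: sdist_def)

lemma abs_sdist: "\<bar>sdist \<Omega> z\<bar> = infdist z (frontier \<Omega>)"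
  by (simp add: sdist_def infdist_nonneg)

text \<open>The orthogonality of the values of the Hessian to \<open>N\<close>, differentiated once
  more.\<close>

lemma D2_N_N:
  assumes p: "p \<in> U"
  shows "D2 N p v v \<bullet> N p = - (norm (FD N p v))\<^sup>2"
proof -
  have "((\<lambda>z. FD N z v \<bullet> N z) has_derivative (\<lambda>w. FD N p v \<bullet> FD N p w + D2 N p v w \<bullet> N p)) (at p)"
    by (intro has_derivative_inner C2_has_D2[OF C2_N p] der_N p)
  moreover have "((\<lambda>z. FD N z v \<bullet> N z) has_derivative (\<lambda>w. 0)) (at p)"
    by (rule has_derivative_transform_within_open[OF has_derivative_const[of 0] open_U p])
      (simp add: inner_FD_N_N)
  ultimately have "(\<lambda>w. FD N p v \<bullet> FD N p w + D2 N p v w \<bullet> N p) = (\<lambda>w. 0)"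
    by (rule has_derivative_unique)
  then have "FD N p v \<bullet> FD N p v + D2 N p v v \<bullet> N p = 0" by meson
  then show ?thesis by (simp add: power2_norm_eq_inner)
qed

text \<open>The foot point map. As \<rho> vanishes on its image, differentiating the composition
  once and twice determines the derivatives of \<rho> along the boundary without a
  parametrisation.\<close>

definition proj_bd where "proj_bd z = z - sdist \<Omega> z *\<^sub>R N z"

lemma der_proj_bd: "z \<in> U \<Longrightarrow> (proj_bd has_derivative (\<lambda>v. v - (sdist \<Omega> z *\<^sub>R FD N z v + (N z \<bullet> v) *\<^sub>R N z))) (at z)"
  unfolding proj_bd_def[abs_def]
  by (intro has_derivative_diff has_derivative_scaleR has_derivative_ident der_sdist der_N)

lemma C2_proj_bd: "Cn_on 2 U proj_bd"
  unfolding proj_bd_def[abs_def] by (intro Cn_on_diff Cn_on_scaleR Cn_on_id open_U C2_sdist C2_N)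

lemma D2_proj_bd:
  assumes p: "p \<in> frontier \<Omega>" and v: "N p \<bullet> v = 0" "N p \<bullet> w = 0"
  shows "D2 proj_bd p v w = - ((FD N p w \<bullet> v) *\<^sub>R N p)"
proof -
  have pU: "p \<in> U" using p by (rule in_U)
  have "((\<lambda>z. v - (sdist \<Omega> z *\<^sub>R FD N z v + (N z \<bullet> v) *\<^sub>R N z)) has_derivative
     (\<lambda>w. 0 - ((sdist \<Omega> p *\<^sub>R D2 N p v w + (N p \<bullet> w) *\<^sub>R FD N p v) + ((N p \<bullet> v) *\<^sub>R FD N p w + (FD N p w \<bullet> v) *\<^sub>R N p)))) (at p)"
    by (intro has_derivative_diff has_derivative_add has_derivative_scaleR has_derivative_const der_sdist der_N pU
        C2_has_D2[OF C2_N pU] has_derivative_inner_left)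
  from D2_eqI[OF open_U pU der_proj_bd this, of w] show ?thesis
    using v sdist_frontier[OF p] by simp
qed

end

section \<open>A defining function with a plurisubharmonic power\<close>

locale boundary_psh = normal_field \<Omega> U N for \<Omega> U :: "(complex^'n) set" and N +
  fixes W \<rho> Ue and \<eta> :: real
  assumes df: "defining_function 2 \<Omega> W \<rho>" and Ue: "open Ue" "frontier \<Omega> \<subseteq> Ue" "Ue \<subseteq> W"
    and psh: "psh_on (Ue \<inter> \<Omega>) (\<lambda>z. - ((- \<rho> z) powr \<eta>))" and \<eta>: "0 < \<eta>" "\<eta> < 1"
begin

lemma W: "open W" "frontier \<Omega> \<subseteq> W"
  using df by (auto simp: defining_function_def nbhd_of_boundary_def)

lemma C2_\<rho>: "Cn_on 2 W \<rho>"
proof -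
  have "enat 2 \<le> (2::enat)" by (simp add: numeral_eq_enat)
  then show ?thesis using df unfolding defining_function_def Ck_on_def by blast
qed

lemma \<rho>_zero: "p \<in> frontier \<Omega> \<Longrightarrow> \<rho> p = 0" and \<rho>_neg: "z \<in> W \<Longrightarrow> z \<in> \<Omega> \<Longrightarrow> \<rho> z < 0"
  and \<rho>_pos: "z \<in> W \<Longrightarrow> z \<notin> closure \<Omega> \<Longrightarrow> 0 < \<rho> z"
  using df by (auto simp: defining_function_def)

lemma \<rho>_neg_iff: "z \<in> W \<Longrightarrow> \<rho> z < 0 \<longleftrightarrow> z \<in> \<Omega>"
  using \<rho>_zero[of z] \<rho>_neg[of z] \<rho>_pos[of z] interior_open[OF open_\<Omega>]
  by (cases "z \<in> closure \<Omega>"; cases "z \<in> \<Omega>") (auto simp: frontier_def)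

lemma in_W: "p \<in> frontier \<Omega> \<Longrightarrow> p \<in> W" using W by blast

lemma der_\<rho>: "z \<in> W \<Longrightarrow> (\<rho> has_derivative FD \<rho> z) (at z)"
  using Cn_on_has_FD[OF C2_\<rho>] by simp

lemma linear_FD_\<rho>: "z \<in> W \<Longrightarrow> linear (FD \<rho> z)"
  using FD_linear[OF C2_\<rho>] by simp

text \<open>The limit of the quotient of \<rho> by the signed distance along the normal.\<close>

definition slope where "slope p = FD \<rho> p (N p)"

lemma \<rho>_proj: "z \<in> U \<Longrightarrow> \<rho> (proj_bd z) = 0" and proj_in: "z \<in> U \<Longrightarrow> proj_bd z \<in> W"
  using proj[of z] \<rho>_zero in_W by (auto simp: proj_bd_def)

lemma proj_bd_frontier: "p \<in> frontier \<Omega> \<Longrightarrow> proj_bd p = p"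
  by (simp add: proj_bd_def sdist_frontier)

lemma FD_\<rho>:
  assumes p: "p \<in> frontier \<Omega>"
  shows "FD \<rho> p v = slope p * (N p \<bullet> v)"
proof -
  have pU: "p \<in> U" and pW: "p \<in> W" using p in_U in_W by auto
  have "((\<lambda>z. \<rho> (proj_bd z)) has_derivative (\<lambda>v. FD \<rho> p (v - (sdist \<Omega> p *\<^sub>R FD N p v + (N p \<bullet> v) *\<^sub>R N p)))) (at p)"
    using has_derivative_compose[OF der_proj_bd[OF pU], of \<rho>] der_\<rho>[OF pW] proj_bd_frontier[OF p] by simp
  moreover have "((\<lambda>z. \<rho> (proj_bd z)) has_derivative (\<lambda>v. 0)) (at p)"
    by (rule has_derivative_transform_within_open[OF has_derivative_const[of 0] open_U pU])
      (simp add: \<rho>_proj)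
  ultimately have "(\<lambda>v. FD \<rho> p (v - (sdist \<Omega> p *\<^sub>R FD N p v + (N p \<bullet> v) *\<^sub>R N p))) = (\<lambda>v. 0)"
    by (rule has_derivative_unique)
  then have "FD \<rho> p (v - (sdist \<Omega> p *\<^sub>R FD N p v + (N p \<bullet> v) *\<^sub>R N p)) = 0" by meson
  then show ?thesis
    using sdist_frontier[OF p] linear_diff[OF linear_FD_\<rho>[OF pW]] linear_scale[OF linear_FD_\<rho>[OF pW]]
    by (simp add: slope_def)
qed

text \<open>The composition of \<rho> with \<open>proj_bd\<close> is constant, and the second
  derivative of \<open>proj_bd\<close> on tangential vectors is normal; paired with the gradient of
  \<rho> it gives the slope times the Hessian of the distance.\<close>

lemma D2_\<rho>:
  assumes p: "p \<in> frontier \<Omega>" and v: "N p \<bullet> v = 0" "N p \<bullet> w = 0"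
  shows "D2 \<rho> p v w = slope p * (FD N p w \<bullet> v)"
proof -
  have pU: "p \<in> U" and pW: "p \<in> W" using p in_U in_W by auto
  have FDp: "FD proj_bd p x = x - (N p \<bullet> x) *\<^sub>R N p" for x
    using FD_eqI[OF der_proj_bd[OF pU]] sdist_frontier[OF p] by simp
  have "D2 (\<lambda>z. \<rho> (proj_bd z)) p v w = D2 \<rho> p v w + FD \<rho> p (D2 proj_bd p v w)"
    using D2_compose[OF open_U W(1) C2_proj_bd C2_\<rho> pU proj_in, of v w] v
    by (simp add: FDp proj_bd_frontier[OF p])
  moreover have "D2 (\<lambda>z. \<rho> (proj_bd z)) p v w = 0"
  proof -
    have "((\<lambda>z. \<rho> (proj_bd z)) has_derivative (\<lambda>v. 0)) (at z)" if "z \<in> U" for z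
      by (rule has_derivative_transform_within_open[OF has_derivative_const[of 0] open_U that])
        (simp add: \<rho>_proj)
    from D2_eqI[OF open_U pU this has_derivative_const[of 0]] show ?thesis by simp
  qed
  moreover have "FD \<rho> p (D2 proj_bd p v w) = - (slope p * (FD N p w \<bullet> v))"
    using inner_N_self[OF pU] by (simp add: D2_proj_bd[OF p v] FD_\<rho>[OF p])
  ultimately show ?thesis by simp
qed

text \<open>A small step along -N lowers the signed distance and therefore enters \<Omega>, where
  \<rho> is negative; with a negative slope \<rho> would be positive there.\<close>

lemma slope_pos:
  assumes p: "p \<in> frontier \<Omega>"
  shows "slope p > 0"
proof -
  have pU: "p \<in> U" and pW: "p \<in> W" using p in_U in_W by auto
  have "slope p \<noteq> 0"
  proof
    assume "slope p = 0"
    then have "FD \<rho> p = (\<lambda>v. 0)" using FD_\<rho>[OF p] by auto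
    then show False using df p by (auto simp: defining_function_def)
  qed
  moreover have "\<not> slope p < 0"
  proof
    assume neg: "slope p < 0"
    have "((\<lambda>s. sdist \<Omega> (p + s *\<^sub>R (- N p))) has_real_derivative N p \<bullet> (- N p)) (at 0)"
      by (rule line_has_real_derivative) (use der_sdist[OF pU] in simp)
    from DERIV_neg_dec_right[OF this] obtain d1 where d1: "d1 > 0" 
      "\<And>h. 0 < h \<Longrightarrow> h < d1 \<Longrightarrow> sdist \<Omega> (p + h *\<^sub>R (- N p)) < sdist \<Omega> (p + 0 *\<^sub>R (- N p))"
      using inner_N_self[OF pU] by auto
    have "((\<lambda>s. \<rho> (p + s *\<^sub>R (- N p))) has_real_derivative FD \<rho> p (- N p)) (at 0)"
      by (rule line_has_real_derivative) (use der_\<rho>[OF pW] in simp)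
    moreover have "FD \<rho> p (- N p) > 0" using neg inner_N_self[OF pU] by (simp add: FD_\<rho>[OF p])
    ultimately obtain d2 where d2: "d2 > 0" 
      "\<And>h. 0 < h \<Longrightarrow> h < d2 \<Longrightarrow> \<rho> (p + 0 *\<^sub>R (- N p)) < \<rho> (p + h *\<^sub>R (- N p))"
      using DERIV_pos_inc_right by force
    obtain d3 where d3: "d3 > 0" "ball p d3 \<subseteq> W" using W(1) pW openE by blast
    define h where "h = min d1 (min d2 d3) / 2"
    have h: "0 < h" "h < d1" "h < d2" "h < d3" using d1 d2 d3 by (auto simp: h_def)
    have "sdist \<Omega> (p + h *\<^sub>R (- N p)) < 0" using d1(2)[OF h(1,2)] sdist_frontier[OF p] by simp
    then have "p + h *\<^sub>R (- N p) \<in> \<Omega>" using sdist_neg_iff by blast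
    moreover have "p + h *\<^sub>R (- N p) \<in> ball p d3"
      using h norm_N[OF pU] by (simp add: dist_norm)
    ultimately have "\<rho> (p + h *\<^sub>R (- N p)) < 0" using \<rho>_neg d3(2) by blast
    moreover have "\<rho> (p + h *\<^sub>R (- N p)) > 0" using d2(2)[OF h(1,3)] \<rho>_zero[OF p] by simp
    ultimately show False by simp
  qed
  ultimately show ?thesis by simp
qed

lemma levi_\<rho>:
  assumes q: "q \<in> Ue" "q \<in> \<Omega>"
  shows "0 \<le> levi_re \<rho> q v / (- \<rho> q) + (1 - \<eta>) * grad_sq \<rho> q v / (\<rho> q)\<^sup>2"
proof -
  let ?S = "Ue \<inter> \<Omega>"
  have S: "open ?S" using Ue open_\<Omega> by blast
  have C: "Cn_on 2 ?S \<rho>" by (rule Cn_on_subset[OF C2_\<rho>]) (use Ue in auto)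
  have neg: "\<rho> z < 0" if "z \<in> ?S" for z using that Ue \<rho>_neg by blast
  have "0 \<le> levi_re (\<lambda>z. - ((- \<rho> z) powr \<eta>)) q v"
    by (rule psh_imp_levi_re_nonneg[OF S Cn_on_neg_powr[OF S C neg] psh]) (use q in auto)
  then have "0 \<le> (\<eta> * (- \<rho> q) powr \<eta>) * (levi_re \<rho> q v / (- \<rho> q) + (1 - \<eta>) * grad_sq \<rho> q v / (\<rho> q)\<^sup>2)"
    using levi_re_neg_powr[OF S C neg, of q \<eta> v] q by simp
  moreover have "0 < \<eta> * (- \<rho> q) powr \<eta>" using \<eta> neg[of q] q by simp
  ultimately show ?thesis by (simp only: zero_le_mult_iff) auto
qed

section \<open>The logarithm translated along the normal\<close>

definition shift where "shift \<epsilon> p = p - \<epsilon> *\<^sub>R N p"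

definition shifted_log where "shifted_log \<epsilon> z = - ln (- \<rho> (shift \<epsilon> z))"

definition shift_dom where "shift_dom \<epsilon> = {z \<in> U. shift \<epsilon> z \<in> Ue \<inter> \<Omega>}"

lemma C2_shift: "Cn_on 2 U (shift \<epsilon>)"
  unfolding shift_def[abs_def] by (intro Cn_on_diff Cn_on_scaleR Cn_on_id open_U Cn_on_const C2_N)

lemma open_shift_dom: "open (shift_dom \<epsilon>)"
proof -
  have "open (U \<inter> shift \<epsilon> -` (Ue \<inter> \<Omega>))"
    by (rule continuous_open_preimage[OF Cn_on_continuous[OF C2_shift] open_U]) (use Ue open_\<Omega> in auto)
  moreover have "U \<inter> shift \<epsilon> -` (Ue \<inter> \<Omega>) = shift_dom \<epsilon>" by (auto simp: shift_dom_def)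
  ultimately show ?thesis by simp
qed

lemma C2_\<rho>_shift: "Cn_on 2 (shift_dom \<epsilon>) (\<lambda>z. \<rho> (shift \<epsilon> z))"
  by (rule Cn_on_compose[OF open_shift_dom W(1) _ Cn_on_subset[OF C2_shift] C2_\<rho>]) (use Ue in \<open>auto simp: shift_dom_def\<close>)

lemma \<rho>_shift_neg: "z \<in> shift_dom \<epsilon> \<Longrightarrow> \<rho> (shift \<epsilon> z) < 0"
  using \<rho>_neg Ue by (auto simp: shift_dom_def)

lemma C2_shifted_log: "Cn_on 2 (shift_dom \<epsilon>) (shifted_log \<epsilon>)"
  unfolding shifted_log_def[abs_def]
  by (intro Cn_on_minus open_shift_dom Cn_on_compose[OF open_shift_dom open_greaterThan[of 0] _ Cn_on_minus[OF open_shift_dom C2_\<rho>_shift] Cn_on_ln])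
    (use \<rho>_shift_neg in auto)

lemma shifted_log_derivatives:
  assumes p: "p \<in> shift_dom \<epsilon>"
  defines "q \<equiv> shift \<epsilon> p" and "H \<equiv> FD N p"
  shows "FD (shifted_log \<epsilon>) p v = (FD \<rho> q v - \<epsilon> * FD \<rho> q (H v)) / (- \<rho> q)"
    and "D2 (shifted_log \<epsilon>) p v v = ((FD \<rho> q v - \<epsilon> * FD \<rho> q (H v)) / (- \<rho> q))\<^sup>2 +
     (D2 \<rho> q v v - \<epsilon> * D2 \<rho> q v (H v) - \<epsilon> * D2 \<rho> q (H v) v + \<epsilon>\<^sup>2 * D2 \<rho> q (H v) (H v) - \<epsilon> * FD \<rho> q (D2 N p v v)) / (- \<rho> q)"
proof -
  let ?f = "\<lambda>z. \<rho> (shift \<epsilon> z)"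
  have pU: "p \<in> U" using p by (simp add: shift_dom_def)
  have qW: "q \<in> W" using p Ue by (auto simp: shift_dom_def q_def)
  have neg: "\<rho> q < 0" using \<rho>_shift_neg[OF p] by (simp add: q_def)
  note lin = linear_diff[OF linear_FD_\<rho>[OF qW]] linear_scale[OF linear_FD_\<rho>[OF qW]] linear_neg[OF linear_FD_\<rho>[OF qW]]
    linear_diff[OF D2_linear_right[OF C2_\<rho> qW]] linear_scale[OF D2_linear_right[OF C2_\<rho> qW]]
    linear_diff[OF D2_linear_left[OF W(1) C2_\<rho> qW]] linear_scale[OF D2_linear_left[OF W(1) C2_\<rho> qW]]
  have ds: "(shift \<epsilon> has_derivative (\<lambda>v. v - \<epsilon> *\<^sub>R FD N z v)) (at z)" if "z \<in> U" for z
    unfolding shift_def[abs_def]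
    by (intro has_derivative_diff has_derivative_scaleR_right has_derivative_ident der_N that)
  have F: "FD (shift \<epsilon>) p v = v - \<epsilon> *\<^sub>R H v" for v using FD_eqI[OF ds[OF pU]] by (simp add: H_def)
  have "((\<lambda>z. v - \<epsilon> *\<^sub>R FD N z v) has_derivative (\<lambda>w. 0 - \<epsilon> *\<^sub>R D2 N p v w)) (at p)" for v
    by (intro has_derivative_diff has_derivative_scaleR_right has_derivative_const C2_has_D2[OF C2_N pU])
  from D2_eqI[OF open_U pU ds this] have D: "D2 (shift \<epsilon>) p v w = - \<epsilon> *\<^sub>R D2 N p v w" for v w by simp
  have sub: "shift_dom \<epsilon> \<subseteq> U" "\<And>z. z \<in> shift_dom \<epsilon> \<Longrightarrow> shift \<epsilon> z \<in> W" using Ue by (auto simp: shift_dom_def)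
  have fF: "FD ?f p v = FD \<rho> q v - \<epsilon> * FD \<rho> q (H v)" for v
    using FD_compose[of "shift \<epsilon>" p \<rho> v] Cn_on_has_FD[OF C2_shift _ pU] der_\<rho>[OF qW] by (simp add: F q_def[symmetric] lin)
  have fD: "D2 ?f p v v = D2 \<rho> q v v - \<epsilon> * D2 \<rho> q v (H v) - \<epsilon> * D2 \<rho> q (H v) v + \<epsilon>\<^sup>2 * D2 \<rho> q (H v) (H v) - \<epsilon> * FD \<rho> q (D2 N p v v)"
    using D2_compose[OF open_shift_dom W(1) Cn_on_subset[OF C2_shift sub(1)] C2_\<rho> p sub(2), of v v]
    by (simp add: F D q_def[symmetric] lin power2_eq_square algebra_simps)
  have h: "((\<lambda>t. - ln (- t)) has_real_derivative - (1 / t)) (at t)" if "t < 0" for t :: real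
    using that by (auto intro!: derivative_eq_intros)
  have h': "((\<lambda>t. - (1 / t)) has_real_derivative 1 / t\<^sup>2) (at t)" if "t < 0" for t :: real
    using that by (auto intro!: derivative_eq_intros simp: power2_eq_square)
  have "FD (shifted_log \<epsilon>) p v = - (1 / \<rho> q) * FD ?f p v" for v
    unfolding shifted_log_def[abs_def] q_def
    by (rule FD_real_compose[OF C2_\<rho>_shift _ p h]) (use \<rho>_shift_neg[OF p] in auto)
  then show "FD (shifted_log \<epsilon>) p v = (FD \<rho> q v - \<epsilon> * FD \<rho> q (H v)) / (- \<rho> q)" by (simp add: fF)
  have "D2 (shifted_log \<epsilon>) p v v = 1 / (\<rho> q)\<^sup>2 * FD ?f p v * FD ?f p v + - (1 / \<rho> q) * D2 ?f p v v"
    unfolding shifted_log_def[abs_def] q_def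
    by (rule D2_real_compose[OF open_shift_dom C2_\<rho>_shift p h h']) (use \<rho>_shift_neg p in auto)
  then show "D2 (shifted_log \<epsilon>) p v v = ((FD \<rho> q v - \<epsilon> * FD \<rho> q (H v)) / (- \<rho> q))\<^sup>2 +
     (D2 \<rho> q v v - \<epsilon> * D2 \<rho> q v (H v) - \<epsilon> * D2 \<rho> q (H v) v + \<epsilon>\<^sup>2 * D2 \<rho> q (H v) (H v) - \<epsilon> * FD \<rho> q (D2 N p v v)) / (- \<rho> q)"
    by (simp add: fF fD power2_eq_square)
qed

text \<open>The last limit is a difference quotient for the derivative of \<rho>: at boundary points
  this derivative kills the tangential vectors \<open>v n\<close>, so at the translated points it is
  of order \<epsilon>. Tangential derivatives of the logarithm thus stay bounded although \<rho> is
  of order \<epsilon>.\<close>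

lemma shift_limits:
  assumes p: "\<And>n. p n \<in> frontier \<Omega>" "p \<longlonglongrightarrow> p0" "p0 \<in> frontier \<Omega>" and e: "\<And>n. \<epsilon> n > 0" "\<epsilon> \<longlonglongrightarrow> 0"
  shows "(\<lambda>n. N (p n)) \<longlonglongrightarrow> N p0" "(\<lambda>n. shift (\<epsilon> n) (p n)) \<longlonglongrightarrow> p0"
    "(\<lambda>n. - \<rho> (shift (\<epsilon> n) (p n)) / \<epsilon> n) \<longlonglongrightarrow> slope p0"
    "\<And>v v0. (\<And>n. N (p n) \<bullet> v n = 0) \<Longrightarrow> v \<longlonglongrightarrow> v0 \<Longrightarrow> (\<lambda>n. FD \<rho> (shift (\<epsilon> n) (p n)) (v n) / \<epsilon> n) \<longlonglongrightarrow> - D2 \<rho> p0 v0 (N p0)"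
proof -
  have p0W: "p0 \<in> W" and p0U: "p0 \<in> U" using p(3) in_W in_U by auto
  show lN: "(\<lambda>n. N (p n)) \<longlonglongrightarrow> N p0"
    by (rule continuous_on_tendsto_compose[OF Cn_on_continuous[OF C2_N] p(2) p0U]) (use p in_U in auto)
  have "(\<lambda>n. shift (\<epsilon> n) (p n)) \<longlonglongrightarrow> p0 - 0 *\<^sub>R N p0" unfolding shift_def by (intro tendsto_intros p e lN)
  then show lq: "(\<lambda>n. shift (\<epsilon> n) (p n)) \<longlonglongrightarrow> p0" by simp
  have sh: "shift (\<epsilon> n) (p n) = p n + \<epsilon> n *\<^sub>R (- N (p n))" for n by (simp add: shift_def)
  have lN': "(\<lambda>n. - N (p n)) \<longlonglongrightarrow> - N p0" by (intro tendsto_intros lN)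
  have C1: "Cn_on 1 W \<rho>" by (rule Cn_on_mono[OF C2_\<rho>]) simp
  have "(\<lambda>n. (\<rho> (shift (\<epsilon> n) (p n)) - \<rho> (p n)) / \<epsilon> n) \<longlonglongrightarrow> FD \<rho> p0 (- N p0)"
    unfolding sh by (rule difference_quotient_tendsto[OF W(1) C1 p0W p(2) lN' e])
  then have "(\<lambda>n. - ((\<rho> (shift (\<epsilon> n) (p n)) - \<rho> (p n)) / \<epsilon> n)) \<longlonglongrightarrow> - FD \<rho> p0 (- N p0)" by (rule tendsto_minus)
  moreover have "- FD \<rho> p0 (- N p0) = slope p0" using inner_N_self[OF p0U] by (simp add: FD_\<rho>[OF p(3)])
  ultimately show "(\<lambda>n. - \<rho> (shift (\<epsilon> n) (p n)) / \<epsilon> n) \<longlonglongrightarrow> slope p0" using \<rho>_zero[OF p(1)] by simp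
  fix v v0 assume v: "\<And>n. N (p n) \<bullet> v n = 0" "v \<longlonglongrightarrow> v0"
  have C1': "Cn_on 1 W (\<lambda>z. FD \<rho> z b)" for b
    using Cn_on_FD[of 1 W \<rho> b] C2_\<rho> by (simp only: numeral_2_eq_2 One_nat_def)
  have "(\<lambda>n. (FD \<rho> (shift (\<epsilon> n) (p n)) b - FD \<rho> (p n) b) / \<epsilon> n) \<longlonglongrightarrow> D2 \<rho> p0 b (- N p0)" for b
    unfolding sh D2_def by (rule difference_quotient_tendsto[OF W(1) C1' p0W p(2) lN' e])
  then have lim: "(\<lambda>n. \<Sum>b\<in>Basis. (v n \<bullet> b) * ((FD \<rho> (shift (\<epsilon> n) (p n)) b - FD \<rho> (p n) b) / \<epsilon> n)) \<longlonglongrightarrow> (\<Sum>b\<in>Basis. (v0 \<bullet> b) * D2 \<rho> p0 b (- N p0))"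
    by (intro tendsto_intros v)
  have "(\<Sum>b\<in>Basis. (v0 \<bullet> b) * D2 \<rho> p0 b (- N p0)) = D2 \<rho> p0 v0 (- N p0)"
    using linear_eq_sum_Basis[OF D2_linear_left[OF W(1) C2_\<rho> p0W], of v0 "- N p0"] by simp
  also have "\<dots> = - D2 \<rho> p0 v0 (N p0)" by (rule linear_neg[OF D2_linear_right[OF C2_\<rho> p0W]])
  finally have "(\<Sum>b\<in>Basis. (v0 \<bullet> b) * D2 \<rho> p0 b (- N p0)) = - D2 \<rho> p0 v0 (N p0)" .
  moreover have "\<forall>\<^sub>F n in sequentially. (\<Sum>b\<in>Basis. (v n \<bullet> b) * ((FD \<rho> (shift (\<epsilon> n) (p n)) b - FD \<rho> (p n) b) / \<epsilon> n)) = FD \<rho> (shift (\<epsilon> n) (p n)) (v n) / \<epsilon> n"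
    using topological_tendstoD[OF lq W(1) p0W]
  proof eventually_elim
    case (elim n)
    have "(\<Sum>b\<in>Basis. (v n \<bullet> b) * ((FD \<rho> (shift (\<epsilon> n) (p n)) b - FD \<rho> (p n) b) / \<epsilon> n)) =
      ((\<Sum>b\<in>Basis. (v n \<bullet> b) * FD \<rho> (shift (\<epsilon> n) (p n)) b) - (\<Sum>b\<in>Basis. (v n \<bullet> b) * FD \<rho> (p n) b)) / \<epsilon> n"
      by (simp add: sum_divide_distrib sum_subtractf[symmetric] right_diff_distrib diff_divide_distrib)
    also have "(\<Sum>b\<in>Basis. (v n \<bullet> b) * FD \<rho> (shift (\<epsilon> n) (p n)) b) = FD \<rho> (shift (\<epsilon> n) (p n)) (v n)"
      using linear_eq_sum_Basis[OF linear_FD_\<rho>[OF elim], of "v n"] by simp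
    also have "(\<Sum>b\<in>Basis. (v n \<bullet> b) * FD \<rho> (p n) b) = FD \<rho> (p n) (v n)"
      using linear_eq_sum_Basis[OF linear_FD_\<rho>[OF in_W[OF p(1)[of n]]], of "v n"] by simp
    also have "\<dots> = 0" using v(1) by (simp add: FD_\<rho>[OF p(1)])
    finally show ?case by simp
  qed
  ultimately show "(\<lambda>n. FD \<rho> (shift (\<epsilon> n) (p n)) (v n) / \<epsilon> n) \<longlonglongrightarrow> - D2 \<rho> p0 v0 (N p0)"
    using lim tendsto_cong by force
qed

text \<open>Positivity of the slope and the third limit of \<open>shift_limits\<close> place
  translated boundary points inside \<Omega>; compactness makes the threshold uniform.\<close>

lemma shift_eventually_in:
  obtains e0 where "e0 > 0" "\<And>\<epsilon>. 0 < \<epsilon> \<Longrightarrow> \<epsilon> < e0 \<Longrightarrow> frontier \<Omega> \<subseteq> shift_dom \<epsilon>"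
proof -
  have "\<exists>n. \<forall>\<epsilon>. 0 < \<epsilon> \<and> \<epsilon> < inverse (real (Suc n)) \<longrightarrow> frontier \<Omega> \<subseteq> shift_dom \<epsilon>"
  proof (rule ccontr)
    assume "\<not> ?thesis"
    then have "\<forall>n. \<exists>\<epsilon> p. 0 < \<epsilon> \<and> \<epsilon> < inverse (real (Suc n)) \<and> p \<in> frontier \<Omega> \<and> p \<notin> shift_dom \<epsilon>" by blast
    then obtain \<epsilon> p where ep: "\<And>n. 0 < \<epsilon> n" "\<And>n. \<epsilon> n < inverse (real (Suc n))" "\<And>n. p n \<in> frontier \<Omega>" "\<And>n. p n \<notin> shift_dom (\<epsilon> n)"
      by metis
    obtain p0 \<sigma> where p0: "p0 \<in> frontier \<Omega>" "strict_mono \<sigma>" "(p \<circ> \<sigma>) \<longlonglongrightarrow> p0"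
      by (rule seq_compactE[OF compact_imp_seq_compact[OF compact_frontier] allI[OF ep(3)]])
    have e0: "\<epsilon> \<longlonglongrightarrow> 0"
      by (rule tendsto_sandwich[OF _ _ tendsto_const LIMSEQ_inverse_real_of_nat]) (auto intro!: always_eventually less_imp_le ep simp del: of_nat_Suc)
    let ?p = "p \<circ> \<sigma>" and ?e = "\<epsilon> \<circ> \<sigma>"
    have e1: "?e \<longlonglongrightarrow> 0" using LIMSEQ_subseq_LIMSEQ[OF e0 p0(2)] .
    have "\<And>n. ?p n \<in> frontier \<Omega>" "\<And>n. ?e n > 0" using ep by auto
    note sl = shift_limits[OF this(1) p0(3,1) this(2) e1]
    have "\<forall>\<^sub>F n in sequentially. shift (?e n) (?p n) \<in> Ue"
      using topological_tendstoD[OF sl(2) Ue(1)] p0(1) Ue(2) by blast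
    moreover have "\<forall>\<^sub>F n in sequentially. 0 < - \<rho> (shift (?e n) (?p n)) / ?e n"
      by (rule order_tendstoD(1)[OF sl(3) slope_pos[OF p0(1)]])
    ultimately have "\<forall>\<^sub>F n in sequentially. ?p n \<in> shift_dom (?e n)"
    proof eventually_elim
      case (elim n)
      have "\<rho> (shift (?e n) (?p n)) < 0" using elim(2) ep(1)[of "\<sigma> n"] by (simp add: divide_less_0_iff)
      then have "shift (?e n) (?p n) \<in> \<Omega>" using \<rho>_neg_iff elim(1) Ue by blast
      then show ?case using elim(1) in_U[OF ep(3)[of "\<sigma> n"]] by (simp add: shift_dom_def)
    qed
    then obtain n where "?p n \<in> shift_dom (?e n)" using eventually_happens'[OF sequentially_bot] by blast
    then show False using ep(4) by simp
  qed
  then obtain n where "\<And>\<epsilon>. 0 < \<epsilon> \<Longrightarrow> \<epsilon> < inverse (real (Suc n)) \<Longrightarrow> frontier \<Omega> \<subseteq> shift_dom \<epsilon>" by blast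
  then show ?thesis using that[of "inverse (real (Suc n))"] by simp
qed

text \<open>The Hessian of \<open>shifted_log\<close> contributes the term \<open>levi_re \<rho> q \<tau> / (- \<rho> q)\<close>, which need not stay bounded. It
  cancels against the Levi form of \<open>- (- \<rho>)\<^sup>\<eta>\<close> at \<open>q\<close>, tested on the vector that minimises the limit.\<close>

lemma limit_inequality:
  assumes p: "\<And>n. p n \<in> frontier \<Omega>" "p \<longlonglongrightarrow> p0" "p0 \<in> frontier \<Omega>" and e: "\<And>n. \<epsilon> n > 0" "\<epsilon> \<longlonglongrightarrow> 0"
    and \<tau>: "\<And>n. N (p n) \<bullet> \<tau> n = 0" "\<And>n. N (p n) \<bullet> J (\<tau> n) = 0" "\<tau> \<longlonglongrightarrow> \<tau>0"
    and dm: "\<And>n. p n \<in> shift_dom (\<epsilon> n)"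
  obtains err where "err \<longlonglongrightarrow> 0"
    "\<And>n. err n \<le> bd_rhs (shifted_log (\<epsilon> n)) (p n) (\<tau> n) - \<eta> / (1 - \<eta>) * bd_lhs (shifted_log (\<epsilon> n)) (p n) (\<tau> n)"
proof -
  define q where "q n = shift (\<epsilon> n) (p n)" for n
  define H where "H n = FD N (p n)" for n
  define m where "m n = FD \<rho> (q n)" for n
  define B where "B n = D2 \<rho> (q n)" for n
  \<comment> \<open>The rescaled quantities have finite limits: \<open>S\<close> tends to the slope,
    \<open>M1\<close> and \<open>M2\<close> to mixed second derivatives of \<rho>.\<close>
  define S where "S n = - \<rho> (q n) / \<epsilon> n" for n
  define M1 where "M1 n = m n (\<tau> n) / \<epsilon> n" for n
  define M2 where "M2 n = m n (J (\<tau> n)) / \<epsilon> n" for n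
  define f1 where "f1 n = (M1 n - m n (H n (\<tau> n))) / S n" for n
  define f2 where "f2 n = (M2 n - m n (H n (J (\<tau> n)))) / S n" for n
  define y1 where "y1 n = theta1 (p n) (\<tau> n)" for n
  define y2 where "y2 n = theta2 (p n) (\<tau> n)" for n
  \<comment> \<open>With this choice f1 + a = -(y2 - f1) / (1 - \<eta>) and f2 - b = (y1 + f2) / (1
    - \<eta>), the stationary point of the limiting polynomial. It is formed from the quantities at
    stage n, which converge.\<close>
  define a where "a n = - (y2 n - f1 n) / (1 - \<eta>) - f1 n" for n
  define b where "b n = - (y1 n + f2 n) / (1 - \<eta>) + f2 n" for n
  define w where "w n = a n *\<^sub>R N (p n) + b n *\<^sub>R J (N (p n))" for n
  \<comment> \<open>\<open>X\<close> and \<open>Y\<close> collect what is left of two Hessian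
    expressions after the term B(t, t) / (\<epsilon> S) has been split off: \<open>X\<close> for
    \<open>shifted_log\<close>, \<open>Y\<close> for \<rho> on the test vector t + \<epsilon>
    x.\<close>
  define X where "X n t = - B n t (H n t) - B n (H n t) t + \<epsilon> n * B n (H n t) (H n t) - m n (D2 N (p n) t t)" for n t
  define Y where "Y n t x = B n t x + B n x t + \<epsilon> n * B n x x" for n t x
  define err where "err n = (f1 n)\<^sup>2 + (f2 n)\<^sup>2 + (X n (\<tau> n) + X n (J (\<tau> n))) / S n
     - (Y n (\<tau> n) (w n) + Y n (J (\<tau> n)) (J (w n))) / S n
     - (1 - \<eta>) * (((M1 n + m n (w n)) / S n)\<^sup>2 + ((M2 n + m n (J (w n))) / S n)\<^sup>2)
     + (norm (H n (\<tau> n)))\<^sup>2 + (norm (H n (J (\<tau> n))))\<^sup>2 - (y1 n)\<^sup>2 - (y2 n)\<^sup>2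
     - \<eta> / (1 - \<eta>) * ((f1 n - y2 n)\<^sup>2 + (f2 n + y1 n)\<^sup>2)" for n
  have qW: "q n \<in> W" and q_in: "q n \<in> Ue" "q n \<in> \<Omega>" for n
    using dm[of n] Ue by (auto simp: shift_dom_def q_def)
  have Spos: "S n > 0" and \<sigma>: "- \<rho> (q n) = \<epsilon> n * S n" for n
    using \<rho>_shift_neg[OF dm[of n]] e(1)[of n] by (simp_all add: S_def q_def divide_neg_pos)
  have bound: "err n \<le> bd_rhs (shifted_log (\<epsilon> n)) (p n) (\<tau> n) - \<eta> / (1 - \<eta>) * bd_lhs (shifted_log (\<epsilon> n)) (p n) (\<tau> n)" for n
  proof -
    let ?t = "\<tau> n" and ?e = "\<epsilon> n" and ?S = "S n" and ?w = "w n"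
    have nz: "?e \<noteq> 0" "?S \<noteq> 0" using e(1)[of n] Spos[of n] by auto
    have F1: "FD (shifted_log ?e) (p n) ?t = f1 n" 
      unfolding shifted_log_derivatives(1)[OF dm] q_def[symmetric] \<sigma> m_def[symmetric] H_def[symmetric] f1_def M1_def
      using nz by (simp add: field_simps)
    have F2: "FD (shifted_log ?e) (p n) (J ?t) = f2 n" 
      unfolding shifted_log_derivatives(1)[OF dm] q_def[symmetric] \<sigma> m_def[symmetric] H_def[symmetric] f2_def M2_def
      using nz by (simp add: field_simps)
    have Dphi: "D2 (shifted_log ?e) (p n) t t = (FD (shifted_log ?e) (p n) t)\<^sup>2 + B n t t / (?e * ?S) + X n t / ?S" for t
      unfolding shifted_log_derivatives[OF dm] q_def[symmetric] \<sigma> m_def[symmetric] H_def[symmetric] B_def[symmetric] X_def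
      using nz by (simp add: power2_eq_square field_simps)
    have bd_rhs: "bd_rhs (shifted_log ?e) (p n) ?t = (f1 n)\<^sup>2 + (f2 n)\<^sup>2 + (B n ?t ?t + B n (J ?t) (J ?t)) / (?e * ?S) + (X n ?t + X n (J ?t)) / ?S
      + (norm (H n ?t))\<^sup>2 + (norm (H n (J ?t)))\<^sup>2 - (y1 n)\<^sup>2 - (y2 n)\<^sup>2"
      unfolding bd_rhs_def levi_re_def Dphi F1 F2 H_def[symmetric] y1_def y2_def by (simp add: add_divide_distrib)
    have bd_lhs: "bd_lhs (shifted_log ?e) (p n) ?t = (f1 n - y2 n)\<^sup>2 + (f2 n + y1 n)\<^sup>2"
      by (simp add: bd_lhs_def F1 F2 y1_def y2_def)
    note lin = linear_add[OF linear_FD_\<rho>[OF qW]] linear_scale[OF linear_FD_\<rho>[OF qW]]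
      linear_add[OF D2_linear_right[OF C2_\<rho> qW]] linear_scale[OF D2_linear_right[OF C2_\<rho> qW]]
      linear_add[OF D2_linear_left[OF W(1) C2_\<rho> qW]] linear_scale[OF D2_linear_left[OF W(1) C2_\<rho> qW]]
    have Bv: "B n (t + ?e *\<^sub>R x) (t + ?e *\<^sub>R x) / (?e * ?S) = B n t t / (?e * ?S) + Y n t x / ?S" for t x
      unfolding Y_def using nz by (simp add: B_def lin field_simps)
    have mv: "(m n (t + ?e *\<^sub>R x))\<^sup>2 / (?e * ?S)\<^sup>2 = ((m n t / ?e + m n x) / ?S)\<^sup>2" for t x
      using nz by (simp add: m_def lin power2_eq_square field_simps)
    \<comment> \<open>A lower bound for the possibly unbounded term of \<open>bd_rhs\<close>.
      Inserting it into \<open>bd_rhs\<close> minus the weighted \<open>bd_lhs\<close> produces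
      \<open>err\<close>.\<close>
    have "0 \<le> levi_re \<rho> (q n) (?t + ?e *\<^sub>R ?w) / (?e * ?S) + (1 - \<eta>) * grad_sq \<rho> (q n) (?t + ?e *\<^sub>R ?w) / (?e * ?S)\<^sup>2"
      using levi_\<rho>[OF q_in, of n "?t + ?e *\<^sub>R ?w"] \<sigma>[of n] by (metis power2_minus)
    also have "levi_re \<rho> (q n) (?t + ?e *\<^sub>R ?w) / (?e * ?S) = (B n ?t ?t + B n (J ?t) (J ?t)) / (?e * ?S) + (Y n ?t ?w + Y n (J ?t) (J ?w)) / ?S"
      unfolding levi_re_def B_def[symmetric] J_add J_scaleR add_divide_distrib Bv by simp
    also have "(1 - \<eta>) * grad_sq \<rho> (q n) (?t + ?e *\<^sub>R ?w) / (?e * ?S)\<^sup>2 = (1 - \<eta>) * (((M1 n + m n ?w) / ?S)\<^sup>2 + ((M2 n + m n (J ?w)) / ?S)\<^sup>2)"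
      unfolding grad_sq_def m_def[symmetric] J_add J_scaleR times_divide_eq_right[symmetric] add_divide_distrib mv M1_def M2_def by simp
    finally show ?thesis unfolding err_def bd_rhs bd_lhs by linarith
  qed
  have p0W: "p0 \<in> W" and p0U: "p0 \<in> U" using p(3) in_W in_U by auto
  note sl = shift_limits[OF p e]
  have lN: "(\<lambda>n. N (p n)) \<longlonglongrightarrow> N p0" by (rule sl(1))
  have lq: "q \<longlonglongrightarrow> p0" using sl(2) by (simp add: q_def[abs_def])
  have lS: "S \<longlonglongrightarrow> slope p0" using sl(3) by (simp add: S_def[abs_def] q_def)
  have lM1: "M1 \<longlonglongrightarrow> - D2 \<rho> p0 \<tau>0 (N p0)"
    using sl(4)[OF \<tau>(1,3)] by (simp add: M1_def[abs_def] m_def q_def)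
  have lJ: "(\<lambda>n. J (\<tau> n)) \<longlonglongrightarrow> J \<tau>0" by (intro tendsto_intros \<tau>)
  have lM2: "M2 \<longlonglongrightarrow> - D2 \<rho> p0 (J \<tau>0) (N p0)"
    using sl(4)[OF \<tau>(2) lJ] by (simp add: M2_def[abs_def] m_def q_def)
  have one2: "(1::nat) \<le> 2" by simp
  have lm: "(\<lambda>n. m n (v n)) \<longlonglongrightarrow> slope p0 * (N p0 \<bullet> v0)" if "v \<longlonglongrightarrow> v0" for v v0
    using FD_tendsto[OF W(1) C2_\<rho> one2 p0W lq that] by (simp add: m_def FD_\<rho>[OF p(3)])
  have lB: "(\<lambda>n. B n (v n) (x n)) \<longlonglongrightarrow> D2 \<rho> p0 v0 x0" if "v \<longlonglongrightarrow> v0" "x \<longlonglongrightarrow> x0" for v v0 x x0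
    using D2_tendsto[OF W(1) C2_\<rho> p0W lq that] by (simp add: B_def)
  have lH: "(\<lambda>n. H n (v n)) \<longlonglongrightarrow> FD N p0 v0" if "v \<longlonglongrightarrow> v0" for v v0
    using FD_tendsto[OF open_U C2_N one2 p0U p(2) that] by (simp add: H_def)
  have lDN: "(\<lambda>n. D2 N (p n) (v n) (v n)) \<longlonglongrightarrow> D2 N p0 v0 v0" if "v \<longlonglongrightarrow> v0" for v v0
    by (rule D2_tendsto[OF open_U C2_N p0U p(2) that that])
  have tg: "N p0 \<bullet> \<tau>0 = 0" "N p0 \<bullet> J \<tau>0 = 0"
  proof -
    have "(\<lambda>n. N (p n) \<bullet> \<tau> n) \<longlonglongrightarrow> N p0 \<bullet> \<tau>0" "(\<lambda>n. N (p n) \<bullet> J (\<tau> n)) \<longlonglongrightarrow> N p0 \<bullet> J \<tau>0"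
      by (intro tendsto_intros lN \<tau> lJ)+
    then show "N p0 \<bullet> \<tau>0 = 0" "N p0 \<bullet> J \<tau>0 = 0" using \<tau> by (simp_all add: LIMSEQ_const_iff)
  qed
  define c0 where "c0 = slope p0"
  have c0: "c0 > 0" using slope_pos[OF p(3)] by (simp add: c0_def)
  define h1 where "h1 = FD N p0 \<tau>0"
  define h2 where "h2 = FD N p0 (J \<tau>0)"
  define F1 where "F1 = - D2 \<rho> p0 \<tau>0 (N p0) / c0"
  define F2 where "F2 = - D2 \<rho> p0 (J \<tau>0) (N p0) / c0"
  define Y1 where "Y1 = h1 \<bullet> J (N p0)"
  define Y2 where "Y2 = h2 \<bullet> J (N p0)"
  define A where "A = - (Y2 - F1) / (1 - \<eta>) - F1"
  define D where "D = - (Y1 + F2) / (1 - \<eta>) + F2"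
  define w0 where "w0 = A *\<^sub>R N p0 + D *\<^sub>R J (N p0)"
  have NH: "N p0 \<bullet> FD N p0 v = 0" for v using inner_FD_N_N[OF p0U, of v] by (simp add: inner_commute)
  have NN: "N p0 \<bullet> N p0 = 1" by (rule inner_N_self[OF p0U])
  have ly1: "y1 \<longlonglongrightarrow> Y1" and ly2: "y2 \<longlonglongrightarrow> Y2"
    unfolding y1_def[abs_def] y2_def[abs_def] Y1_def Y2_def h1_def h2_def
    by (intro tendsto_intros FD_tendsto[OF open_U C2_N one2 p0U p(2)] \<tau> lJ lN)+
  have "f1 \<longlonglongrightarrow> (- D2 \<rho> p0 \<tau>0 (N p0) - slope p0 * (N p0 \<bullet> FD N p0 \<tau>0)) / slope p0"
    unfolding f1_def[abs_def] using c0 by (intro tendsto_intros lM1 lm lH \<tau> lS) (simp add: c0_def)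
  then have lf1: "f1 \<longlonglongrightarrow> F1" by (simp add: NH F1_def c0_def)
  have "f2 \<longlonglongrightarrow> (- D2 \<rho> p0 (J \<tau>0) (N p0) - slope p0 * (N p0 \<bullet> FD N p0 (J \<tau>0))) / slope p0"
    unfolding f2_def[abs_def] using c0 by (intro tendsto_intros lM2 lm lH lJ lS) (simp add: c0_def)
  then have lf2: "f2 \<longlonglongrightarrow> F2" by (simp add: NH F2_def c0_def)
  have la: "a \<longlonglongrightarrow> A" and lb: "b \<longlonglongrightarrow> D"
    unfolding a_def[abs_def] b_def[abs_def] A_def D_def using \<eta> by (intro tendsto_intros ly1 ly2 lf1 lf2; simp)+
  have lw: "w \<longlonglongrightarrow> w0" unfolding w_def[abs_def] w0_def by (intro tendsto_intros la lb lN)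
  have lJw: "(\<lambda>n. J (w n)) \<longlonglongrightarrow> J w0" by (intro tendsto_intros lw)
  \<comment> \<open>The two mixed terms contribute -2 c0 |H v|^2 and the second derivative of
    \<open>N\<close> gives back c0 |H v|^2 by \<open>D2_N_N\<close>. After division by the slope the
    total cancels the squared Hessian in \<open>bd_rhs\<close>.\<close>
  have lX: "(\<lambda>n. X n (v n)) \<longlonglongrightarrow> - c0 * (norm (FD N p0 v0))\<^sup>2" if v: "v \<longlonglongrightarrow> v0" and t0: "N p0 \<bullet> v0 = 0" for v v0
  proof -
    have "(\<lambda>n. X n (v n)) \<longlonglongrightarrow> - D2 \<rho> p0 v0 (FD N p0 v0) - D2 \<rho> p0 (FD N p0 v0) v0 + 0 * D2 \<rho> p0 (FD N p0 v0) (FD N p0 v0) - slope p0 * (N p0 \<bullet> D2 N p0 v0 v0)"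
      unfolding X_def by (intro tendsto_intros lB lH lm lDN v e(2))
    moreover have "D2 \<rho> p0 (FD N p0 v0) v0 = c0 * (norm (FD N p0 v0))\<^sup>2"
      using D2_\<rho>[OF p(3) NH t0] by (simp add: c0_def power2_norm_eq_inner)
    moreover have "D2 \<rho> p0 v0 (FD N p0 v0) = D2 \<rho> p0 (FD N p0 v0) v0" by (rule D2_symmetric[OF W(1) C2_\<rho> p0W])
    moreover have "N p0 \<bullet> D2 N p0 v0 v0 = - (norm (FD N p0 v0))\<^sup>2"
      using D2_N_N[OF p0U] by (simp add: inner_commute)
    ultimately show ?thesis by (simp add: c0_def)
  qed
  have lY: "(\<lambda>n. Y n (v n) (x n)) \<longlonglongrightarrow> 2 * D2 \<rho> p0 v0 x0" if v: "v \<longlonglongrightarrow> v0" and x: "x \<longlonglongrightarrow> x0" for v v0 x x0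
  proof -
    have "(\<lambda>n. Y n (v n) (x n)) \<longlonglongrightarrow> D2 \<rho> p0 v0 x0 + D2 \<rho> p0 x0 v0 + 0 * D2 \<rho> p0 x0 x0"
      unfolding Y_def by (intro tendsto_intros lB v x e(2))
    then show ?thesis using D2_symmetric[OF W(1) C2_\<rho> p0W, of v0 x0] by simp
  qed
  have "err \<longlonglongrightarrow> F1\<^sup>2 + F2\<^sup>2 + (- c0 * (norm h1)\<^sup>2 + - c0 * (norm h2)\<^sup>2) / c0
     - (2 * D2 \<rho> p0 \<tau>0 w0 + 2 * D2 \<rho> p0 (J \<tau>0) (J w0)) / c0
     - (1 - \<eta>) * (((- D2 \<rho> p0 \<tau>0 (N p0) + c0 * (N p0 \<bullet> w0)) / c0)\<^sup>2 + ((- D2 \<rho> p0 (J \<tau>0) (N p0) + c0 * (N p0 \<bullet> J w0)) / c0)\<^sup>2)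
     + (norm h1)\<^sup>2 + (norm h2)\<^sup>2 - Y1\<^sup>2 - Y2\<^sup>2
     - \<eta> / (1 - \<eta>) * ((F1 - Y2)\<^sup>2 + (F2 + Y1)\<^sup>2)" (is "_ \<longlonglongrightarrow> ?L")
    unfolding err_def[abs_def] h1_def h2_def
    using c0 unfolding c0_def
    by (intro tendsto_intros lf1 lf2 ly1 ly2 lX[unfolded c0_def] lY lS lM1 lM2 lm lH \<tau> lJ lw lJw tg) auto
  \<comment> \<open>Here the choice of \<open>a\<close> and \<open>b\<close> pays off: the
    polynomial is strictly convex, and any other limit of (a, b) would leave a negative
    value.\<close>
  moreover have "?L = 0"
  proof -
    have w: "N p0 \<bullet> w0 = A" "N p0 \<bullet> J w0 = - D"
      using NN by (simp_all add: w0_def inner_add_right inner_diff_right)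
    note lin = linear_add[OF D2_linear_right[OF C2_\<rho> p0W]] linear_diff[OF D2_linear_right[OF C2_\<rho> p0W]] linear_scale[OF D2_linear_right[OF C2_\<rho> p0W]]
    have t: "D2 \<rho> p0 \<tau>0 (N p0) = - c0 * F1" "D2 \<rho> p0 (J \<tau>0) (N p0) = - c0 * F2"
      using c0 by (simp_all add: F1_def F2_def)
    have JN: "N p0 \<bullet> J (N p0) = 0" by simp
    have j1: "D2 \<rho> p0 \<tau>0 (J (N p0)) = c0 * Y1"
      using D2_\<rho>[OF p(3) JN tg(1)] D2_symmetric[OF W(1) C2_\<rho> p0W, of "J (N p0)" \<tau>0]
      by (simp add: c0_def Y1_def h1_def)
    have j2: "D2 \<rho> p0 (J \<tau>0) (J (N p0)) = c0 * Y2"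
      using D2_\<rho>[OF p(3) JN tg(2)] D2_symmetric[OF W(1) C2_\<rho> p0W, of "J (N p0)" "J \<tau>0"]
      by (simp add: c0_def Y2_def h2_def)
    have b1: "D2 \<rho> p0 \<tau>0 w0 = c0 * (- A * F1 + D * Y1)"
      by (simp add: w0_def lin t j1 algebra_simps)
    have b2: "D2 \<rho> p0 (J \<tau>0) (J w0) = c0 * (A * Y2 + D * F2)"
      by (simp add: w0_def lin t j2 algebra_simps)
    have e1: "(- c0 * (norm h1)\<^sup>2 + - c0 * (norm h2)\<^sup>2) / c0 = - (norm h1)\<^sup>2 - (norm h2)\<^sup>2"
      using c0 by (simp add: field_simps)
    have e2: "(2 * (c0 * (- A * F1 + D * Y1)) + 2 * (c0 * (A * Y2 + D * F2))) / c0 = 2 * (A * (Y2 - F1) + D * (Y1 + F2))"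
      using c0 by (simp add: field_simps)
    have e3: "(- (- c0 * F1) + c0 * A) / c0 = F1 + A" "(- (- c0 * F2) + c0 * (- D)) / c0 = F2 - D"
      using c0 by (simp_all add: field_simps)
    define k where "k = 1 - \<eta>"
    have k: "k \<noteq> 0" "\<eta> = 1 - k" using \<eta> by (auto simp: k_def)
    show ?thesis
      unfolding w t b1 b2 e1 e2 e3 unfolding A_def D_def unfolding k(2) using k(1)
      by (simp add: power2_eq_square field_simps)
  qed
  ultimately have "err \<longlonglongrightarrow> 0" by simp
  then show ?thesis using that bound by blast
qed

text \<open>A compactness argument makes \<open>limit_inequality\<close> uniform over boundary
  points and unit tangent vectors. That statement is asymptotic in \<epsilon>, so a fixed \<epsilon>
  retains an error \<open>e\<close>.\<close>

lemma boundary_inequality_approx: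
  assumes e: "e > 0"
  obtains \<epsilon> where "frontier \<Omega> \<subseteq> shift_dom \<epsilon>"
    "\<And>p \<tau>. p \<in> frontier \<Omega> \<Longrightarrow> N p \<bullet> \<tau> = 0 \<Longrightarrow> N p \<bullet> J \<tau> = 0 \<Longrightarrow> norm \<tau> = 1 \<Longrightarrow>
      \<eta> / (1 - \<eta>) * bd_lhs (shifted_log \<epsilon>) p \<tau> - bd_rhs (shifted_log \<epsilon>) p \<tau> \<le> e"
proof -
  obtain e0 where e0: "e0 > 0" "\<And>\<epsilon>. 0 < \<epsilon> \<Longrightarrow> \<epsilon> < e0 \<Longrightarrow> frontier \<Omega> \<subseteq> shift_dom \<epsilon>" using shift_eventually_in by blast
  define \<epsilon> where "\<epsilon> n = e0 / 2 * inverse (real (Suc n))" for n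
  have \<epsilon>: "\<epsilon> n > 0" "\<epsilon> n < e0" for n
  proof -
    show "\<epsilon> n > 0" using e0 by (simp add: \<epsilon>_def)
    have "e0 / 2 * inverse (real (Suc n)) \<le> e0 / 2 * 1"
      using e0 by (intro mult_left_mono) (auto simp: inverse_le_1_iff)
    then show "\<epsilon> n < e0" using e0 unfolding \<epsilon>_def by linarith
  qed
  have \<epsilon>0: "\<epsilon> \<longlonglongrightarrow> 0" unfolding \<epsilon>_def[abs_def] by (intro tendsto_mult_right_zero LIMSEQ_inverse_real_of_nat)
  let ?bad = "\<lambda>n p \<tau>. p \<in> frontier \<Omega> \<and> N p \<bullet> \<tau> = 0 \<and> N p \<bullet> J \<tau> = 0 \<and> norm \<tau> = 1 \<and>
      \<not> \<eta> / (1 - \<eta>) * bd_lhs (shifted_log (\<epsilon> n)) p \<tau> - bd_rhs (shifted_log (\<epsilon> n)) p \<tau> \<le> e"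
  have "\<exists>n. \<forall>p \<tau>. \<not> ?bad n p \<tau>"
  proof (rule ccontr)
    assume "\<not> ?thesis"
    then have "\<forall>n. \<exists>p \<tau>. ?bad n p \<tau>" by blast
    then obtain p \<tau> where pt: "\<And>n. ?bad n (p n) (\<tau> n)" by metis
    have cpt: "compact (frontier \<Omega> \<times> sphere (0::complex^'n) 1)" by (intro compact_Times compact_frontier compact_sphere)
    have mem: "\<forall>n. (p n, \<tau> n) \<in> frontier \<Omega> \<times> sphere 0 1" using pt by simp
    obtain l \<sigma> where l: "l \<in> frontier \<Omega> \<times> sphere 0 1" "strict_mono \<sigma>" "((\<lambda>n. (p n, \<tau> n)) \<circ> \<sigma>) \<longlonglongrightarrow> l"
      by (rule seq_compactE[OF compact_imp_seq_compact[OF cpt] mem])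
    have lp: "(\<lambda>n. p (\<sigma> n)) \<longlonglongrightarrow> fst l" and lt: "(\<lambda>n. \<tau> (\<sigma> n)) \<longlonglongrightarrow> snd l"
      using tendsto_fst[OF l(3)] tendsto_snd[OF l(3)] by (simp_all add: o_def)
    have le: "(\<lambda>n. \<epsilon> (\<sigma> n)) \<longlonglongrightarrow> 0" using LIMSEQ_subseq_LIMSEQ[OF \<epsilon>0 l(2)] by (simp add: o_def)
    have pf: "p (\<sigma> n) \<in> frontier \<Omega>" "N (p (\<sigma> n)) \<bullet> \<tau> (\<sigma> n) = 0" "N (p (\<sigma> n)) \<bullet> J (\<tau> (\<sigma> n)) = 0" for n using pt by auto
    have dm: "p (\<sigma> n) \<in> shift_dom (\<epsilon> (\<sigma> n))" for n using e0(2)[OF \<epsilon>] pf by blast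
    have l1: "fst l \<in> frontier \<Omega>" using l(1) by (simp add: mem_Times_iff)
    obtain err where err: "err \<longlonglongrightarrow> 0" 
      "\<And>n. err n \<le> bd_rhs (shifted_log (\<epsilon> (\<sigma> n))) (p (\<sigma> n)) (\<tau> (\<sigma> n)) - \<eta> / (1 - \<eta>) * bd_lhs (shifted_log (\<epsilon> (\<sigma> n))) (p (\<sigma> n)) (\<tau> (\<sigma> n))"
      using limit_inequality[OF pf(1) lp l1 \<epsilon>(1) le pf(2,3) lt dm] by blast
    have "\<forall>\<^sub>F n in sequentially. - e < err n" using order_tendstoD(1)[OF err(1), of "- e"] e by simp
    then obtain n where "- e < err n" using eventually_happens'[OF sequentially_bot] by blast
    then show False using err(2)[of n] pt[of "\<sigma> n"] by linarith
  qed
  then obtain n where n: "\<And>p \<tau>. \<not> ?bad n p \<tau>" by blast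
  show ?thesis
    by (rule that[of "\<epsilon> n"]) (use e0(2)[OF \<epsilon>] n in blast)+
qed

end

section \<open>Replacement by a smooth function\<close>

context normal_field
begin

lemma bd_lhs_scale: "open S \<Longrightarrow> Cn_on 2 S g \<Longrightarrow> p \<in> S \<Longrightarrow> p \<in> U \<Longrightarrow> bd_lhs g p (t *\<^sub>R \<tau>) = t\<^sup>2 * bd_lhs g p \<tau>"
  using linear_scale[OF FD_linear[of 2 S g p]] linear_scale[OF linear_FD_N[of p]]
  by (simp add: bd_lhs_def power2_eq_square algebra_simps)

lemma bd_rhs_scale: "open S \<Longrightarrow> Cn_on 2 S g \<Longrightarrow> p \<in> S \<Longrightarrow> p \<in> U \<Longrightarrow> bd_rhs g p (t *\<^sub>R \<tau>) = t\<^sup>2 * bd_rhs g p \<tau>"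
  using linear_scale[OF D2_linear_left[of S g p]] linear_scale[OF D2_linear_right[of S g p]] linear_scale[OF linear_FD_N[of p]]
  by (simp add: bd_rhs_def levi_re_def power2_eq_square power2_norm_eq_inner algebra_simps)

text \<open>The inequality sees only first and second derivatives on the boundary, so the function
  can be cut off in a collar, extended by zero and approximated in C^2. Strictness on unit vectors
  survives by compactness, and homogeneity then covers all nonzero vectors.\<close>

lemma smooth_replacement:
  fixes f :: "complex^'n \<Rightarrow> real"
  assumes S: "open S" "frontier \<Omega> \<subseteq> S" and f: "Cn_on 2 S f" and k: "\<kappa> > 0"
    and ineq: "\<And>p \<tau>. p \<in> frontier \<Omega> \<Longrightarrow> N p \<bullet> \<tau> = 0 \<Longrightarrow> N p \<bullet> J \<tau> = 0 \<Longrightarrow> norm \<tau> = 1 \<Longrightarrow> a * bd_lhs f p \<tau> + \<kappa> \<le> bd_rhs f p \<tau>"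
  obtains g where "\<And>m. Cn_on m UNIV g"
    "\<And>p \<tau>. p \<in> frontier \<Omega> \<Longrightarrow> N p \<bullet> \<tau> = 0 \<Longrightarrow> N p \<bullet> J \<tau> = 0 \<Longrightarrow> \<tau> \<noteq> 0 \<Longrightarrow> a * bd_lhs g p \<tau> < bd_rhs g p \<tau>"
proof -
  have "open (S \<inter> U)" "frontier \<Omega> \<subseteq> S \<inter> U" using S open_U frontier_sub by auto
  from compact_in_open_separated[OF frontier_ne compact_frontier this] 
  obtain d where d: "d > 0" "{z. infdist z (frontier \<Omega>) \<le> d} \<subseteq> S \<inter> U" by blast
  \<comment> \<open>Strictly between 0 and \<open>d\<close>: the regions where
    \<open>infdist\<close> is below \<open>d\<close> and where it is above \<open>d2\<close> cover
    the space, and on the second one the cutoff vanishes.\<close>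
  define d2 where "d2 = d / 2"
  have d2: "0 < d2" "d2 < d" using d by (auto simp: d2_def)
  obtain \<theta> :: "real \<Rightarrow> real" where \<theta>: "Cn_on 2 UNIV \<theta>" "\<And>t. \<bar>t\<bar> \<le> d2 / 2 \<Longrightarrow> \<theta> t = 1" "\<And>t. d2 \<le> \<bar>t\<bar> \<Longrightarrow> \<theta> t = 0"
    using cutoff_exists[OF d2(1)] by metis
  define F where "F z = \<theta> (sdist \<Omega> z) * f z" for z
  have oI: "open {z. infdist z (frontier \<Omega>) < r}" and oJ: "open {z. r < infdist z (frontier \<Omega>)}" for r
    by (intro open_Collect_less continuous_intros)+
  have CF: "Cn_on 2 UNIV F"
  proof (rule Cn_on_localI)
    fix z :: "complex^'n"
    show "\<exists>T. open T \<and> z \<in> T \<and> Cn_on 2 T F"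
    proof (cases "infdist z (frontier \<Omega>) < d")
      case True
      let ?T = "{z. infdist z (frontier \<Omega>) < d}"
      have sub: "?T \<subseteq> S" "?T \<subseteq> U" using d by auto
      have "Cn_on 2 ?T (\<lambda>z. \<theta> (sdist \<Omega> z))"
        by (rule Cn_on_compose[OF oI open_UNIV _ Cn_on_subset[OF C2_sdist sub(2)] \<theta>(1)]) simp
      then have "Cn_on 2 ?T F"
        unfolding F_def[abs_def] by (intro Cn_on_mult oI Cn_on_subset[OF f sub(1)])
      then show ?thesis using True oI by (intro exI[of _ ?T]) simp
    next
      case False
      let ?T = "{z. d2 < infdist z (frontier \<Omega>)}"
      have "Cn_on 2 ?T F"
        by (rule Cn_on_transform[OF Cn_on_const[of _ _ 0] oJ]) (auto simp: F_def abs_sdist \<theta>(3))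
      then show ?thesis using False d2 oJ by (intro exI[of _ ?T]) simp
    qed
  qed
  have "compact {z. infdist z (frontier \<Omega>) \<le> d2}"
    by (rule compact_infdist_le[OF frontier_ne compact_frontier d2(1)])
  then obtain b where b: "{z. infdist z (frontier \<Omega>) \<le> d2} \<subseteq> cbox (- b) b"
    using bounded_subset_cbox_symmetric compact_imp_bounded by metis
  have zF: "F y = 0" if "y \<notin> cbox (- b) b" for y
  proof -
    have "\<not> infdist y (frontier \<Omega>) \<le> d2" using b that by auto
    then show ?thesis by (simp add: F_def abs_sdist \<theta>(3) not_le)
  qed
  let ?O = "{z. infdist z (frontier \<Omega>) < d2 / 2}"
  have Ff: "F z = f z" if "z \<in> ?O" for z using that by (simp add: F_def abs_sdist \<theta>(2))
  have fO: "p \<in> ?O" if "p \<in> frontier \<Omega>" for p using that d2 by simp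
  have FD_F: "FD F p = FD f p" and D2_F: "D2 F p = D2 f p" if "p \<in> frontier \<Omega>" for p
    by (rule FD_cong[OF oI fO[OF that]], erule Ff) (rule D2_cong[OF oI fO[OF that]], erule Ff)
  have "\<exists>g. (\<forall>m. Cn_on m UNIV g) \<and> (\<forall>x\<in>frontier \<Omega>. \<forall>v. \<bar>FD g x v - FD F x v\<bar> \<le> inverse (real (Suc n)) * norm v) \<and>
     (\<forall>x\<in>frontier \<Omega>. \<forall>v w. \<bar>D2 g x v w - D2 F x v w\<bar> \<le> inverse (real (Suc n)) * norm v * norm w)" for n
  proof -
    have pos: "0 < inverse (real (Suc n))" by simp
    obtain h where h: "\<And>m. Cn_on m UNIV h"
      "\<And>x v. x \<in> frontier \<Omega> \<Longrightarrow> \<bar>FD h x v - FD F x v\<bar> \<le> inverse (real (Suc n)) * norm v"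
      "\<And>x v w. x \<in> frontier \<Omega> \<Longrightarrow> \<bar>D2 h x v w - D2 F x v w\<bar> \<le> inverse (real (Suc n)) * norm v * norm w"
      using smooth_C2_approximation[OF CF zF compact_imp_bounded[OF compact_frontier] pos] by metis
    show ?thesis by (intro exI[of _ h] conjI allI ballI h)
  qed
  then obtain g where g: "\<And>n m. Cn_on m UNIV (g n)" 
    "\<And>n x v. x \<in> frontier \<Omega> \<Longrightarrow> \<bar>FD (g n) x v - FD F x v\<bar> \<le> inverse (real (Suc n)) * norm v"
    "\<And>n x v w. x \<in> frontier \<Omega> \<Longrightarrow> \<bar>D2 (g n) x v w - D2 F x v w\<bar> \<le> inverse (real (Suc n)) * norm v * norm w" by metis
  let ?bad = "\<lambda>n p \<tau>. p \<in> frontier \<Omega> \<and> N p \<bullet> \<tau> = 0 \<and> N p \<bullet> J \<tau> = 0 \<and> norm \<tau> = 1 \<and> \<not> a * bd_lhs (g n) p \<tau> < bd_rhs (g n) p \<tau>"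
  have "\<exists>n. \<forall>p \<tau>. \<not> ?bad n p \<tau>"
  proof (rule ccontr)
    assume "\<not> ?thesis"
    then have "\<forall>n. \<exists>p \<tau>. ?bad n p \<tau>" by blast
    then obtain p \<tau> where pt: "\<And>n. ?bad n (p n) (\<tau> n)" by metis
    have cpt: "compact (frontier \<Omega> \<times> sphere (0::complex^'n) 1)" by (intro compact_Times compact_frontier compact_sphere)
    have mem: "\<forall>n. (p n, \<tau> n) \<in> frontier \<Omega> \<times> sphere 0 1" using pt by simp
    obtain l \<sigma> where l: "l \<in> frontier \<Omega> \<times> sphere 0 1" "strict_mono \<sigma>" "((\<lambda>n. (p n, \<tau> n)) \<circ> \<sigma>) \<longlonglongrightarrow> l"
      by (rule seq_compactE[OF compact_imp_seq_compact[OF cpt] mem])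
    define p0 where "p0 = fst l"
    define t0 where "t0 = snd l"
    have lp: "(\<lambda>n. p (\<sigma> n)) \<longlonglongrightarrow> p0" and lt: "(\<lambda>n. \<tau> (\<sigma> n)) \<longlonglongrightarrow> t0"
      using tendsto_fst[OF l(3)] tendsto_snd[OF l(3)] by (simp_all add: o_def p0_def t0_def)
    have p0: "p0 \<in> frontier \<Omega>" "norm t0 = 1" using l(1) by (auto simp: mem_Times_iff p0_def t0_def)
    have p0U: "p0 \<in> U" by (rule in_U[OF p0(1)])
    have pf: "p (\<sigma> n) \<in> frontier \<Omega>" "N (p (\<sigma> n)) \<bullet> \<tau> (\<sigma> n) = 0" "N (p (\<sigma> n)) \<bullet> J (\<tau> (\<sigma> n)) = 0" "norm (\<tau> (\<sigma> n)) = 1" for n using pt by auto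
    have lN: "(\<lambda>n. N (p (\<sigma> n))) \<longlonglongrightarrow> N p0"
      by (rule continuous_on_tendsto_compose[OF Cn_on_continuous[OF C2_N] lp p0U]) (use pf in_U in auto)
    have lJ: "(\<lambda>n. J (\<tau> (\<sigma> n))) \<longlonglongrightarrow> J t0" by (intro tendsto_intros lt)
    have tg: "N p0 \<bullet> t0 = 0" "N p0 \<bullet> J t0 = 0"
    proof -
      have "(\<lambda>n. N (p (\<sigma> n)) \<bullet> \<tau> (\<sigma> n)) \<longlonglongrightarrow> N p0 \<bullet> t0" "(\<lambda>n. N (p (\<sigma> n)) \<bullet> J (\<tau> (\<sigma> n))) \<longlonglongrightarrow> N p0 \<bullet> J t0"
        by (intro tendsto_intros lN lt lJ)+
      then show "N p0 \<bullet> t0 = 0" "N p0 \<bullet> J t0 = 0" using pf by (simp_all add: LIMSEQ_const_iff)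
    qed
    have one2: "(1::nat) \<le> 2" by simp
    have i0: "(\<lambda>n. inverse (real (Suc (\<sigma> n)))) \<longlonglongrightarrow> 0"
      using LIMSEQ_subseq_LIMSEQ[OF LIMSEQ_inverse_real_of_nat l(2)] by (simp add: o_def)
    have lF: "(\<lambda>n. FD (g (\<sigma> n)) (p (\<sigma> n)) (v n)) \<longlonglongrightarrow> FD F p0 v0" if v: "v \<longlonglongrightarrow> v0" "\<And>n. norm (v n) = 1" for v v0
    proof -
      have "(\<lambda>n. FD (g (\<sigma> n)) (p (\<sigma> n)) (v n) - FD F (p (\<sigma> n)) (v n)) \<longlonglongrightarrow> 0"
      proof (rule Lim_null_comparison[OF always_eventually[OF allI] i0])
        show "norm (FD (g (\<sigma> n)) (p (\<sigma> n)) (v n) - FD F (p (\<sigma> n)) (v n)) \<le> inverse (real (Suc (\<sigma> n)))" for n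
          using g(2)[OF pf(1)[of n], of "\<sigma> n" "v n"] v(2)[of n] by simp
      qed
      from tendsto_add[OF this FD_tendsto[OF open_UNIV CF one2 UNIV_I lp v(1)]] show ?thesis by simp
    qed
    have lD: "(\<lambda>n. D2 (g (\<sigma> n)) (p (\<sigma> n)) (v n) (v n)) \<longlonglongrightarrow> D2 F p0 v0 v0" if v: "v \<longlonglongrightarrow> v0" "\<And>n. norm (v n) = 1" for v v0
    proof -
      have "(\<lambda>n. D2 (g (\<sigma> n)) (p (\<sigma> n)) (v n) (v n) - D2 F (p (\<sigma> n)) (v n) (v n)) \<longlonglongrightarrow> 0"
      proof (rule Lim_null_comparison[OF always_eventually[OF allI] i0])
        show "norm (D2 (g (\<sigma> n)) (p (\<sigma> n)) (v n) (v n) - D2 F (p (\<sigma> n)) (v n) (v n)) \<le> inverse (real (Suc (\<sigma> n)))" for n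
          using g(3)[OF pf(1)[of n], of "\<sigma> n" "v n" "v n"] v(2)[of n] by simp
      qed
      from tendsto_add[OF this D2_tendsto[OF open_UNIV CF UNIV_I lp v(1) v(1)]] show ?thesis by simp
    qed
    have nJ: "norm (J (\<tau> (\<sigma> n))) = 1" for n using pf by simp
    note lH = FD_tendsto[OF open_U C2_N one2 p0U lp]
    have "(\<lambda>n. a * bd_lhs (g (\<sigma> n)) (p (\<sigma> n)) (\<tau> (\<sigma> n)) - bd_rhs (g (\<sigma> n)) (p (\<sigma> n)) (\<tau> (\<sigma> n))) \<longlonglongrightarrow> a * bd_lhs F p0 t0 - bd_rhs F p0 t0"
      unfolding bd_lhs_def bd_rhs_def levi_re_def
      by (intro tendsto_intros lF[OF lt pf(4)] lF[OF lJ nJ] lD[OF lt pf(4)] lD[OF lJ nJ] lH lt lJ lN)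
    then have "0 \<le> a * bd_lhs F p0 t0 - bd_rhs F p0 t0"
      by (rule LIMSEQ_le_const) (use pt in \<open>auto simp: not_less\<close>)
    moreover have "a * bd_lhs F p0 t0 + \<kappa> \<le> bd_rhs F p0 t0"
      using ineq[OF p0(1) tg p0(2)] by (simp add: bd_lhs_def bd_rhs_def levi_re_def FD_F[OF p0(1)] D2_F[OF p0(1)])
    ultimately show False using k by linarith
  qed
  then obtain n where n: "\<And>p \<tau>. \<not> ?bad n p \<tau>" by blast
  have n': "a * bd_lhs (g n) p \<tau> < bd_rhs (g n) p \<tau>" if "p \<in> frontier \<Omega>" "N p \<bullet> \<tau> = 0" "N p \<bullet> J \<tau> = 0" "\<tau> \<noteq> 0" for p \<tau>
  proof -
    have "norm \<tau> > 0" using that by simp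
    let ?t = "inverse (norm \<tau>)"
    have "a * bd_lhs (g n) p (?t *\<^sub>R \<tau>) < bd_rhs (g n) p (?t *\<^sub>R \<tau>)"
      using n[of p "?t *\<^sub>R \<tau>"] that by simp
    then have "?t\<^sup>2 * (a * bd_lhs (g n) p \<tau>) < ?t\<^sup>2 * bd_rhs (g n) p \<tau>"
      using bd_lhs_scale[OF open_UNIV g(1) UNIV_I in_U[OF that(1)]] bd_rhs_scale[OF open_UNIV g(1) UNIV_I in_U[OF that(1)]]
      by (simp add: algebra_simps)
    then show ?thesis using \<open>norm \<tau> > 0\<close> by (simp add: mult_less_cancel_left)
  qed
  show ?thesis by (rule that[of "g n"]) (use g(1) n' in auto)
qed

end

section \<open>The proposition\<close>

lemma ratio_less: "0 < s \<Longrightarrow> s < t \<Longrightarrow> t < 1 \<Longrightarrow> s / (1 - s) < t / (1 - t)" for s t :: real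
  by (simp add: field_simps)

section \<open>From a plurisubharmonic power to the boundary inequality\<close>

context boundary_psh
begin

theorem smooth_solution:
  assumes s: "0 < s" "s < \<eta>"
  obtains g where "\<And>m. Cn_on m UNIV g"
    "\<And>p \<tau>. (p, \<tau>) \<in> T10_boundary \<Omega> \<Longrightarrow> \<tau> \<noteq> 0 \<Longrightarrow> ineq_lhs \<Omega> s g p \<tau> < ineq_rhs \<Omega> g p \<tau>"
proof -
  have r: "0 \<le> s / (1 - s)" "s / (1 - s) < \<eta> / (1 - \<eta>)" using s \<eta> ratio_less[of s \<eta>] by auto
  obtain \<kappa> where k: "0 < \<kappa>" and kp: "\<And>S (\<phi> :: complex^'n \<Rightarrow> real) p \<tau>. open S \<Longrightarrow> Cn_on 2 S \<phi> \<Longrightarrow> p \<in> S \<Longrightarrow> p \<in> frontier \<Omega> \<Longrightarrow>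
    s / (1 - s) * bd_lhs (\<lambda>z. \<phi> z + \<kappa> * (z \<bullet> z)) p \<tau> + 2 * \<kappa> * (norm \<tau>)\<^sup>2 - bd_rhs (\<lambda>z. \<phi> z + \<kappa> * (z \<bullet> z)) p \<tau>
      \<le> \<eta> / (1 - \<eta>) * bd_lhs \<phi> p \<tau> - bd_rhs \<phi> p \<tau>"
    by (rule strict_perturbation[OF r]) blast
  \<comment> \<open>The tolerance is the \<kappa> just obtained: on unit vectors the perturbation
    provides 2 \<kappa>, of which \<kappa> is spent here and \<kappa> remains for
    \<open>smooth_replacement\<close>.\<close>
  obtain \<epsilon> where dm: "frontier \<Omega> \<subseteq> shift_dom \<epsilon>" and ap: "\<And>p \<tau>. p \<in> frontier \<Omega> \<Longrightarrow> N p \<bullet> \<tau> = 0 \<Longrightarrow> N p \<bullet> J \<tau> = 0 \<Longrightarrow> norm \<tau> = 1 \<Longrightarrow>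
      \<eta> / (1 - \<eta>) * bd_lhs (shifted_log \<epsilon>) p \<tau> - bd_rhs (shifted_log \<epsilon>) p \<tau> \<le> \<kappa>"
    by (rule boundary_inequality_approx[OF k]) blast
  let ?f = "\<lambda>z. shifted_log \<epsilon> z + \<kappa> * (z \<bullet> z)"
  have Cf: "Cn_on 2 (shift_dom \<epsilon>) ?f"
    by (intro Cn_on_add open_shift_dom C2_shifted_log Cn_on_norm_square)
  have ineq: "s / (1 - s) * bd_lhs ?f p \<tau> + \<kappa> \<le> bd_rhs ?f p \<tau>"
    if p: "p \<in> frontier \<Omega>" and \<tau>: "N p \<bullet> \<tau> = 0" "N p \<bullet> J \<tau> = 0" "norm \<tau> = 1" for p \<tau>
  proof -
    have "p \<in> shift_dom \<epsilon>" using p dm by blast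
    from kp[OF open_shift_dom C2_shifted_log this p, of \<tau>] ap[OF p \<tau>] show ?thesis by (simp add: \<tau>(3))
  qed
  obtain g where g: "\<And>m. Cn_on m UNIV g"
    "\<And>p \<tau>. p \<in> frontier \<Omega> \<Longrightarrow> N p \<bullet> \<tau> = 0 \<Longrightarrow> N p \<bullet> J \<tau> = 0 \<Longrightarrow> \<tau> \<noteq> 0 \<Longrightarrow> s / (1 - s) * bd_lhs g p \<tau> < bd_rhs g p \<tau>"
    by (rule smooth_replacement[OF open_shift_dom dm Cf k ineq]) blast+
  show ?thesis
  proof (rule that[OF g(1)])
    fix p \<tau> assume "(p, \<tau>) \<in> T10_boundary \<Omega>" and nz: "\<tau> \<noteq> 0"
    then have p: "p \<in> frontier \<Omega>" "N p \<bullet> \<tau> = 0" "N p \<bullet> J \<tau> = 0" by (auto simp: T10_iff)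
    show "ineq_lhs \<Omega> s g p \<tau> < ineq_rhs \<Omega> g p \<tau>"
      unfolding ineq_lhs_eq[OF open_UNIV g(1) UNIV_I in_U[OF p(1)]] ineq_rhs_eq[OF open_UNIV g(1) UNIV_I in_U[OF p(1)]]
      using g(2)[OF p nz] by (rule divide_strict_right_mono) simp
  qed
qed

end

section \<open>From the boundary inequality to a strictly plurisubharmonic power\<close>

context normal_field
begin

theorem strictly_psh_power_exists:
  assumes psc: "pseudoconvex \<Omega>" and k: "2 \<le> k" and sd: "Ck_on k U (sdist \<Omega>)"
    and s: "0 < \<eta>" "\<eta> < s" "s < 1" and Us: "open Us" "frontier \<Omega> \<subseteq> Us" and \<phi>: "Ck_on k Us \<phi>"
    and ineq: "\<And>p \<tau>. (p, \<tau>) \<in> T10_boundary \<Omega> \<Longrightarrow> ineq_lhs \<Omega> s \<phi> p \<tau> \<le> ineq_rhs \<Omega> \<phi> p \<tau>"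
  obtains W \<rho> Ue where "defining_function k \<Omega> W \<rho>" "nbhd_of_boundary Ue \<Omega>" "Ue \<subseteq> W"
    "strictly_psh_on (Ue \<inter> \<Omega>) (\<lambda>z. - ((- \<rho> z) powr \<eta>))"
proof -
  have k2: "enat 2 \<le> k" using k by (simp add: numeral_eq_enat)
  have r: "0 \<le> \<eta> / (1 - \<eta>)" "\<eta> / (1 - \<eta>) < s / (1 - s)" using s ratio_less[of \<eta> s] by auto
  obtain \<kappa> where kk: "0 < \<kappa>" and kp: "\<And>S (\<phi> :: complex^'n \<Rightarrow> real) p \<tau>. open S \<Longrightarrow> Cn_on 2 S \<phi> \<Longrightarrow> p \<in> S \<Longrightarrow> p \<in> frontier \<Omega> \<Longrightarrow>
    \<eta> / (1 - \<eta>) * bd_lhs (\<lambda>z. \<phi> z + \<kappa> * (z \<bullet> z)) p \<tau> + 2 * \<kappa> * (norm \<tau>)\<^sup>2 - bd_rhs (\<lambda>z. \<phi> z + \<kappa> * (z \<bullet> z)) p \<tau>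
      \<le> s / (1 - s) * bd_lhs \<phi> p \<tau> - bd_rhs \<phi> p \<tau>"
    by (rule strict_perturbation[OF r]) blast
  \<comment> \<open>The added term turns the weak inequality for s into the strict one for \<eta>
    that \<open>weighted_levi_pos\<close> asks for.\<close>
  define f where "f z = \<phi> z + \<kappa> * (z \<bullet> z)" for z
  let ?S = "Us \<inter> U"
  have S: "open ?S" "frontier \<Omega> \<subseteq> ?S" using Us open_U frontier_sub by auto
  have C\<phi>: "Cn_on m Us \<phi>" and Cr: "Cn_on m ?S (sdist \<Omega>)" if "enat m \<le> k" for m
    using \<phi> sd that Cn_on_subset[of m U "sdist \<Omega>" ?S] by (auto simp: Ck_on_def)
  have Cf: "Cn_on m ?S f" if "enat m \<le> k" for m
    unfolding f_def[abs_def] by (intro Cn_on_add S Cn_on_norm_square Cn_on_subset[OF C\<phi>[OF that]]) auto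
  have Rf: "\<eta> / (1 - \<eta>) * bd_lhs f p \<tau> + 2 * \<kappa> * (norm \<tau>)\<^sup>2 \<le> bd_rhs f p \<tau>"
    if p: "p \<in> frontier \<Omega>" and \<tau>: "N p \<bullet> \<tau> = 0" "N p \<bullet> J \<tau> = 0" for p \<tau>
  proof -
    have pUs: "p \<in> Us" using p Us by blast
    have "(p, \<tau>) \<in> T10_boundary \<Omega>" using p \<tau> by (simp add: T10_iff)
    from ineq[OF this] have "s / (1 - s) * bd_lhs \<phi> p \<tau> / 4 \<le> bd_rhs \<phi> p \<tau> / 4"
      unfolding ineq_lhs_eq[OF Us(1) C\<phi>[OF k2] pUs in_U[OF p]] ineq_rhs_eq[OF Us(1) C\<phi>[OF k2] pUs in_U[OF p]] .
    moreover have "x \<le> y" if "x / 4 \<le> y / 4" for x y :: real using that by simp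
    ultimately have "s / (1 - s) * bd_lhs \<phi> p \<tau> \<le> bd_rhs \<phi> p \<tau>" by blast
    with kp[OF Us(1) C\<phi>[OF k2] pUs p, of \<tau>] show ?thesis unfolding f_def[abs_def] by linarith
  qed
  have e1: "\<eta> < 1" using s by simp
  obtain d where d: "d > 0" "{z. infdist z (frontier \<Omega>) \<le> d} \<subseteq> ?S" 
    and pos: "\<And>q v. q \<in> \<Omega> \<Longrightarrow> infdist q (frontier \<Omega>) < d \<Longrightarrow> v \<noteq> 0 \<Longrightarrow> 0 < weighted_levi \<eta> f q v"
    by (rule weighted_levi_pos[OF psc S Int_lower2 Cf[OF k2] s(1) e1 kk Rf]) blast+
  define \<rho> where "\<rho> z = sdist \<Omega> z * exp (- f z)" for z
  have C\<rho>: "Cn_on m ?S \<rho>" if "enat m \<le> k" for m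
    unfolding \<rho>_def[abs_def]
    by (intro Cn_on_mult S Cr[OF that] Cn_on_compose[OF S(1) open_UNIV UNIV_I Cn_on_minus[OF S(1) Cf[OF that]] Cn_on_exp])
  have "FD \<rho> p \<noteq> (\<lambda>v. 0)" if p: "p \<in> frontier \<Omega>" for p
  proof -
    have pS: "p \<in> ?S" and pU: "p \<in> U" using p S by auto
    \<comment> \<open>The distance vanishes at \<open>p\<close>, so the derivative of the
      exponential factor contributes nothing.\<close>
    have "FD \<rho> p (N p) = exp (- f p)"
      unfolding \<rho>_def[abs_def]
      using FD_mult[OF Cr[OF k2] Cn_on_compose[OF S(1) open_UNIV UNIV_I Cn_on_minus[OF S(1) Cf[OF k2]] Cn_on_exp] _ pS, of "N p"]
        sdist_frontier[OF p] inner_N_self[OF pU] by (simp add: FD_sdist[OF pU])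
    then show ?thesis by (metis exp_not_eq_zero)
  qed
  then have df: "defining_function k \<Omega> ?S \<rho>"
    unfolding defining_function_def nbhd_of_boundary_def Ck_on_def
    using S C\<rho> sdist_frontier sdist_pos sdist_neg by (auto simp: \<rho>_def mult_neg_pos)
  let ?U = "{z. infdist z (frontier \<Omega>) < d}"
  have oU: "open ?U" by (intro open_Collect_less continuous_intros)
  have nb: "nbhd_of_boundary ?U \<Omega>" using oU d by (auto simp: nbhd_of_boundary_def)
  have sub: "?U \<subseteq> ?S" using d by auto
  let ?T = "?U \<inter> \<Omega>"
  have oT: "open ?T" using oU open_\<Omega> by blast
  have subT: "?T \<subseteq> ?S" "?T \<subseteq> U" "?T \<subseteq> \<Omega>" using sub by auto
  have neg: "\<rho> z < 0" if "z \<in> ?T" for z using that sdist_neg by (simp add: \<rho>_def mult_neg_pos)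
  have C2: "Cn_on 2 ?T \<rho>" by (rule Cn_on_subset[OF C\<rho>[OF k2] subT(1)])
  have C2pow: "Cn_on 2 ?T (\<lambda>z. - ((- \<rho> z) powr \<eta>))" by (rule Cn_on_neg_powr[OF oT C2 neg])
  have "strictly_psh_on ?T (\<lambda>z. - ((- \<rho> z) powr \<eta>))"
    unfolding strictly_psh_on_def
  proof (intro conjI ballI allI impI)
    show "Ck_on 2 ?T (\<lambda>z. - ((- \<rho> z) powr \<eta>))"
      unfolding Ck_on_def using Cn_on_mono[OF C2pow] by (simp add: numeral_eq_enat del: Cn_on.simps)
    fix q v assume q: "q \<in> ?T" and v: "v \<noteq> (0 :: complex^'n)"
    have "0 < weighted_levi \<eta> f q v" using pos q v by blast
    also have "weighted_levi \<eta> f q v = levi_re \<rho> q v / (- \<rho> q) + (1 - \<eta>) * grad_sq \<rho> q v / (\<rho> q)\<^sup>2"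
      using weighted_levi_eq[OF oT subT(2,3) Cn_on_subset[OF Cf[OF k2] subT(1)] q] unfolding \<rho>_def[abs_def] by simp
    finally have "0 < \<eta> * (- \<rho> q) powr \<eta> * (levi_re \<rho> q v / (- \<rho> q) + (1 - \<eta>) * grad_sq \<rho> q v / (\<rho> q)\<^sup>2)"
      using s(1) neg[OF q] by (intro mult_pos_pos) auto
    also have "\<dots> = levi_re (\<lambda>z. - ((- \<rho> z) powr \<eta>)) q v"
      by (rule levi_re_neg_powr[OF oT C2 neg q, symmetric])
    finally show "0 < Re (form11_at (i_del_delbar (\<lambda>z. complex_of_real (- ((- \<rho> z) powr \<eta>))) q) v v)"
      unfolding Re_levi[OF oT C2pow q] by simp
  qed
  with df nb sub show ?thesis using that by blast
qed

end

theorem proposition7p1: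
  fixes \<Omega> :: "(complex^'n) set" and k :: enat
  assumes "domain_set \<Omega>" and "bounded \<Omega>" and "pseudoconvex \<Omega>"
    and "3 \<le> k" and "has_Ck_boundary k \<Omega>"
  shows
    "(\<forall>(\<eta>::real) W \<rho> U\<^sub>\<eta>.
        0 < \<eta> \<and> \<eta> < 1 \<and> defining_function 2 \<Omega> W \<rho> \<and>
        nbhd_of_boundary U\<^sub>\<eta> \<Omega> \<and> U\<^sub>\<eta> \<subseteq> W \<and>
        psh_on (U\<^sub>\<eta> \<inter> \<Omega>) (\<lambda>z. - ((- \<rho> z) powr \<eta>)) \<longrightarrow>
        (\<forall>s. 0 < s \<and> s < \<eta> \<longrightarrow>
          (\<exists>U\<^sub>s \<phi>. nbhd_of_boundary U\<^sub>s \<Omega> \<and> U\<^sub>s \<subseteq> U\<^sub>\<eta> \<and> Ck_on \<infinity> U\<^sub>s \<phi> \<and>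
             (\<forall>(p, \<tau>)\<in>T10_boundary \<Omega>. \<tau> \<noteq> 0 \<longrightarrow> ineq_lhs \<Omega> s \<phi> p \<tau> < ineq_rhs \<Omega> \<phi> p \<tau>))))
     \<and>
     (\<forall>(s::real) U\<^sub>s \<phi>.
        0 < s \<and> s < 1 \<and> nbhd_of_boundary U\<^sub>s \<Omega> \<and> Ck_on k U\<^sub>s \<phi> \<and>
        (\<forall>(p, \<tau>)\<in>T10_boundary \<Omega>. ineq_lhs \<Omega> s \<phi> p \<tau> \<le> ineq_rhs \<Omega> \<phi> p \<tau>) \<longrightarrow>
        (\<forall>\<eta>. 0 < \<eta> \<and> \<eta> < s \<longrightarrow>
          (\<exists>W \<rho> U\<^sub>\<eta>. defining_function k \<Omega> W \<rho> \<and>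
             nbhd_of_boundary U\<^sub>\<eta> \<Omega> \<and> U\<^sub>\<eta> \<subseteq> W \<and>
             strictly_psh_on (U\<^sub>\<eta> \<inter> \<Omega>) (\<lambda>z. - ((- \<rho> z) powr \<eta>)))))"
proof -
  have op: "open \<Omega>" using assms(1) by (simp add: domain_set_def)
  have "\<Omega> \<noteq> UNIV" using assms(2) not_bounded_UNIV by blast
  then have ne: "frontier \<Omega> \<noteq> {}" using assms(1) by (simp add: domain_set_def frontier_eq_empty)
  have k2: "2 \<le> k" using assms(4) by (rule order_trans[rotated]) simp
  \<comment> \<open>The bound with \<open>Suc 2\<close> is what makes the gradient of the distance,
    one order below the boundary, of class C^2.\<close>
  have e2: "enat 2 \<le> k" "enat (Suc 2) \<le> k" using k2 assms(4) by (simp_all add: numeral_eq_enat)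
  obtain U where U: "open U" "frontier \<Omega> \<subseteq> U" "Ck_on k U (sdist \<Omega>)"
    "\<And>m. enat (Suc m) \<le> k \<Longrightarrow> Cn_on m U (grad (sdist \<Omega>))"
    "\<And>z. z \<in> U \<Longrightarrow> (sdist \<Omega> has_derivative (\<lambda>v. grad (sdist \<Omega>) z \<bullet> v)) (at z)"
    "\<And>z. z \<in> U \<Longrightarrow> norm (grad (sdist \<Omega>) z) = 1"
    "\<And>z. z \<in> U \<Longrightarrow> z - sdist \<Omega> z *\<^sub>R grad (sdist \<Omega>) z \<in> frontier \<Omega>"
    "\<And>z. z \<in> U \<Longrightarrow> grad (sdist \<Omega>) (z - sdist \<Omega> z *\<^sub>R grad (sdist \<Omega>) z) = grad (sdist \<Omega>) z"
    using sdist_regular[OF op assms(5) k2] by metis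
  have C2: "Cn_on 2 U (sdist \<Omega>)" using U(3) e2(1) unfolding Ck_on_def by blast
  interpret normal_field \<Omega> U "grad (sdist \<Omega>)"
    by unfold_locales (fact op assms(2) ne U(1,2) C2 U(4)[OF e2(2)] U(5-8))+
  show ?thesis
  proof (intro conjI allI impI; (elim conjE)?)
    fix \<eta> :: real and W \<rho> U\<^sub>\<eta> and s :: real
    assume \<eta>: "0 < \<eta>" "\<eta> < 1" and df: "defining_function 2 \<Omega> W \<rho>" and nb: "nbhd_of_boundary U\<^sub>\<eta> \<Omega>" and sub: "U\<^sub>\<eta> \<subseteq> W"
      and psh: "psh_on (U\<^sub>\<eta> \<inter> \<Omega>) (\<lambda>z. - ((- \<rho> z) powr \<eta>))" and s: "0 < s" "s < \<eta>"
    interpret boundary_psh \<Omega> U "grad (sdist \<Omega>)" W \<rho> U\<^sub>\<eta> \<eta>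
      using df nb sub psh \<eta> by unfold_locales (auto simp: nbhd_of_boundary_def)
    obtain g where g: "\<And>m. Cn_on m UNIV g"
      "\<And>p \<tau>. (p, \<tau>) \<in> T10_boundary \<Omega> \<Longrightarrow> \<tau> \<noteq> 0 \<Longrightarrow> ineq_lhs \<Omega> s g p \<tau> < ineq_rhs \<Omega> g p \<tau>"
      by (rule smooth_solution[OF s]) blast+
    show "\<exists>U\<^sub>s \<phi>. nbhd_of_boundary U\<^sub>s \<Omega> \<and> U\<^sub>s \<subseteq> U\<^sub>\<eta> \<and> Ck_on \<infinity> U\<^sub>s \<phi> \<and>
             (\<forall>(p, \<tau>)\<in>T10_boundary \<Omega>. \<tau> \<noteq> 0 \<longrightarrow> ineq_lhs \<Omega> s \<phi> p \<tau> < ineq_rhs \<Omega> \<phi> p \<tau>)"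
    proof (intro exI conjI)
      \<comment> \<open>The function is smooth on the whole space, so \<open>U\<^sub>\<eta>\<close>
        itself can be taken as the smaller neighbourhood.\<close>
      show "Ck_on \<infinity> U\<^sub>\<eta> g" unfolding Ck_on_def using Cn_on_subset[OF g(1)] by blast
      show "\<forall>(p, \<tau>)\<in>T10_boundary \<Omega>. \<tau> \<noteq> 0 \<longrightarrow> ineq_lhs \<Omega> s g p \<tau> < ineq_rhs \<Omega> g p \<tau>"
        using g(2) by blast
    qed (use nb in auto)
  next
    fix s :: real and U\<^sub>s \<phi> and \<eta> :: real
    assume s: "0 < s" "s < 1" and nb: "nbhd_of_boundary U\<^sub>s \<Omega>" and \<phi>: "Ck_on k U\<^sub>s \<phi>"
      and ineq: "\<forall>(p, \<tau>)\<in>T10_boundary \<Omega>. ineq_lhs \<Omega> s \<phi> p \<tau> \<le> ineq_rhs \<Omega> \<phi> p \<tau>" and \<eta>: "0 < \<eta>" "\<eta> < s"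
    have Us: "open U\<^sub>s" "frontier \<Omega> \<subseteq> U\<^sub>s" using nb by (auto simp: nbhd_of_boundary_def)
    obtain W \<rho> Ue where "defining_function k \<Omega> W \<rho>" "nbhd_of_boundary Ue \<Omega>" "Ue \<subseteq> W"
      "strictly_psh_on (Ue \<inter> \<Omega>) (\<lambda>z. - ((- \<rho> z) powr \<eta>))"
      by (rule strictly_psh_power_exists[OF assms(3) k2 U(3) \<eta> s(2) Us \<phi>]) (use ineq in blast)+
    then show "\<exists>W \<rho> U\<^sub>\<eta>. defining_function k \<Omega> W \<rho> \<and> nbhd_of_boundary U\<^sub>\<eta> \<Omega> \<and> U\<^sub>\<eta> \<subseteq> W \<and>
             strictly_psh_on (U\<^sub>\<eta> \<inter> \<Omega>) (\<lambda>z. - ((- \<rho> z) powr \<eta>))" by blast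
  qed
qed

end
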